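(* Let $r,t\geq 2$ be integers and $\varepsilon>0$. Every classical streaming algorithm that gives an $(r-\varepsilon)$-approximation for Unique Games on $n$-vertex hypergraphs with hyperedges of size at most $t$ over alphabet $\mathbb{Z}_r$, with success probability at least $2/3$ over its internal randomness, needs $\Omega((n/t)^{1-1/t})$ bits of space, where the $\Omega$ hides dependence on $r$ and $\varepsilon$.
   Context: A Unique Games instance on a hypergraph $H=(V,E)$, $|V|=n$, assigns to each hyperedge $e\in E$ (a subset of $V$ of size at most $t$) a linear constraint $\pi_e:\mathbb{Z}_r^{|e|}\to\{0,1\}$ (e.g. $\pi_e(x_e)=[\sum_{i\in e}x_i=q_e]$ for some $q_e\in\mathbb{Z}_r$); its value is $\mathrm{OPT}=\max_{x\in\mathbb{Z}_r^n}\sum_{e\in E}\pi_e(x_e)$. An algorithm gives a $\gamma$-approximation with success probability $2/3$ if on every input it outputs a value in $[\mathrm{OPT}/\gamma,\mathrm{OPT}]$ with probability at least $2/3$. In the (adversarial) streaming model the hyperedges together with their constraints arrive one at a time in an arbitrary order, and the algorithm must output its answer at the end using limited memory. *)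

theory Defs
  imports "HOL-Probability.Probability_Mass_Function" "HOL-Number_Theory.Cong" "HOL-Library.FuncSet"
begin

section \<open>Unique Games on hypergraphs\<close>

text \<open>
  The vertex set is \<open>{..<n}\<close>, and elements of \<open>\<int>\<^sub>r\<close> are represented by the integers in
  \<open>{0..<int r}\<close>. A constraint on a hyperedge \<open>e\<close> reads a whole assignment; a linear one depends
  only on its restriction to \<open>e\<close>, modulo \<open>r\<close>.
\<close>

type_synonym constr = "(nat \<Rightarrow> int) \<Rightarrow> bool"

definition linear_constr :: "nat \<Rightarrow> nat set \<Rightarrow> constr \<Rightarrow> bool" where
  "linear_constr r e \<pi> \<longleftrightarrow>
     (\<exists>(a :: nat \<Rightarrow> int) (q :: int). \<pi> = (\<lambda>x. [(\<Sum>i\<in>e. a i * x i) = q] (mod int r)))"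

definition unique_games :: "nat \<Rightarrow> nat \<Rightarrow> nat \<Rightarrow> nat set set \<Rightarrow> (nat set \<Rightarrow> constr) \<Rightarrow> bool" where
  "unique_games r t n E \<pi> \<longleftrightarrow>
     (\<forall>e\<in>E. e \<subseteq> {..<n} \<and> card e \<le> t \<and> linear_constr r e (\<pi> e))"

definition ug_value :: "nat set set \<Rightarrow> (nat set \<Rightarrow> constr) \<Rightarrow> (nat \<Rightarrow> int) \<Rightarrow> nat" where
  "ug_value E \<pi> x = (\<Sum>e\<in>E. of_bool (\<pi> e x))"

definition ug_opt :: "nat \<Rightarrow> nat \<Rightarrow> nat set set \<Rightarrow> (nat set \<Rightarrow> constr) \<Rightarrow> nat" where
  "ug_opt r n E \<pi> = Max (ug_value E \<pi> ` ({..<n} \<rightarrow>\<^sub>E {0..<int r}))"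

section \<open>Streaming algorithms\<close>

type_synonym stream_item = "nat set \<times> constr"

text \<open>
  The streams of an instance: the hyperedges with their constraints, each once, in any order.
\<close>

definition ug_streams :: "nat set set \<Rightarrow> (nat set \<Rightarrow> constr) \<Rightarrow> stream_item list set" where
  "ug_streams E \<pi> = {map (\<lambda>e. (e, \<pi> e)) es | es. distinct es \<and> set es = E}"

text \<open>
  The memory content is a bit string. There are two sources of internal randomness, neither of
  which is charged as space: a read-only random tape, drawn once and available throughout (its
  content coded as a natural number), and fresh random choices in the initialisation, in each
  update and in the final output. The transition functions are otherwise arbitrary, so the model
  is non-uniform and computation time is unrestricted.
\<close>

record streaming_alg =
  tape :: "nat pmf"
  init :: "nat \<Rightarrow> bool list pmf"
  step :: "nat \<Rightarrow> stream_item \<Rightarrow> bool list \<Rightarrow> bool list pmf"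
  answer :: "nat \<Rightarrow> bool list \<Rightarrow> real pmf"

definition memory_after :: "streaming_alg \<Rightarrow> nat \<Rightarrow> stream_item list \<Rightarrow> bool list pmf" where
  "memory_after A \<omega> \<sigma> = foldl (\<lambda>M i. bind_pmf M (step A \<omega> i)) (init A \<omega>) \<sigma>"

definition output_dist :: "streaming_alg \<Rightarrow> stream_item list \<Rightarrow> real pmf" where
  "output_dist A \<sigma> = bind_pmf (tape A) (\<lambda>\<omega>. bind_pmf (memory_after A \<omega> \<sigma>) (answer A \<omega>))"

text \<open>
  Every prefix of a stream of an instance is itself a stream of an instance, so the following
  bounds the memory at all times during the run.
\<close>

definition ug_space_at_most :: "nat \<Rightarrow> nat \<Rightarrow> nat \<Rightarrow> streaming_alg \<Rightarrow> nat \<Rightarrow> bool" where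
  "ug_space_at_most r t n A s \<longleftrightarrow>
     (\<forall>E \<pi>. unique_games r t n E \<pi> \<longrightarrow>
       (\<forall>\<sigma>\<in>ug_streams E \<pi>. \<forall>\<omega>\<in>set_pmf (tape A). \<forall>m\<in>set_pmf (memory_after A \<omega> \<sigma>). length m \<le> s))"

text \<open>
  Approximation factors are positive: for \<open>\<gamma> \<le> 0\<close> the interval below would degenerate and
  always contain \<open>0\<close>.
\<close>

definition ug_approx :: "nat \<Rightarrow> nat \<Rightarrow> nat \<Rightarrow> real \<Rightarrow> real \<Rightarrow> streaming_alg \<Rightarrow> bool" where
  "ug_approx r t n \<gamma> p A \<longleftrightarrow> 0 < \<gamma> \<and>
     (\<forall>E \<pi>. unique_games r t n E \<pi> \<longrightarrow>
       (\<forall>\<sigma>\<in>ug_streams E \<pi>.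
          p \<le> measure_pmf.prob (output_dist A \<sigma>)
                {real (ug_opt r n E \<pi>) / \<gamma> .. real (ug_opt r n E \<pi>)}))"

end

theory Submission
  imports Defs "HOL-Probability.Probability"
begin

text \<open>
  The hard streams consist of \<open>B\<^sup>2\<close> stages, each of which is a random partial matching of
  \<open>t\<close>-element hyperedges across \<open>t\<close> parts. In a yes stream all labels are consistent with one
  hidden random assignment, so every constraint can be satisfied; in a no stream the labels are
  uniform, and by a Chernoff bound no assignment satisfies much more than a fraction \<open>1/r\<close> of them.

  The two are compared by a hybrid argument over the stages. For a memory content \<open>a\<close> before some
  stage, let \<open>f x\<close> be the probability of reaching \<open>a\<close> when the hidden assignment is \<open>x\<close>. It takes
  values in \<open>[0,1]\<close> and, with \<open>s\<close> bits of memory, typically has mean at least about \<open>2\<^sup>-\<^sup>s\<close>.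
  The distance of the labels of the next stage from uniform, given \<open>a\<close>, is controlled by the Fourier
  coefficients of \<open>f\<close> at those characters that are constant on the hyperedges of the matching.
  Hypercontractivity bounds the Fourier mass of \<open>f\<close> at each level, and a fixed character of weight
  \<open>t l\<close> is of this form with probability at most \<open>(m choose l) / (N choose l)\<^sup>t\<close>, where \<open>N\<close> is
  the size of the parts and \<open>m\<close> the number of hyperedges of a stage. The resulting sum is small as
  long as \<open>s\<close> is at most a small multiple of \<open>t N\<^bsup>1 - 1/t\<^esup>\<close>, which makes the loss over all stages small.
\<close>

section \<open>Power means and characters of \<open>\<int>\<^sub>r\<^sup>V\<close>\<close>

text \<open>The union bound over \<open>r ^ n\<close> assignments needs on the order of n log r
  hyperedges, but the Fourier bound tolerates at most N / (64 r)^2 of them per stage; hence many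
  stages. An instance carries one constraint per hyperedge, so hyperedges of different stages must
  differ as sets. Giving B blocks to only two of the parts separates \<open>B * B\<close> stages
  with 2 B + t - 2 blocks. With B proportional to t, the part size N is of order n / t, the source
  of n / t in the bound. The number of stages then grows like t^2, but the loss per stage is
  exponentially small in t. In each hybrid the consistent stages come first and the uniform ones
  last, so the rest of the run depends on the past only through the memory content. Replacing one
  stage therefore involves only the joint law of hidden assignment and memory. \<open>S\<close> is a
  threshold with S >= 2 s + 2: contents reached with probability below 2^(-S) are given up at a
  total cost of \<open>2 ^ Suc s * (1/2) ^ S\<close>, and the level inequality handles the
  others.\<close>

lemma power_weighted_mean:
  fixes a z :: "'i \<Rightarrow> real"
  assumes "finite I" "\<And>i. i \<in> I \<Longrightarrow> 0 \<le> a i" "\<And>i. i \<in> I \<Longrightarrow> 0 \<le> z i"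
  shows "(\<Sum>i\<in>I. a i * z i) ^ Suc k \<le> (\<Sum>i\<in>I. a i) ^ k * (\<Sum>i\<in>I. a i * z i ^ Suc k)"
proof (cases "(\<Sum>i\<in>I. a i) = 0")
  case True
  then have "\<And>i. i \<in> I \<Longrightarrow> a i = 0"
    using assms by (simp add: sum_nonneg_eq_0_iff)
  then show ?thesis by simp
next
  case False
  define A where "A = (\<Sum>i\<in>I. a i)"
  have A: "A > 0"
    using False sum_nonneg[OF assms(2)] unfolding A_def by (simp add: less_le)
  have cvx: "convex_on {0::real..} (\<lambda>x. x ^ Suc k)"
  proof (cases "even (Suc k)")
    case True
    then show ?thesis
      using convex_power_even convex_on_subset by blast
  next
    case False
    then show ?thesis by (rule convex_power_odd)
  qed
  \<comment> \<open>Jensen's inequality with the weights \<open>a i / A\<close>. Multiplied out, it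
    also covers total weight 0; it serves below both for Minkowski and for Hoelder.\<close>
  have "(\<Sum>i\<in>I. (a i / A) *\<^sub>R z i) ^ Suc k \<le> (\<Sum>i\<in>I. (a i / A) * z i ^ Suc k)"
    using A assms False unfolding A_def
    by (intro convex_on_sum[OF _ _ cvx[unfolded A_def]]) (auto simp flip: sum_divide_distrib)
  then have "(\<Sum>i\<in>I. a i * z i) ^ Suc k / A ^ Suc k \<le> (\<Sum>i\<in>I. a i * z i ^ Suc k) / A"
    by (simp add: sum_divide_distrib power_divide flip: sum_divide_distrib)
  then show ?thesis
    using A unfolding A_def[symmetric] by (simp add: field_simps)
qed

text \<open>Minkowski's inequality for exponent k + 1, free of roots: after writing
  \<open>F i x = C i * z i x\<close>, Jensen with the weights \<open>C i\<close> reduces the sum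
  over i to the individual bounds. Applied to squared moduli, it gives the induction step of
  \<open>hypercontractive_vecs\<close>.\<close>

lemma Minkowski_power:
  fixes F :: "'i \<Rightarrow> 'x \<Rightarrow> real"
  assumes "finite I" "\<And>i x. i \<in> I \<Longrightarrow> x \<in> X \<Longrightarrow> 0 \<le> F i x" "\<And>i. i \<in> I \<Longrightarrow> 0 \<le> C i"
    and "finite X" "R \<ge> 0"
    and bound: "\<And>i. i \<in> I \<Longrightarrow> (\<Sum>x\<in>X. F i x ^ Suc k) \<le> R * C i ^ Suc k"
  shows "(\<Sum>x\<in>X. (\<Sum>i\<in>I. F i x) ^ Suc k) \<le> R * (\<Sum>i\<in>I. C i) ^ Suc k"
proof -
  \<comment> \<open>If \<open>C i = 0\<close>, the bound forces \<open>F i\<close> to vanish on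
    \<open>X\<close>, so 0 is a valid value for the quotient.\<close>
  define z where "z i x = (if C i = 0 then 0 else F i x / C i)" for i x
  have Fz: "F i x = C i * z i x" if "i \<in> I" "x \<in> X" for i x
  proof (cases "C i = 0")
    case True
    have "(\<Sum>x\<in>X. F i x ^ Suc k) \<le> 0"
      using bound[OF that(1)] True by simp
    moreover have "F i x ^ Suc k \<le> (\<Sum>x\<in>X. F i x ^ Suc k)"
      using assms that by (intro member_le_sum) auto
    ultimately have "F i x ^ Suc k \<le> 0" by linarith
    then have "F i x = 0"
      using assms(2)[OF that] by (metis antisym_conv zero_less_power linorder_not_le order_less_le)
    then show ?thesis using True by simp
  qed (simp add: z_def)
  have "(\<Sum>x\<in>X. (\<Sum>i\<in>I. F i x) ^ Suc k) = (\<Sum>x\<in>X. (\<Sum>i\<in>I. C i * z i x) ^ Suc k)"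
    using Fz by (intro sum.cong refl arg_cong[where f="\<lambda>y. y ^ Suc k"]) auto
  also have "\<dots> \<le> (\<Sum>x\<in>X. (\<Sum>i\<in>I. C i) ^ k * (\<Sum>i\<in>I. C i * z i x ^ Suc k))"
    using assms by (intro sum_mono power_weighted_mean) (auto simp: z_def)
  also have "\<dots> = (\<Sum>i\<in>I. C i) ^ k * (\<Sum>i\<in>I. C i * (\<Sum>x\<in>X. z i x ^ Suc k))"
    unfolding sum_distrib_left[symmetric] by (subst sum.swap) (simp add: sum_distrib_left)
  also have "\<dots> \<le> (\<Sum>i\<in>I. C i) ^ k * (\<Sum>i\<in>I. C i * R)"
  proof (rule mult_left_mono[OF sum_mono])
    fix i assume i: "i \<in> I"
    show "C i * (\<Sum>x\<in>X. z i x ^ Suc k) \<le> C i * R"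
    proof (cases "C i = 0")
      case False
      then have "C i > 0" using assms(3)[OF i] by simp
      have "(\<Sum>x\<in>X. z i x ^ Suc k) = (\<Sum>x\<in>X. F i x ^ Suc k) / C i ^ Suc k"
        using False by (simp add: z_def power_divide sum_divide_distrib del: power_Suc)
      also have "\<dots> \<le> R"
        using bound[OF i] \<open>C i > 0\<close> by (simp add: divide_le_eq del: power_Suc)
      finally show ?thesis using \<open>C i > 0\<close> by simp
    qed simp
  qed (use assms in \<open>auto intro!: zero_le_power sum_nonneg\<close>)
  also have "\<dots> = R * (\<Sum>i\<in>I. C i) ^ Suc k"
    by (simp add: sum_distrib_left[symmetric] sum_distrib_right[symmetric] mult_ac)
  finally show ?thesis .
qed

section \<open>Roots of unity and characters\<close>

definition root_pow :: "nat \<Rightarrow> nat \<Rightarrow> complex" where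
  "root_pow r k = cis (2 * pi * real k / real r)"

lemma root_pow_0 [simp]: "root_pow r 0 = 1"
  by (simp add: root_pow_def)

lemma root_pow_add: "root_pow r (a + b) = root_pow r a * root_pow r b"
  by (simp add: root_pow_def cis_mult add_divide_distrib distrib_left)

lemma root_pow_mult: "root_pow r (a * b) = root_pow r a ^ b"
proof -
  have "2 * pi * real (a * b) / real r = real b * (2 * pi * real a / real r)" by simp
  then show ?thesis unfolding root_pow_def by (simp only: Complex.DeMoivre)
qed

lemma root_pow_sum: "root_pow r (\<Sum>i\<in>A. f i) = (\<Prod>i\<in>A. root_pow r (f i))"
  by (induction A rule: infinite_finite_induct) (simp_all add: root_pow_add)

lemma root_pow_self [simp]: "r > 0 \<Longrightarrow> root_pow r r = 1"
  by (simp add: root_pow_def)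

lemma root_pow_mod [simp]: "r > 0 \<Longrightarrow> root_pow r (k mod r) = root_pow r k"
proof -
  assume "r > 0"
  have "root_pow r k = root_pow r (r * (k div r) + k mod r)" by simp
  also have "\<dots> = root_pow r (k mod r)"
    using \<open>r > 0\<close> by (simp only: root_pow_add root_pow_mult root_pow_self) simp
  finally show ?thesis by simp
qed

lemma root_pow_cnj_mult [simp]: "root_pow r k * cnj (root_pow r k) = 1"
  by (simp add: root_pow_def complex_norm_square[symmetric])

text \<open>For u different from u' this is a geometric sum whose ratio is an r-th root of unity
  other than 1.\<close>

lemma root_pow_orthogonal:
  assumes "u < r" "u' < r"
  shows "(\<Sum>y<r. root_pow r (u * y) * cnj (root_pow r (u' * y))) = (if u = u' then of_nat r else 0)"
proof (cases "u = u'")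
  case False
  define z where "z = root_pow r u * cnj (root_pow r u')"
  have r: "r > 0" using assms by simp
  have inj: "inj_on (\<lambda>k. cis (2 * pi * real k / real r)) {..<r}"
    using Complex.bij_betw_roots_unity[OF r] by (simp add: bij_betw_def)
  have z1: "z \<noteq> 1"
  proof
    assume "z = 1"
    then have "root_pow r u * cnj (root_pow r u') * root_pow r u' = root_pow r u'"
      by (simp add: z_def)
    then have "root_pow r u = root_pow r u'"
      by (simp add: mult.assoc mult.commute[of "cnj _"])
    then show False
      using inj_onD[OF inj, of u u'] assms False by (simp add: root_pow_def)
  qed
  have "z ^ r = root_pow r u ^ r * cnj (root_pow r u' ^ r)"
    by (simp add: z_def power_mult_distrib)
  also have "\<dots> = 1"
    using r by (simp add: mult.commute[of _ r] root_pow_mult flip: root_pow_mult)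
       (simp add: root_pow_mult)
  finally have zr: "z ^ r = 1" .
  have "(\<Sum>y<r. root_pow r (u * y) * cnj (root_pow r (u' * y))) = (\<Sum>y<r. z ^ y)"
    by (simp add: z_def root_pow_mult power_mult_distrib)
  also have "\<dots> = 0"
    using z1 zr by (simp add: sum_gp_strict)
  finally show ?thesis using False by simp
qed simp

definition chr :: "nat \<Rightarrow> 'a set \<Rightarrow> ('a \<Rightarrow> nat) \<Rightarrow> ('a \<Rightarrow> nat) \<Rightarrow> complex" where
  "chr r V u x = root_pow r (\<Sum>i\<in>V. u i * x i)"

abbreviation vecs :: "nat \<Rightarrow> 'a set \<Rightarrow> ('a \<Rightarrow> nat) set" where
  "vecs r V \<equiv> V \<rightarrow>\<^sub>E {..<r}"

text \<open>The symmetry turns orthogonality of characters into orthogonality over frequencies, as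
  needed in \<open>fourier_inversion\<close>.\<close>

lemma chr_commute: "chr r V u x = chr r V x u"
  by (simp add: chr_def mult.commute)

lemma finite_vecs [simp]: "finite V \<Longrightarrow> finite (vecs r V)"
  by (simp add: finite_PiE)

lemma card_vecs: "finite V \<Longrightarrow> card (vecs r V) = r ^ card V"
  by (simp add: card_PiE)

lemma sum_vecs_insert:
  assumes "finite V" "a \<notin> V"
  shows "(\<Sum>x\<in>vecs r (insert a V). g x) = (\<Sum>x\<in>vecs r V. \<Sum>y<r. g (x(a := y)))"
proof -
  have "(\<Sum>x\<in>vecs r (insert a V). g x) = (\<Sum>(y, x)\<in>{..<r} \<times> vecs r V. g (x(a := y)))"
    unfolding PiE_insert_eq using assms
    by (subst sum.reindex[OF inj_combinator]) (auto simp: case_prod_beta)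
  also have "\<dots> = (\<Sum>y<r. \<Sum>x\<in>vecs r V. g (x(a := y)))"
    by (simp add: sum.cartesian_product)
  finally show ?thesis by (simp add: sum.swap[of _ "{..<r}"])
qed

lemma chr_insert:
  assumes "finite V" "a \<notin> V"
  shows "chr r (insert a V) (u(a := b)) (x(a := y)) = root_pow r (b * y) * chr r V u x"
proof -
  have "(\<Sum>i\<in>V. (u(a := b)) i * (x(a := y)) i) = (\<Sum>i\<in>V. u i * x i)"
    using assms by (intro sum.cong) auto
  then show ?thesis
    using assms by (simp add: chr_def root_pow_add)
qed

text \<open>The sum factors over the coordinates, and a single coordinate where u and u' differ
  makes its factor 0.\<close>

lemma chr_orthogonal:
  assumes "finite V" "u \<in> vecs r V" "u' \<in> vecs r V"
  shows "(\<Sum>x\<in>vecs r V. chr r V u x * cnj (chr r V u' x)) = (if u = u' then of_nat (r ^ card V) else 0)"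
proof -
  have "(\<Sum>x\<in>vecs r V. chr r V u x * cnj (chr r V u' x))
      = (\<Sum>x\<in>vecs r V. \<Prod>i\<in>V. root_pow r (u i * x i) * cnj (root_pow r (u' i * x i)))"
    by (simp add: chr_def root_pow_sum prod.distrib)
  also have "\<dots> = (\<Prod>i\<in>V. \<Sum>y<r. root_pow r (u i * y) * cnj (root_pow r (u' i * y)))"
    using assms(1) by (subst prod_sum_PiE) auto
  also have "\<dots> = (\<Prod>i\<in>V. if u i = u' i then of_nat r else 0)"
    using assms by (intro prod.cong refl root_pow_orthogonal) auto
  also have "\<dots> = (if u = u' then of_nat (r ^ card V) else 0)"
  proof (cases "u = u'")
    case False
    then obtain i where "i \<in> V" "u i \<noteq> u' i"
      using assms by (metis PiE_ext)
    then show ?thesis using False assms(1) by (auto simp: prod_zero_iff)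
  qed simp
  finally show ?thesis .
qed

section \<open>Hypercontractivity\<close>

lemma one_add_power_le_quadratic:
  fixes z :: real
  assumes "-1 \<le> z" "\<bar>real k * z\<bar> \<le> 1"
  shows "(1 + z) ^ k \<le> 1 + real k * z + (real k * z)\<^sup>2"
proof -
  have "(1 + z) ^ k \<le> exp z ^ k"
    using assms by (intro power_mono) auto
  also have "\<dots> = exp (real k * z)"
    by (simp add: exp_of_nat_mult)
  also have "\<dots> \<le> 1 + real k * z + (real k * z)\<^sup>2"
  proof (cases "real k * z \<ge> 0")
    case True
    then show ?thesis using exp_bound[of "real k * z"] assms by simp
  next
    case False
    define w where "w = - (real k * z)"
    have w: "0 < w" "w \<le> 1" using False assms(2) unfolding w_def by linarith+
    have "1 + w \<le> exp w" by (rule exp_ge_add_one_self)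
    then have "exp (- w) \<le> 1 / (1 + w)"
      using w by (simp add: exp_minus field_simps)
    \<comment> \<open>Indeed (1 + w) (1 - w + w^2) = 1 + w^3.\<close>
    also have "\<dots> \<le> 1 - w + w\<^sup>2"
    proof -
      have "1 \<le> (1 + w) * (1 - w + w\<^sup>2)"
        using w by (simp add: algebra_simps power2_eq_square)
      then show ?thesis using w by (simp add: divide_le_eq mult.commute)
    qed
    finally show ?thesis by (simp add: w_def power2_eq_square)
  qed
  finally show ?thesis .
qed

text \<open>Mean zero removes the first-order contribution of g, so the k-th moment grows only at
  second order in \<rho>, where Bernoulli's inequality leaves room of size k G^2 / |a|^2. The factor
  \<open>card Y\<close> in the smallness condition pays for passing from the mean square of g to its
  maximum.\<close>

lemma mean_zero_perturbation_moment:
  fixes g :: "'y \<Rightarrow> complex" and a :: complex and \<rho> G :: real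
  assumes Y: "finite Y" "Y \<noteq> {}" and "k > 0" "\<rho> \<ge> 0" and \<rho>: "16 * real (card Y) * real k * \<rho>\<^sup>2 \<le> 1"
    and mean: "(\<Sum>y\<in>Y. g y) = 0" and G: "G \<ge> 0" "(\<Sum>y\<in>Y. (norm (g y))\<^sup>2) = real (card Y) * G\<^sup>2"
  shows "(\<Sum>y\<in>Y. (norm (a + \<rho> * g y))\<^sup>2 ^ k) \<le> real (card Y) * ((norm a)\<^sup>2 + G\<^sup>2) ^ k"
proof -
  define R where "R = real (card Y)"
  define b where "b = \<rho> * sqrt R"
  have R: "R \<ge> 1" using Y by (simp add: R_def Suc_leI card_gt_0_iff)
  have b0: "b \<ge> 0" using \<open>\<rho> \<ge> 0\<close> R by (simp add: b_def)
  have b2: "b\<^sup>2 = \<rho>\<^sup>2 * R" using R by (simp add: b_def power_mult_distrib)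
  have kb: "16 * real k * b\<^sup>2 \<le> 1" using \<rho> by (simp add: b2 R_def mult_ac)
  have k1: "real k \<ge> 1" using \<open>k > 0\<close> by simp
  have "16 * b\<^sup>2 \<le> 16 * real k * b\<^sup>2" using k1 by (simp add: mult_right_mono)
  then have "b\<^sup>2 \<le> (1/4)\<^sup>2" using kb by (simp add: power2_eq_square)
  then have b4: "b \<le> 1/4" by (rule power2_le_imp_le) simp
  have gb: "\<rho> * norm (g y) \<le> b * G" if "y \<in> Y" for y
  proof -
    have "(norm (g y))\<^sup>2 \<le> (\<Sum>y\<in>Y. (norm (g y))\<^sup>2)"
      using Y that by (intro member_le_sum) auto
    then have "norm (g y) \<le> sqrt (R * G\<^sup>2)"
      by (intro real_le_rsqrt) (simp add: G R_def)
    also have "\<dots> = sqrt R * G" using G by (simp add: real_sqrt_mult)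
    finally show ?thesis
      using \<open>\<rho> \<ge> 0\<close> by (simp add: b_def mult_left_mono mult.assoc)
  qed
  \<comment> \<open>If G dominates, the cross term 2 b |a| G is at most (2/3) G^2 and the bound
    holds pointwise. Otherwise G / |a| is at most 3 b, and relative to a the perturbation is small
    enough for a quadratic expansion of the k-th power.\<close>
  show ?thesis
  proof (cases "3 * b * norm a \<le> G")
    case True
    have "(norm (a + \<rho> * g y))\<^sup>2 ^ k \<le> ((norm a)\<^sup>2 + G\<^sup>2) ^ k" if "y \<in> Y" for y
    proof (intro power_mono)
      have "norm (a + \<rho> * g y) \<le> norm a + \<rho> * norm (g y)"
        using \<open>\<rho> \<ge> 0\<close> by (metis norm_triangle_ineq norm_mult norm_of_real abs_of_nonneg)
      also have "\<dots> \<le> norm a + b * G" using gb[OF that] by simp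
      finally have "(norm (a + \<rho> * g y))\<^sup>2 \<le> (norm a + b * G)\<^sup>2"
        by (rule power_mono) simp
      also have "\<dots> = (norm a)\<^sup>2 + (2 / 3) * G * (3 * b * norm a) + b\<^sup>2 * G\<^sup>2"
        by (simp add: power2_eq_square algebra_simps)
      also have "\<dots> \<le> (norm a)\<^sup>2 + (2 / 3) * G * G + (1/16) * G\<^sup>2"
        using True G \<open>b\<^sup>2 \<le> (1/4)\<^sup>2\<close>
        by (intro add_mono mult_left_mono mult_right_mono) (auto simp: power2_eq_square)
      also have "\<dots> \<le> (norm a)\<^sup>2 + G\<^sup>2" by (simp add: power2_eq_square)
      finally show "(norm (a + \<rho> * g y))\<^sup>2 \<le> (norm a)\<^sup>2 + G\<^sup>2" .
    qed simp
    then have "(\<Sum>y\<in>Y. (norm (a + \<rho> * g y))\<^sup>2 ^ k) \<le> (\<Sum>y\<in>Y. ((norm a)\<^sup>2 + G\<^sup>2) ^ k)"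
      by (rule sum_mono)
    then show ?thesis by simp
  next
    case False
    then have a0: "norm a > 0" using G b0 by (metis mult_zero_right not_less norm_le_zero_iff norm_zero)
    define A where "A = norm a"
    define D where "D = G / A"
    define f where "f y = g y / a" for y
    define h where "h y = 2 * \<rho> * Re (f y) + \<rho>\<^sup>2 * (norm (f y))\<^sup>2" for y
    have A: "A > 0" using a0 by (simp add: A_def)
    have D: "D \<ge> 0" "D \<le> 3 * b" using A G False by (auto simp: D_def A_def field_simps)
    have fac: "(norm (a + \<rho> * g y))\<^sup>2 = A\<^sup>2 * (1 + h y)" for y
    proof -
      have "a + \<rho> * g y = a * (1 + \<rho> * f y)" using a0 by (auto simp: f_def field_simps)
      moreover have "(norm (1 + \<rho> * f y))\<^sup>2 = 1 + h y"
        unfolding h_def cmod_power2 by (simp add: power2_eq_square algebra_simps)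
      ultimately show ?thesis by (simp add: norm_mult power_mult_distrib A_def)
    qed
    have fb: "\<rho> * norm (f y) \<le> b * D" if "y \<in> Y" for y
      using gb[OF that] A by (simp add: f_def D_def A_def norm_divide divide_right_mono)
    have bD: "b * D \<le> 3 * b\<^sup>2" using D b0 using mult_left_mono[of D "3 * b" b] by (simp add: power2_eq_square)
    then have bD': "b * D \<le> 3 / 16" using \<open>b\<^sup>2 \<le> (1/4)\<^sup>2\<close> by (simp add: power2_eq_square)
    \<comment> \<open>35/16 = 2 + 3/16: the linear part of h contributes 2, and \<rho> |f y| <= 3/16
      bounds the quadratic part. The square of 35/16 is below 5, the constant in
      \<open>hk\<close>.\<close>
    have habs: "\<bar>h y\<bar> \<le> (35/16) * (\<rho> * norm (f y))" if "y \<in> Y" for y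
    proof -
      define n where "n = \<rho> * norm (f y)"
      have n: "0 \<le> n" "n \<le> 3/16" using fb[OF that] bD' \<open>\<rho> \<ge> 0\<close> by (auto simp: n_def)
      have "\<bar>\<rho> * Re (f y)\<bar> \<le> n"
        using \<open>\<rho> \<ge> 0\<close> abs_Re_le_cmod[of "f y"] by (simp add: n_def abs_mult mult_left_mono)
      then have "\<bar>h y\<bar> \<le> 2 * n + n\<^sup>2"
        using abs_triangle_ineq[of "2 * (\<rho> * Re (f y))" "n\<^sup>2"]
        by (simp add: h_def n_def power_mult_distrib abs_mult mult.assoc)
      also have "n\<^sup>2 \<le> (3/16) * n" using n mult_right_mono[of n "3/16" n] by (simp add: power2_eq_square)
      finally show ?thesis by (simp add: n_def)
    qed
    have hk: "(1 + h y) ^ k \<le> 1 + real k * h y + 5 * (real k)\<^sup>2 * (\<rho>\<^sup>2 * (norm (f y))\<^sup>2)" if y: "y \<in> Y" for y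
    proof -
      have "\<bar>h y\<bar> \<le> (35/16) * (3 * b\<^sup>2)" using habs[OF y] fb[OF y] bD by simp
      then have "real k * \<bar>h y\<bar> \<le> real k * ((35/16) * (3 * b\<^sup>2))" by (rule mult_left_mono) simp
      also have "\<dots> \<le> 1" using kb by simp
      finally have kh: "\<bar>real k * h y\<bar> \<le> 1" by (simp add: abs_mult)
      have "(1 + h y) = (norm (a + \<rho> * g y))\<^sup>2 / A\<^sup>2" using A by (simp add: fac)
      then have "1 + h y \<ge> 0" by simp
      then have "(1 + h y) ^ k \<le> 1 + real k * h y + (real k * h y)\<^sup>2"
        using kh by (intro one_add_power_le_quadratic) auto
      moreover have "(h y)\<^sup>2 \<le> 5 * (\<rho>\<^sup>2 * (norm (f y))\<^sup>2)"
      proof -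
        have "\<bar>h y\<bar>\<^sup>2 \<le> ((35/16) * (\<rho> * norm (f y)))\<^sup>2" using habs[OF y] by (intro power_mono) auto
        also have "\<dots> = (35/16)\<^sup>2 * (\<rho>\<^sup>2 * (norm (f y))\<^sup>2)" by (simp add: power_mult_distrib power_divide)
        also have "\<dots> \<le> 5 * (\<rho>\<^sup>2 * (norm (f y))\<^sup>2)" by (intro mult_right_mono) (auto simp: power2_eq_square)
        finally show ?thesis by simp
      qed
      then have "(real k)\<^sup>2 * (h y)\<^sup>2 \<le> (real k)\<^sup>2 * (5 * (\<rho>\<^sup>2 * (norm (f y))\<^sup>2))"
        by (rule mult_left_mono) simp
      ultimately show ?thesis by (simp add: power_mult_distrib algebra_simps)
    qed
    have fmean: "(\<Sum>y\<in>Y. Re (f y)) = 0"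
    proof -
      have "(\<Sum>y\<in>Y. f y) = 0" using mean by (simp add: f_def flip: sum_divide_distrib)
      then show ?thesis by (metis Re_sum zero_complex.sel(1))
    qed
    have f2: "(\<Sum>y\<in>Y. (norm (f y))\<^sup>2) = R * D\<^sup>2"
      using G by (simp add: f_def norm_divide power_divide D_def A_def R_def flip: sum_divide_distrib)
    have hsum: "(\<Sum>y\<in>Y. h y) = \<rho>\<^sup>2 * (R * D\<^sup>2)"
      using fmean f2 by (simp add: h_def sum.distrib flip: sum_distrib_left)
    have "(\<Sum>y\<in>Y. (1 + h y) ^ k) \<le> (\<Sum>y\<in>Y. 1 + real k * h y + 5 * (real k)\<^sup>2 * (\<rho>\<^sup>2 * (norm (f y))\<^sup>2))"
      by (intro sum_mono hk)
    also have "\<dots> = R + real k * (\<rho>\<^sup>2 * (R * D\<^sup>2)) + 5 * (real k)\<^sup>2 * (\<rho>\<^sup>2 * (R * D\<^sup>2))"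
      by (simp add: sum.distrib hsum f2 R_def flip: sum_distrib_left)
    also have "\<dots> = R * (1 + real k * D\<^sup>2 * (\<rho>\<^sup>2 + 5 * (real k * \<rho>\<^sup>2)))"
      by (simp add: algebra_simps power2_eq_square)
    also have "\<dots> \<le> R * (1 + real k * D\<^sup>2 * 1)"
    proof -
      have le: "\<rho>\<^sup>2 \<le> real k * \<rho>\<^sup>2" using k1 mult_right_mono[of 1 "real k" "\<rho>\<^sup>2"] by simp
      have "real k * \<rho>\<^sup>2 * 1 \<le> real k * \<rho>\<^sup>2 * R" using R by (intro mult_left_mono) auto
      then have "16 * (real k * \<rho>\<^sup>2) \<le> 1" using kb by (simp add: b2 mult_ac)
      then have "\<rho>\<^sup>2 + 5 * (real k * \<rho>\<^sup>2) \<le> 1" using le by linarith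
      then show ?thesis using R by (intro mult_left_mono add_left_mono) auto
    qed
    also have "\<dots> \<le> R * (1 + D\<^sup>2) ^ k"
    proof (rule mult_left_mono)
      have "-1 \<le> D\<^sup>2" using zero_le_power2[of D] by linarith
      then show "1 + real k * D\<^sup>2 * 1 \<le> (1 + D\<^sup>2) ^ k"
        using Bernoulli_inequality[of "D\<^sup>2" k] by simp
    qed (use R in simp)
    finally have main: "(\<Sum>y\<in>Y. (1 + h y) ^ k) \<le> R * (1 + D\<^sup>2) ^ k" .
    have "(\<Sum>y\<in>Y. (norm (a + \<rho> * g y))\<^sup>2 ^ k) = (A\<^sup>2) ^ k * (\<Sum>y\<in>Y. (1 + h y) ^ k)"
      by (simp only: fac power_mult_distrib sum_distrib_left)
    also have "\<dots> \<le> (A\<^sup>2) ^ k * (R * (1 + D\<^sup>2) ^ k)"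
      by (intro mult_left_mono main) auto
    also have "\<dots> = R * (A\<^sup>2 * (1 + D\<^sup>2)) ^ k" by (simp add: power_mult_distrib)
    also have "A\<^sup>2 * (1 + D\<^sup>2) = A\<^sup>2 + G\<^sup>2" using A by (simp add: D_def field_simps)
    finally show ?thesis by (simp add: A_def R_def)
  qed
qed

definition wt :: "'a set \<Rightarrow> ('a \<Rightarrow> nat) \<Rightarrow> nat" where
  "wt V v = card {i\<in>V. v i \<noteq> 0}"

lemma wt_insert:
  assumes "finite V" "a \<notin> V"
  shows "wt (insert a V) (v(a := u)) = (if u = 0 then wt V v else Suc (wt V v))"
proof -
  have "{i \<in> insert a V. (v(a := u)) i \<noteq> 0} = (if u = 0 then {} else {a}) \<union> {i\<in>V. v i \<noteq> 0}"
    using assms by auto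
  then show ?thesis using assms by (simp add: wt_def)
qed

text \<open>The nontrivial frequencies sum to a function of mean 0 whose square norm is given by
  orthogonality, so this is \<open>mean_zero_perturbation_moment\<close> with the coefficient
  \<open>a 0\<close> as the unperturbed value.\<close>

lemma one_coordinate_hypercontractive:
  fixes a :: "nat \<Rightarrow> complex"
  assumes "r > 0" "k > 0" "\<rho> \<ge> 0" "16 * real r * real k * \<rho>\<^sup>2 \<le> 1"
  shows "(\<Sum>y<r. (norm (\<Sum>u<r. complex_of_real (if u = 0 then 1 else \<rho>) * a u * root_pow r (u * y)))\<^sup>2 ^ k)
    \<le> real r * (\<Sum>u<r. (norm (a u))\<^sup>2) ^ k"
proof -
  define g where "g y = (\<Sum>u\<in>{0<..<r}. a u * root_pow r (u * y))" for y
  define G where "G = sqrt (\<Sum>u\<in>{0<..<r}. (norm (a u))\<^sup>2)"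
  have split: "{..<r} = insert 0 {0<..<r}" using assms(1) by auto
  have g0: "(\<Sum>y<r. root_pow r (u * y)) = 0" if "u \<in> {0<..<r}" for u
    using root_pow_orthogonal[of u r 0] that by simp
  have mean: "(\<Sum>y<r. g y) = 0"
    unfolding g_def by (subst sum.swap) (simp add: g0 flip: sum_distrib_left)
  have sq: "(\<Sum>y<r. (norm (g y))\<^sup>2) = real r * G\<^sup>2"
  proof -
    have "complex_of_real (\<Sum>y<r. (norm (g y))\<^sup>2) = (\<Sum>y<r. g y * cnj (g y))"
      unfolding of_real_sum complex_norm_square ..
    also have "\<dots> = (\<Sum>y<r. \<Sum>u\<in>{0<..<r}. \<Sum>u'\<in>{0<..<r}. a u * cnj (a u') * (root_pow r (u * y) * cnj (root_pow r (u' * y))))"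
      unfolding g_def by (simp add: sum_product mult_ac)
    also have "\<dots> = (\<Sum>u\<in>{0<..<r}. \<Sum>u'\<in>{0<..<r}. \<Sum>y<r. a u * cnj (a u') * (root_pow r (u * y) * cnj (root_pow r (u' * y))))"
      by (subst sum.swap) (intro sum.cong refl sum.swap)
    also have "\<dots> = (\<Sum>u\<in>{0<..<r}. \<Sum>u'\<in>{0<..<r}. a u * cnj (a u') * (if u = u' then of_nat r else 0))"
      by (intro sum.cong refl) (simp add: root_pow_orthogonal flip: sum_distrib_left)
    also have "\<dots> = (\<Sum>u\<in>{0<..<r}. a u * cnj (a u) * of_nat r)"
      by (intro sum.cong refl) (simp add: if_distrib cong: if_cong)
    also have "\<dots> = complex_of_real (real r * G\<^sup>2)"
      by (simp add: G_def sum_nonneg complex_norm_square[symmetric] sum_distrib_left mult_ac)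
    finally show ?thesis by (simp only: of_real_eq_iff)
  qed
  have "(\<Sum>y<r. (norm (\<Sum>u<r. complex_of_real (if u = 0 then 1 else \<rho>) * a u * root_pow r (u * y)))\<^sup>2 ^ k)
      = (\<Sum>y<r. (norm (a 0 + \<rho> * g y))\<^sup>2 ^ k)"
  proof (intro sum.cong refl arg_cong[where f="\<lambda>x. (norm x)\<^sup>2 ^ k"])
    fix y
    have "(\<Sum>u\<in>{0<..<r}. complex_of_real (if u = 0 then 1 else \<rho>) * a u * root_pow r (u * y)) = \<rho> * g y"
      unfolding g_def sum_distrib_left by (intro sum.cong) auto
    then show "(\<Sum>u<r. complex_of_real (if u = 0 then 1 else \<rho>) * a u * root_pow r (u * y)) = a 0 + \<rho> * g y"
      unfolding split by (subst sum.insert) auto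
  qed
  also have "\<dots> \<le> real (card {..<r}) * ((norm (a 0))\<^sup>2 + G\<^sup>2) ^ k"
    using assms mean sq by (intro mean_zero_perturbation_moment) (auto simp: G_def sum_nonneg)
  also have "(norm (a 0))\<^sup>2 + G\<^sup>2 = (\<Sum>u<r. (norm (a u))\<^sup>2)"
    unfolding split by (simp add: G_def sum_nonneg)
  finally show ?thesis by simp
qed

text \<open>The hypercontractive inequality from exponent 2 to exponent 2 k for the noise operator
  that multiplies level d by \<rho>^d. It tensorises: for fixed other coordinates x the
  one-coordinate case applies to the coefficients \<open>P u x\<close>, and Minkowski with exponent
  k, applied to their squared moduli, moves the sum over u outside so that the induction hypothesis
  can be used for each u.\<close>

lemma hypercontractive_vecs:
  fixes c :: "('a \<Rightarrow> nat) \<Rightarrow> complex"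
  assumes "finite V" "r > 0" "k > 0" "\<rho> \<ge> 0" "16 * real r * real k * \<rho>\<^sup>2 \<le> 1"
  shows "(\<Sum>x\<in>vecs r V. (norm (\<Sum>v\<in>vecs r V. complex_of_real (\<rho> ^ wt V v) * c v * chr r V v x))\<^sup>2 ^ k)
    \<le> real (r ^ card V) * (\<Sum>v\<in>vecs r V. (norm (c v))\<^sup>2) ^ k"
  using assms(1)
proof (induction V arbitrary: c rule: finite_induct)
  case empty
  then show ?case by (simp add: wt_def chr_def)
next
  case (insert b V)
  define P where "P u x = (\<Sum>v\<in>vecs r V. complex_of_real (\<rho> ^ wt V v) * c (v(b := u)) * chr r V v x)" for u x
  define C where "C u = (\<Sum>v\<in>vecs r V. (norm (c (v(b := u))))\<^sup>2)" for u
  obtain k' where k': "k = Suc k'" using assms(3) by (cases k) auto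
  have expand: "(\<Sum>v\<in>vecs r (insert b V). complex_of_real (\<rho> ^ wt (insert b V) v) * c v * chr r (insert b V) v (x(b := y)))
      = (\<Sum>u<r. complex_of_real (if u = 0 then 1 else \<rho>) * P u x * root_pow r (u * y))" for x y
  proof -
    have "(\<Sum>v\<in>vecs r (insert b V). complex_of_real (\<rho> ^ wt (insert b V) v) * c v * chr r (insert b V) v (x(b := y)))
      = (\<Sum>u<r. \<Sum>v\<in>vecs r V. complex_of_real (\<rho> ^ wt (insert b V) (v(b := u))) * c (v(b := u)) * chr r (insert b V) (v(b := u)) (x(b := y)))"
      by (subst sum_vecs_insert[OF insert.hyps], subst sum.swap) (rule refl)
    also have "\<dots> = (\<Sum>u<r. complex_of_real (if u = 0 then 1 else \<rho>) * P u x * root_pow r (u * y))"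
      unfolding P_def sum_distrib_left sum_distrib_right
      by (intro sum.cong refl) (simp add: wt_insert insert.hyps chr_insert mult_ac)
    finally show ?thesis .
  qed
  have "(\<Sum>x\<in>vecs r (insert b V). (norm (\<Sum>v\<in>vecs r (insert b V). complex_of_real (\<rho> ^ wt (insert b V) v) * c v * chr r (insert b V) v x))\<^sup>2 ^ k)
      = (\<Sum>x\<in>vecs r V. \<Sum>y<r. (norm (\<Sum>u<r. complex_of_real (if u = 0 then 1 else \<rho>) * P u x * root_pow r (u * y)))\<^sup>2 ^ k)"
    by (subst sum_vecs_insert[OF insert.hyps]) (simp only: expand)
  also have "\<dots> \<le> (\<Sum>x\<in>vecs r V. real r * (\<Sum>u<r. (norm (P u x))\<^sup>2) ^ k)"
    by (intro sum_mono one_coordinate_hypercontractive assms)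
  also have "\<dots> = real r * (\<Sum>x\<in>vecs r V. (\<Sum>u<r. (norm (P u x))\<^sup>2) ^ k)"
    by (simp add: sum_distrib_left)
  also have "\<dots> \<le> real r * (real (r ^ card V) * (\<Sum>u<r. C u) ^ k)"
  proof (rule mult_left_mono)
    show "(\<Sum>x\<in>vecs r V. (\<Sum>u<r. (norm (P u x))\<^sup>2) ^ k) \<le> real (r ^ card V) * (\<Sum>u<r. C u) ^ k"
      unfolding k' using insert.hyps insert.IH[of "\<lambda>v. c (v(b := _))"]
      by (intro Minkowski_power) (auto simp: C_def P_def sum_nonneg k' simp del: power_Suc)
  qed simp
  also have "(\<Sum>u<r. C u) = (\<Sum>v\<in>vecs r (insert b V). (norm (c v))\<^sup>2)"
    unfolding C_def by (subst sum_vecs_insert[OF insert.hyps], subst sum.swap) (rule refl)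
  also have "real r * (real (r ^ card V) * (\<Sum>v\<in>vecs r (insert b V). (norm (c v))\<^sup>2) ^ k)
      = real (r ^ card (insert b V)) * (\<Sum>v\<in>vecs r (insert b V). (norm (c v))\<^sup>2) ^ k"
    using insert.hyps by simp
  finally show ?case .
qed

section \<open>The level inequality and the bias of labels\<close>

definition avg :: "nat \<Rightarrow> 'a set \<Rightarrow> (('a \<Rightarrow> nat) \<Rightarrow> real) \<Rightarrow> real" where
  "avg r V f = (\<Sum>x\<in>vecs r V. f x) / real (r ^ card V)"

definition fourier :: "nat \<Rightarrow> 'a set \<Rightarrow> (('a \<Rightarrow> nat) \<Rightarrow> real) \<Rightarrow> ('a \<Rightarrow> nat) \<Rightarrow> complex" where
  "fourier r V f v = (\<Sum>x\<in>vecs r V. of_real (f x) * cnj (chr r V v x)) / of_nat (r ^ card V)"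

text \<open>Let P be the level-d part of f and W its Fourier mass. Then W is the correlation of f
  with P; Hoelder with exponent 2 k and hypercontractivity for P give
  \<open>W ^ k * \<mu> \<le> \<mu> ^ (2 * k) * q ^ (k * d)\<close>. The surplus factor \<mu> on the
  left is at least 2^(-k d) because S <= k d, which doubles the base q: hence 32 instead of
  16.\<close>

lemma level_inequality:
  fixes f :: "('a \<Rightarrow> nat) \<Rightarrow> real"
  assumes V: "finite V" and r: "r > 0" and k: "k > 0"
    and f: "\<And>x. x \<in> vecs r V \<Longrightarrow> 0 \<le> f x" "\<And>x. x \<in> vecs r V \<Longrightarrow> f x \<le> 1"
    and mu: "(1/2) ^ S \<le> avg r V f" and S: "S \<le> k * d"
  shows "(\<Sum>v | v \<in> vecs r V \<and> wt V v = d. (norm (fourier r V f v))\<^sup>2)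
    \<le> (avg r V f)\<^sup>2 * (32 * real r * real k) ^ d"
proof -
  define R where "R = real (r ^ card V)"
  define D where "D = {v \<in> vecs r V. wt V v = d}"
  define \<mu> where "\<mu> = avg r V f"
  define W where "W = (\<Sum>v\<in>D. (norm (fourier r V f v))\<^sup>2)"
  define P where "P x = (\<Sum>v\<in>D. fourier r V f v * chr r V v x)" for x
  define q where "q = 16 * real r * real k"
  \<comment> \<open>The largest noise rate that \<open>hypercontractive_vecs\<close> admits for
    moment order k.\<close>
  define \<rho> where "\<rho> = 1 / sqrt q"
  define Q where "Q = (\<Sum>x\<in>vecs r V. norm (P x) ^ (2 * k))"
  have R: "R > 0" using r by (simp add: R_def)
  have q: "q > 0" using r k by (simp add: q_def)
  have finD: "finite D" using V by (simp add: D_def)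
  have W0: "W \<ge> 0" by (simp add: W_def sum_nonneg)
  have mu0: "\<mu> > 0" using mu unfolding \<mu>_def by (rule less_le_trans[rotated]) simp
  have sumf: "(\<Sum>x\<in>vecs r V. f x) = R * \<mu>" using R by (simp add: \<mu>_def avg_def R_def)
  have "(\<Sum>x\<in>vecs r V. (norm (\<Sum>v\<in>vecs r V. of_real (\<rho> ^ wt V v) * (if v \<in> D then fourier r V f v else 0) * chr r V v x))\<^sup>2 ^ k)
      \<le> R * (\<Sum>v\<in>vecs r V. (norm (if v \<in> D then fourier r V f v else 0))\<^sup>2) ^ k"
    unfolding R_def using r k q
    by (intro hypercontractive_vecs V) (auto simp: \<rho>_def power_divide, simp add: q_def)
  moreover have "(\<Sum>v\<in>vecs r V. of_real (\<rho> ^ wt V v) * (if v \<in> D then fourier r V f v else 0) * chr r V v x) = of_real (\<rho> ^ d) * P x" for x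
  proof -
    have "(\<Sum>v\<in>vecs r V. of_real (\<rho> ^ wt V v) * (if v \<in> D then fourier r V f v else 0) * chr r V v x)
        = (\<Sum>v\<in>D. of_real (\<rho> ^ wt V v) * fourier r V f v * chr r V v x)"
      using V by (intro sum.mono_neutral_cong_right) (auto simp: D_def)
    then show ?thesis
      by (simp add: P_def sum_distrib_left D_def mult.assoc)
  qed
  moreover have "(\<Sum>v\<in>vecs r V. (norm (if v \<in> D then fourier r V f v else 0))\<^sup>2) = W"
    unfolding W_def using V by (intro sum.mono_neutral_cong_right) (auto simp: D_def)
  ultimately have "(\<Sum>x\<in>vecs r V. (norm (of_real (\<rho> ^ d) * P x))\<^sup>2 ^ k) \<le> R * W ^ k" by simp
  moreover have "(norm (of_real (\<rho> ^ d) * P x))\<^sup>2 ^ k = (1 / q) ^ (k * d) * norm (P x) ^ (2 * k)" for x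
  proof -
    have "(norm (complex_of_real (\<rho> ^ d) * P x))\<^sup>2 = (\<rho> ^ d)\<^sup>2 * (norm (P x))\<^sup>2"
      unfolding norm_mult norm_of_real power_mult_distrib by simp
    also have "(\<rho> ^ d)\<^sup>2 = (\<rho>\<^sup>2) ^ d" by (simp only: power_mult[symmetric] mult.commute)
    also have "\<rho>\<^sup>2 = 1 / q" using q by (simp add: \<rho>_def power_divide)
    finally show ?thesis by (simp only: power_mult_distrib power_mult[symmetric] mult.commute[of k d])
  qed
  ultimately have "(1 / q) ^ (k * d) * Q \<le> R * W ^ k"
    by (simp add: Q_def sum_distrib_left)
  then have Q: "Q \<le> q ^ (k * d) * (R * W ^ k)"
  proof -
    assume "(1 / q) ^ (k * d) * Q \<le> R * W ^ k"
    then have "q ^ (k * d) * ((1 / q) ^ (k * d) * Q) \<le> q ^ (k * d) * (R * W ^ k)"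
      using q by (intro mult_left_mono) auto
    moreover have "q ^ (k * d) * (1 / q) ^ (k * d) = 1"
      using q by (simp add: power_mult_distrib[symmetric])
    ultimately show ?thesis by (simp only: mult.assoc[symmetric] mult_1)
  qed
  have WR: "W * R \<le> (\<Sum>x\<in>vecs r V. f x * norm (P x))"
  proof -
    have "of_real (W * R) = (\<Sum>v\<in>D. of_nat (r ^ card V) * fourier r V f v * cnj (fourier r V f v))"
      unfolding W_def R_def of_real_mult of_real_sum complex_norm_square of_real_of_nat_eq sum_distrib_right
      by (intro sum.cong refl) (simp only: mult_ac)
    also have "\<dots> = (\<Sum>v\<in>D. \<Sum>x\<in>vecs r V. of_real (f x) * cnj (fourier r V f v * chr r V v x))"
    proof (intro sum.cong refl)
      fix v
      have "of_nat (r ^ card V) * fourier r V f v = (\<Sum>x\<in>vecs r V. of_real (f x) * cnj (chr r V v x))"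
        using r by (simp add: fourier_def)
      then show "of_nat (r ^ card V) * fourier r V f v * cnj (fourier r V f v)
          = (\<Sum>x\<in>vecs r V. of_real (f x) * cnj (fourier r V f v * chr r V v x))"
        by (simp add: sum_distrib_right sum_distrib_left mult_ac)
    qed
    also have "\<dots> = (\<Sum>x\<in>vecs r V. of_real (f x) * cnj (P x))"
      by (subst sum.swap) (simp add: P_def sum_distrib_left)
    finally have "norm (complex_of_real (W * R)) \<le> (\<Sum>x\<in>vecs r V. norm (of_real (f x) * cnj (P x)))"
      by (simp only: norm_sum)
    moreover have "norm (complex_of_real (W * R)) = W * R" using W0 R by (simp add: norm_mult)
    ultimately have "W * R \<le> (\<Sum>x\<in>vecs r V. norm (of_real (f x) * cnj (P x)))" by simp
    also have "\<dots> = (\<Sum>x\<in>vecs r V. f x * norm (P x))"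
      using f by (intro sum.cong refl) (simp add: norm_mult)
    finally show ?thesis .
  qed
  \<comment> \<open>\<open>power_weighted_mean\<close> with the weights f acts as Hoelder's
    inequality here; afterwards f <= 1 allows the weight in front of the 2k-th power of |P| to be
    dropped.\<close>
  obtain k' where k': "2 * k = Suc k'" using k by (cases "2 * k") auto
  have W2: "W ^ (2 * k) = W ^ k * W ^ k" by (simp add: mult_2 power_add)
  have "(W * R) ^ (2 * k) \<le> (\<Sum>x\<in>vecs r V. f x * norm (P x)) ^ (2 * k)"
    using WR W0 R by (intro power_mono) auto
  also have "\<dots> \<le> (\<Sum>x\<in>vecs r V. f x) ^ k' * (\<Sum>x\<in>vecs r V. f x * norm (P x) ^ (2 * k))"
    unfolding k' using V f by (intro power_weighted_mean) auto
  also have "\<dots> \<le> (\<Sum>x\<in>vecs r V. f x) ^ k' * Q"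
  proof (rule mult_left_mono)
    show "(\<Sum>x\<in>vecs r V. f x * norm (P x) ^ (2 * k)) \<le> Q"
      unfolding Q_def using f by (intro sum_mono) (simp add: mult_left_le_one_le)
  qed (use f in \<open>auto intro!: zero_le_power sum_nonneg\<close>)
  also have "\<dots> \<le> (R * \<mu>) ^ k' * (q ^ (k * d) * (R * W ^ k))"
    unfolding sumf using R mu0 by (intro mult_left_mono Q) auto
  finally have "(W * R) ^ (2 * k) * \<mu> \<le> ((R * \<mu>) ^ k' * (q ^ (k * d) * (R * W ^ k))) * \<mu>"
    using mu0 by (intro mult_right_mono) auto
  also have "\<dots> = (R * \<mu>) ^ (2 * k) * q ^ (k * d) * W ^ k"
    unfolding k' by simp
  finally have "R ^ (2 * k) * (W ^ k * (W ^ k * \<mu>)) \<le> R ^ (2 * k) * (W ^ k * (\<mu> ^ (2 * k) * q ^ (k * d)))"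
    by (simp only: power_mult_distrib W2) (simp only: mult_ac)
  then have main: "W ^ k * (W ^ k * \<mu>) \<le> W ^ k * (\<mu> ^ (2 * k) * q ^ (k * d))"
    by (rule mult_left_le_imp_le) (use R in simp)
  have "W \<le> \<mu>\<^sup>2 * (2 * q) ^ d"
  proof (cases "W = 0")
    case True
    then show ?thesis using q by simp
  next
    case False
    then have "W ^ k > 0" using W0 by simp
    with main have "W ^ k * \<mu> \<le> \<mu> ^ (2 * k) * q ^ (k * d)"
      by (rule mult_left_le_imp_le)
    moreover have "W ^ k * (1/2) ^ (k * d) \<le> W ^ k * \<mu>"
    proof (rule mult_left_mono)
      have "(1/2 :: real) ^ (k * d) \<le> (1/2) ^ S" using S by (intro power_decreasing) auto
      then show "(1/2) ^ (k * d) \<le> \<mu>" using mu unfolding \<mu>_def by (rule order_trans)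
    qed (use W0 in simp)
    ultimately have "W ^ k * (1/2) ^ (k * d) \<le> \<mu> ^ (2 * k) * q ^ (k * d)" by (rule order_trans[rotated])
    then have "2 ^ (k * d) * (W ^ k * (1/2) ^ (k * d)) \<le> 2 ^ (k * d) * (\<mu> ^ (2 * k) * q ^ (k * d))"
      by (rule mult_left_mono) simp
    moreover have "2 ^ (k * d) * (1/2 :: real) ^ (k * d) = 1"
      by (simp add: power_mult_distrib[symmetric])
    ultimately have "W ^ k \<le> \<mu> ^ (2 * k) * (2 * q) ^ (k * d)"
      by (simp only: power_mult_distrib[of 2 q] mult.left_commute[of "2 ^ (k * d)"] mult_1_right)
    also have "\<dots> = (\<mu>\<^sup>2 * (2 * q) ^ d) ^ k"
      by (simp only: power_mult_distrib[of "\<mu>\<^sup>2"] power_mult[symmetric] mult.commute[of k d])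
    finally have "W ^ k \<le> (\<mu>\<^sup>2 * (2 * q) ^ d) ^ k" .
    then show ?thesis
      by (rule power_le_imp_le_base[of _ "k - 1", unfolded Suc_diff_1[OF k]]) (use q in simp)
  qed
  moreover have "2 * q = 32 * real r * real k" by (simp add: q_def)
  ultimately show ?thesis by (simp only: W_def D_def \<mu>_def)
qed

section \<open>Fourier inversion, Parseval and the bias of linear labels\<close>

lemma fourier_inversion:
  assumes "finite V" "r > 0" "w \<in> vecs r V"
  shows "(\<Sum>u\<in>vecs r V. fourier r V g u * chr r V u w) = of_real (g w)"
proof -
  let ?R = "of_nat (r ^ card V) :: complex"
  have "?R * (\<Sum>u\<in>vecs r V. fourier r V g u * chr r V u w)
      = (\<Sum>u\<in>vecs r V. \<Sum>x\<in>vecs r V. of_real (g x) * (chr r V w u * cnj (chr r V x u)))"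
    unfolding sum_distrib_left
  proof (intro sum.cong refl)
    fix u
    have "?R * fourier r V g u = (\<Sum>x\<in>vecs r V. of_real (g x) * cnj (chr r V u x))"
      using assms by (simp add: fourier_def)
    then show "?R * (fourier r V g u * chr r V u w) = (\<Sum>x\<in>vecs r V. of_real (g x) * (chr r V w u * cnj (chr r V x u)))"
      unfolding mult.assoc[symmetric]
      by (simp add: sum_distrib_right sum_distrib_left chr_commute[of r V u] mult_ac)
  qed
  also have "\<dots> = (\<Sum>x\<in>vecs r V. of_real (g x) * (if w = x then ?R else 0))"
    using assms by (subst sum.swap) (simp add: sum_distrib_left[symmetric] chr_orthogonal)
  also have "\<dots> = ?R * of_real (g w)"
    using assms by (simp add: if_distrib[of "\<lambda>x. _ * x"] cong: if_cong)
  finally show ?thesis using assms by simp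
qed

lemma fourier_Parseval:
  assumes "finite V" "r > 0"
  shows "(\<Sum>u\<in>vecs r V. (norm (fourier r V g u))\<^sup>2) = avg r V (\<lambda>x. (g x)\<^sup>2)"
proof -
  let ?R = "of_nat (r ^ card V) :: complex"
  have "of_real (\<Sum>u\<in>vecs r V. (norm (fourier r V g u))\<^sup>2) = (\<Sum>u\<in>vecs r V. fourier r V g u * cnj (fourier r V g u))"
    unfolding of_real_sum complex_norm_square ..
  also have "\<dots> = (\<Sum>u\<in>vecs r V. \<Sum>x\<in>vecs r V. of_real (g x) * (fourier r V g u * chr r V u x)) / ?R"
    unfolding sum_divide_distrib
  proof (intro sum.cong refl)
    fix u
    have "cnj (fourier r V g u) = (\<Sum>x\<in>vecs r V. of_real (g x) * chr r V u x) / ?R"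
      by (simp add: fourier_def)
    then show "fourier r V g u * cnj (fourier r V g u) = (\<Sum>x\<in>vecs r V. of_real (g x) * (fourier r V g u * chr r V u x) / ?R)"
      by (simp only: sum_distrib_left sum_divide_distrib times_divide_eq_right mult_ac)
  qed
  also have "\<dots> = (\<Sum>x\<in>vecs r V. of_real (g x) * (\<Sum>u\<in>vecs r V. fourier r V g u * chr r V u x)) / ?R"
    by (subst sum.swap) (simp add: sum_distrib_left)
  also have "\<dots> = (\<Sum>x\<in>vecs r V. of_real (g x) * of_real (g x)) / ?R"
    using assms by (simp add: fourier_inversion)
  also have "\<dots> = of_real (avg r V (\<lambda>x. (g x)\<^sup>2))"
    by (simp add: avg_def power2_eq_square)
  finally show ?thesis by (simp only: of_real_eq_iff)
qed

lemma fourier_zero: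
  "fourier r V g (\<lambda>i\<in>V. 0) = of_real (avg r V g)"
  by (simp add: fourier_def avg_def chr_def)

text \<open>\<open>Lt\<close> is the transpose of the label map \<open>L\<close>, and g a test
  applied to the labels. Expanding g minus its mean in nontrivial characters and pulling them back
  through \<open>L\<close> turns the correlation with f into a pairing of the coefficients of g with
  those of f at the frequencies \<open>Lt u\<close>. Cauchy-Schwarz separates the two, and Parseval
  bounds the part of g by 1.\<close>

lemma label_bias_le:
  fixes f :: "('a \<Rightarrow> nat) \<Rightarrow> real" and g :: "('b \<Rightarrow> nat) \<Rightarrow> real"
  assumes fin: "finite V" "finite I" and r: "r > 0"
    and L: "\<And>x. x \<in> vecs r V \<Longrightarrow> L x \<in> vecs r I"
    and Lt: "\<And>u x. u \<in> vecs r I \<Longrightarrow> x \<in> vecs r V \<Longrightarrow> chr r I u (L x) = chr r V (Lt u) x"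
    and g: "\<And>w. w \<in> vecs r I \<Longrightarrow> \<bar>g w\<bar> \<le> 1"
  shows "\<bar>avg r V (\<lambda>x. f x * (g (L x) - avg r I g))\<bar>
    \<le> sqrt (\<Sum>u\<in>vecs r I - {\<lambda>i\<in>I. 0}. (norm (fourier r V f (Lt u)))\<^sup>2)"
proof -
  let ?R = "of_nat (r ^ card V) :: complex" and ?z = "\<lambda>i\<in>I. 0 :: nat"
  let ?U = "vecs r I - {?z}"
  have z: "?z \<in> vecs r I" using r by auto
  have split: "of_real (g w - avg r I g) = (\<Sum>u\<in>?U. fourier r I g u * chr r I u w)" if "w \<in> vecs r I" for w
  proof -
    have "of_real (g w) = (\<Sum>u\<in>vecs r I. fourier r I g u * chr r I u w)"
      using fourier_inversion[OF fin(2) r that, of g] by simp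
    also have "\<dots> = fourier r I g ?z * chr r I ?z w + (\<Sum>u\<in>?U. fourier r I g u * chr r I u w)"
      using fin z by (subst sum.remove[of _ ?z]) auto
    finally show ?thesis by (simp add: fourier_zero) (simp add: chr_def)
  qed
  have "of_real (avg r V (\<lambda>x. f x * (g (L x) - avg r I g)))
      = (\<Sum>x\<in>vecs r V. of_real (f x) * of_real (g (L x) - avg r I g)) / ?R"
    by (simp add: avg_def)
  also have "\<dots> = (\<Sum>x\<in>vecs r V. \<Sum>u\<in>?U. fourier r I g u * (of_real (f x) * chr r V (Lt u) x)) / ?R"
    unfolding split[OF L] using L Lt
    by (intro arg_cong2[where f="(/)"] sum.cong refl) (simp add: split sum_distrib_left mult_ac del: of_real_diff)
  also have "\<dots> = (\<Sum>u\<in>?U. fourier r I g u * cnj (fourier r V f (Lt u)))"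
    by (subst sum.swap) (simp add: fourier_def[of r V] sum_distrib_left sum_divide_distrib mult_ac)
  finally have "norm (complex_of_real (avg r V (\<lambda>x. f x * (g (L x) - avg r I g))))
      \<le> (\<Sum>u\<in>?U. norm (fourier r I g u * cnj (fourier r V f (Lt u))))"
    by (simp only: norm_sum)
  then have "\<bar>avg r V (\<lambda>x. f x * (g (L x) - avg r I g))\<bar>
      \<le> (\<Sum>u\<in>?U. \<bar>norm (fourier r I g u)\<bar> * \<bar>norm (fourier r V f (Lt u))\<bar>)"
    by (simp add: norm_mult)
  also have "\<dots> \<le> L2_set (\<lambda>u. norm (fourier r I g u)) ?U * L2_set (\<lambda>u. norm (fourier r V f (Lt u))) ?U"
    by (rule L2_set_mult_ineq)
  also have "\<dots> \<le> 1 * L2_set (\<lambda>u. norm (fourier r V f (Lt u))) ?U"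
  proof (rule mult_right_mono)
    have "(\<Sum>u\<in>?U. (norm (fourier r I g u))\<^sup>2) \<le> (\<Sum>u\<in>vecs r I. (norm (fourier r I g u))\<^sup>2)"
      using fin by (intro sum_mono2) auto
    also have "\<dots> = avg r I (\<lambda>x. (g x)\<^sup>2)" by (rule fourier_Parseval[OF fin(2) r])
    also have "\<dots> \<le> (\<Sum>w\<in>vecs r I. 1) / real (r ^ card I)"
      unfolding avg_def using g
      by (intro divide_right_mono sum_mono) (auto simp: abs_square_le_1)
    also have "\<dots> = 1" using fin r by (simp add: card_vecs)
    finally show "L2_set (\<lambda>u. norm (fourier r I g u)) ?U \<le> 1" by (simp add: L2_set_def)
  qed simp
  finally show ?thesis by (simp add: L2_set_def)
qed

section \<open>Random partial matchings\<close>

lemma permutation_between_subsets: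
  assumes "finite A" "S \<subseteq> A" "T \<subseteq> A" "card S = card T"
  obtains \<tau> where "\<tau> permutes A" "\<tau> ` S = T"
proof -
  have fin: "finite S" "finite T" using assms finite_subset by auto
  obtain f where f: "bij_betw f S T"
    using finite_same_card_bij[OF fin assms(4)] by blast
  have "card (A - S) = card (A - T)"
    using assms fin by (simp add: card_Diff_subset)
  then obtain g where g: "bij_betw g (A - S) (A - T)"
    using finite_same_card_bij[of "A - S" "A - T"] assms(1) by blast
  define \<tau> where "\<tau> x = (if x \<in> S then f x else if x \<in> A then g x else x)" for x
  have 1: "bij_betw \<tau> S T"
    using f by (rule bij_betw_cong[THEN iffD1, rotated]) (simp add: \<tau>_def)
  have 2: "bij_betw \<tau> (A - S) (A - T)"
    using g by (rule bij_betw_cong[THEN iffD1, rotated]) (auto simp: \<tau>_def)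
  have "bij_betw \<tau> (S \<union> (A - S)) (T \<union> (A - T))"
    using 1 2 by (rule bij_betw_combine) auto
  moreover have "S \<union> (A - S) = A" "T \<union> (A - T) = A" using assms by auto
  ultimately have "\<tau> permutes A"
    using assms(2) by (intro bij_imp_permutes) (auto simp: \<tau>_def)
  moreover have "\<tau> ` S = T" using 1 by (simp add: bij_betw_def)
  ultimately show ?thesis by (rule that)
qed

text \<open>Composition with a permutation taking S to T embeds the permutations that map L onto S
  into those that map L onto T. So no other class of image sets of this size is smaller than that of
  S, and the classes are disjoint.\<close>

lemma card_permutes_image_le:
  assumes A: "finite A" and L: "L \<subseteq> A"
  shows "card {\<pi>. \<pi> permutes A \<and> \<pi> ` L = S} * (card A choose card L) \<le> fact (card A)"
proof (cases "{\<pi>. \<pi> permutes A \<and> \<pi> ` L = S} = {}")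
  case True
  show ?thesis unfolding True by simp
next
  case False
  let ?P = "\<lambda>S. {\<pi>. \<pi> permutes A \<and> \<pi> ` L = S}"
  define K where "K = {T. T \<subseteq> A \<and> card T = card L}"
  have fin: "finite (?P T)" for T
    using finite_permutations[OF A] by (rule finite_subset[rotated]) auto
  from False obtain \<pi> where \<pi>: "\<pi> permutes A" "\<pi> ` L = S" by auto
  have S: "S \<subseteq> A" "card S = card L"
    using \<pi>(2) L permutes_image[OF \<pi>(1)] card_image[OF permutes_inj_on[OF \<pi>(1), of L]] by blast+
  have le: "card (?P S) \<le> card (?P T)" if "T \<in> K" for T
  proof -
    obtain \<tau> where \<tau>: "\<tau> permutes A" "\<tau> ` S = T"
      using permutation_between_subsets[OF A S(1), of T] S(2) \<open>T \<in> K\<close> by (auto simp: K_def)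
    have "inj_on ((\<circ>) \<tau>) (?P S)"
      using fun.inj_map[OF permutes_inj[OF \<tau>(1)]] by (rule inj_on_subset) simp
    moreover have "(\<circ>) \<tau> ` ?P S \<subseteq> ?P T"
    proof (rule image_subsetI)
      fix \<pi> assume "\<pi> \<in> ?P S"
      moreover have "(\<tau> \<circ> \<pi>) ` L = \<tau> ` (\<pi> ` L)" by (rule image_comp[symmetric])
      ultimately show "\<tau> \<circ> \<pi> \<in> ?P T" using \<tau> permutes_compose by auto
    qed
    ultimately show ?thesis using fin by (rule card_inj_on_le)
  qed
  have "card (?P S) * (card A choose card L) = (\<Sum>T\<in>K. card (?P S))"
    using n_subsets[OF A, of "card L"] by (simp add: K_def)
  also have "\<dots> \<le> (\<Sum>T\<in>K. card (?P T))" by (rule sum_mono[OF le])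
  also have "\<dots> = card (\<Union>T\<in>K. ?P T)"
    by (rule card_UN_disjoint[symmetric]) (use A fin in \<open>auto simp: K_def\<close>)
  also have "\<dots> \<le> card {\<pi>. \<pi> permutes A}"
    using finite_permutations[OF A] by (intro card_mono) auto
  also have "\<dots> = fact (card A)" using A by (simp add: card_permutations)
  finally show ?thesis .
qed

section \<open>The ensemble of partial matchings\<close>

locale block_matching =
  fixes V :: "'a set" and \<phi> :: "nat \<Rightarrow> nat \<Rightarrow> 'a" and r t N m :: nat
  assumes finV: "finite V"
    and \<phi>_in: "\<And>j i. j < t \<Longrightarrow> i < N \<Longrightarrow> \<phi> j i \<in> V"
    and \<phi>_inj: "\<And>j i j' i'. j < t \<Longrightarrow> i < N \<Longrightarrow> j' < t \<Longrightarrow> i' < N \<Longrightarrow> \<phi> j i = \<phi> j' i' \<Longrightarrow> j = j' \<and> i = i'"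
    and m_le: "m \<le> N" and t_pos: "t > 0" and r_pos: "r > 0"
begin

text \<open>Hyperedge i joins position \<open>M j i\<close> of every part j, and only i < m is used.
  Coding by full permutations keeps the parts independent and makes a uniform \<open>M\<close> a
  uniform ordered partial matching.\<close>

definition matchings :: "(nat \<Rightarrow> nat \<Rightarrow> nat) set" where
  "matchings = {..<t} \<rightarrow>\<^sub>E {\<pi>. \<pi> permutes {..<N}}"

definition label :: "(nat \<Rightarrow> nat \<Rightarrow> nat) \<Rightarrow> ('a \<Rightarrow> nat) \<Rightarrow> nat \<Rightarrow> nat" where
  "label M x = (\<lambda>i\<in>{..<m}. (\<Sum>j<t. x (\<phi> j (M j i))) mod r)"

text \<open>The transpose of \<open>label M\<close>, as \<open>chr_label\<close> shows. For a
  matching, distinct pairs (j, i) give distinct vertices, so at most one summand is nonzero: the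
  result equals u i on hyperedge i and 0 elsewhere.\<close>

definition lift :: "(nat \<Rightarrow> nat \<Rightarrow> nat) \<Rightarrow> (nat \<Rightarrow> nat) \<Rightarrow> 'a \<Rightarrow> nat" where
  "lift M u = (\<lambda>z\<in>V. \<Sum>i<m. \<Sum>j<t. if z = \<phi> j (M j i) then u i else 0)"

lemma finite_matchings [simp]: "finite matchings"
  by (simp add: matchings_def finite_PiE finite_permutations)

lemma card_matchings: "card matchings = fact N ^ t"
  by (simp add: matchings_def card_PiE card_permutations)

lemma matchingsD:
  assumes "M \<in> matchings" "j < t"
  shows "M j permutes {..<N}"
  using assms by (auto simp: matchings_def)

lemma matching_less:
  assumes "M \<in> matchings" "j < t" "i < m"
  shows "M j i < N"
  using permutes_in_image[OF matchingsD[OF assms(1,2)], of i] assms(3) m_le by auto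

lemma matching_inj:
  assumes "M \<in> matchings" "j < t" "M j i = M j i'"
  shows "i = i'"
  using permutes_inj[OF matchingsD[OF assms(1,2)]] assms(3) by (simp add: inj_eq)

lemma label_in: "label M x \<in> vecs r {..<m}"
  using r_pos by (auto simp: label_def)

lemma chr_label:
  assumes M: "M \<in> matchings"
  shows "chr r {..<m} u (label M x) = chr r V (lift M u) x"
proof -
  have "chr r {..<m} u (label M x) = (\<Prod>i<m. root_pow r (u i * (\<Sum>j<t. x (\<phi> j (M j i)))))"
    unfolding chr_def root_pow_sum
  proof (intro prod.cong refl)
    fix i assume "i \<in> {..<m}"
    then show "root_pow r (u i * label M x i) = root_pow r (u i * (\<Sum>j<t. x (\<phi> j (M j i))))"
      using r_pos by (simp add: label_def mult.commute[of "u i"] root_pow_mult)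
  qed
  also have "\<dots> = root_pow r (\<Sum>i<m. \<Sum>j<t. u i * x (\<phi> j (M j i)))"
    by (simp add: root_pow_sum sum_distrib_left)
  also have "(\<Sum>i<m. \<Sum>j<t. u i * x (\<phi> j (M j i)))
      = (\<Sum>i<m. \<Sum>j<t. \<Sum>z\<in>V. (if z = \<phi> j (M j i) then u i else 0) * x z)"
    using finV \<phi>_in matching_less[OF M]
    by (intro sum.cong refl) (simp add: if_distrib[of "\<lambda>y. y * _"] cong: if_cong)
  also have "\<dots> = (\<Sum>i<m. \<Sum>z\<in>V. \<Sum>j<t. (if z = \<phi> j (M j i) then u i else 0) * x z)"
    by (intro sum.cong refl sum.swap)
  also have "\<dots> = (\<Sum>z\<in>V. \<Sum>i<m. \<Sum>j<t. (if z = \<phi> j (M j i) then u i else 0) * x z)"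
    by (rule sum.swap)
  also have "\<dots> = (\<Sum>z\<in>V. lift M u z * x z)"
    by (simp add: lift_def sum_distrib_right)
  finally show ?thesis by (simp add: chr_def)
qed

lemma lift_vertex:
  assumes M: "M \<in> matchings" and "j < t" "i < m"
  shows "lift M u (\<phi> j (M j i)) = u i"
proof -
  have eq: "(\<phi> j (M j i) = \<phi> j' (M j' i')) \<longleftrightarrow> j' = j \<and> i' = i" if "j' < t" "i' < m" for j' i'
    using \<phi>_inj[OF assms(2) matching_less[OF assms] that(1) matching_less[OF M that]] matching_inj[OF M]
      assms(2) by metis
  have "lift M u (\<phi> j (M j i)) = (\<Sum>i'<m. \<Sum>j'<t. if j' = j \<and> i' = i then u i' else 0)"
    using \<phi>_in[OF assms(2) matching_less[OF assms]] by (simp add: lift_def eq cong: if_cong)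
  also have "\<dots> = (\<Sum>i'<m. if i' = i then u i' else 0)"
    using assms(2) by (intro sum.cong refl) auto
  finally show ?thesis using assms(3) by simp
qed

lemma lift_nonzeroE:
  assumes "lift M u z \<noteq> 0" "z \<in> V"
  obtains j i where "j < t" "i < m" "z = \<phi> j (M j i)"
proof -
  have "\<exists>j i. j < t \<and> i < m \<and> z = \<phi> j (M j i)"
  proof (rule ccontr)
    assume *: "\<not> ?thesis"
    have "(if z = \<phi> j (M j i) then u i else 0) = 0" if "j < t" "i < m" for j i
      using * that by auto
    then have "lift M u z = 0" using assms(2) by (simp add: lift_def)
    then show False using assms(1) by simp
  qed
  then show ?thesis using that by blast
qed

lemma lift_in:
  assumes M: "M \<in> matchings" and u: "u \<in> vecs r {..<m}"
  shows "lift M u \<in> vecs r V"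
proof (rule PiE_I)
  fix z assume z: "z \<in> V"
  show "lift M u z \<in> {..<r}"
  proof (cases "lift M u z = 0")
    case False
    then obtain j i where "j < t" "i < m" "z = \<phi> j (M j i)" using z by (rule lift_nonzeroE)
    then show ?thesis using lift_vertex[OF M] u by auto
  qed (use r_pos in simp)
qed (simp add: lift_def)

text \<open>Every nonzero entry of u is copied to the t vertices of its hyperedge, and no vertex is
  shared.\<close>

lemma wt_lift:
  assumes M: "M \<in> matchings"
  shows "wt V (lift M u) = t * wt {..<m} u"
proof -
  let ?L = "{i\<in>{..<m}. u i \<noteq> 0}"
  have inj: "inj_on (\<lambda>(j, i). \<phi> j (M j i)) ({..<t} \<times> ?L)"
  proof (rule inj_onI)
    fix p p' assume p: "p \<in> {..<t} \<times> ?L" "p' \<in> {..<t} \<times> ?L"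
      and eq: "(\<lambda>(j, i). \<phi> j (M j i)) p = (\<lambda>(j, i). \<phi> j (M j i)) p'"
    obtain j i j' i' where pp: "p = (j, i)" "p' = (j', i')" by (cases p, cases p')
    then have *: "j < t" "i < m" "j' < t" "i' < m" using p by auto
    then have "j = j' \<and> M j i = M j' i'"
      using matching_less[OF M] eq pp by (intro \<phi>_inj) auto
    then show "p = p'" using matching_inj[OF M *(1)] pp by blast
  qed
  have "{z\<in>V. lift M u z \<noteq> 0} = (\<lambda>(j, i). \<phi> j (M j i)) ` ({..<t} \<times> ?L)"
  proof (intro equalityI subsetI)
    fix z assume z: "z \<in> {z\<in>V. lift M u z \<noteq> 0}"
    then obtain j i where ji: "j < t" "i < m" "z = \<phi> j (M j i)"
      using lift_nonzeroE[of M u z] by blast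
    then have "u i \<noteq> 0" using z lift_vertex[OF M ji(1,2), of u] by simp
    then show "z \<in> (\<lambda>(j, i). \<phi> j (M j i)) ` ({..<t} \<times> ?L)"
      using ji by (intro image_eqI[of _ _ "(j, i)"]) auto
  next
    fix z assume "z \<in> (\<lambda>(j, i). \<phi> j (M j i)) ` ({..<t} \<times> ?L)"
    then obtain j i where ji: "j < t" "i < m" "u i \<noteq> 0" "z = \<phi> j (M j i)" by auto
    then show "z \<in> {z\<in>V. lift M u z \<noteq> 0}"
      using lift_vertex[OF M ji(1,2), of u] \<phi>_in[OF ji(1) matching_less[OF M ji(1,2)]] by simp
  qed
  then show ?thesis
    unfolding wt_def by (simp only: card_image[OF inj] card_cartesian_product card_lessThan)
qed

text \<open>The parts are permuted independently, so the bound for a single permutation is raised to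
  the power t.\<close>

lemma card_matchings_image_le:
  assumes "L \<subseteq> {..<m}" "card L = l"
  shows "real (card {M\<in>matchings. \<forall>j<t. M j ` L = S j}) \<le> real (card matchings) / real (N choose l) ^ t"
proof -
  have L: "L \<subseteq> {..<N}" using assms(1) m_le by auto
  have lN: "l \<le> N" using card_mono[OF _ L] assms(2) by simp
  have "{M\<in>matchings. \<forall>j<t. M j ` L = S j} = (\<Pi>\<^sub>E j\<in>{..<t}. {\<pi>. \<pi> permutes {..<N} \<and> \<pi> ` L = S j})"
    unfolding matchings_def by (intro set_eqI, simp add: PiE_iff Ball_def, blast)
  then have "real (card {M\<in>matchings. \<forall>j<t. M j ` L = S j})
      = (\<Prod>j<t. real (card {\<pi>. \<pi> permutes {..<N} \<and> \<pi> ` L = S j}))"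
    by (simp add: card_PiE)
  also have "\<dots> \<le> (\<Prod>j<t. fact N / real (N choose l))"
  proof (rule prod_mono)
    fix j
    have "card {\<pi>. \<pi> permutes {..<N} \<and> \<pi> ` L = S j} * (N choose l) \<le> fact N"
      using card_permutes_image_le[OF _ L, of "S j"] assms(2) by simp
    then have "real (card {\<pi>. \<pi> permutes {..<N} \<and> \<pi> ` L = S j}) * real (N choose l) \<le> real (fact N)"
      by (metis of_nat_le_iff of_nat_mult)
    then show "0 \<le> real (card {\<pi>. \<pi> permutes {..<N} \<and> \<pi> ` L = S j}) \<and>
        real (card {\<pi>. \<pi> permutes {..<N} \<and> \<pi> ` L = S j}) \<le> fact N / real (N choose l)"
      using lN by (simp add: le_divide_eq)
  qed
  also have "\<dots> = real (card matchings) / real (N choose l) ^ t"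
    by (simp add: card_matchings power_divide)
  finally show ?thesis .
qed

text \<open>Given M, the vector u can be read off v at the vertices of the hyperedges. Its support L
  must be carried by M onto the support of v in every part, so the count follows by summing
  \<open>card_matchings_image_le\<close> over all candidates L.\<close>

lemma sum_card_lift_preimage_le:
  "(\<Sum>M\<in>matchings. real (card {u\<in>vecs r {..<m}. wt {..<m} u = l \<and> lift M u = v}))
    \<le> real (card matchings) * (real (m choose l) / real (N choose l) ^ t)"
proof -
  define S where "S j = {i. i < N \<and> v (\<phi> j i) \<noteq> 0}" for j
  define \<L> where "\<L> = {L. L \<subseteq> {..<m} \<and> card L = l}"
  have fin: "finite \<L>" by (simp add: \<L>_def)
  have "card {u\<in>vecs r {..<m}. wt {..<m} u = l \<and> lift M u = v} \<le> card {L\<in>\<L>. \<forall>j<t. M j ` L = S j}"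
    if M: "M \<in> matchings" for M
  proof (rule card_inj_on_le[where f = "\<lambda>u. {i\<in>{..<m}. u i \<noteq> 0}"])
    show "inj_on (\<lambda>u. {i\<in>{..<m}. u i \<noteq> 0}) {u\<in>vecs r {..<m}. wt {..<m} u = l \<and> lift M u = v}"
    proof (rule inj_onI)
      fix u u' assume u: "u \<in> {u\<in>vecs r {..<m}. wt {..<m} u = l \<and> lift M u = v}"
        and u': "u' \<in> {u\<in>vecs r {..<m}. wt {..<m} u = l \<and> lift M u = v}"
      show "u = u'"
      proof (rule PiE_ext)
        show "u \<in> vecs r {..<m}" "u' \<in> vecs r {..<m}" using u u' by blast+
        fix i assume "i \<in> {..<m}"
        then show "u i = u' i"
          using lift_vertex[OF M t_pos, of i u] lift_vertex[OF M t_pos, of i u'] u u' by simp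
      qed
    qed
    show "(\<lambda>u. {i\<in>{..<m}. u i \<noteq> 0}) ` {u\<in>vecs r {..<m}. wt {..<m} u = l \<and> lift M u = v}
        \<subseteq> {L\<in>\<L>. \<forall>j<t. M j ` L = S j}"
    proof (rule image_subsetI)
      fix u assume u: "u \<in> {u\<in>vecs r {..<m}. wt {..<m} u = l \<and> lift M u = v}"
      let ?L = "{i\<in>{..<m}. u i \<noteq> 0}"
      have "M j ` ?L = S j" if j: "j < t" for j
      proof (intro equalityI subsetI)
        fix i assume "i \<in> M j ` ?L"
        then obtain i' where "i' < m" "u i' \<noteq> 0" "i = M j i'" by auto
        then show "i \<in> S j"
          using lift_vertex[OF M j \<open>i' < m\<close>, of u] matching_less[OF M j \<open>i' < m\<close>] u by (simp add: S_def)
      next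
        fix i assume i: "i \<in> S j"
        then have "lift M u (\<phi> j i) \<noteq> 0" "i < N" using u by (auto simp: S_def)
        then obtain j' i' where *: "j' < t" "i' < m" "\<phi> j i = \<phi> j' (M j' i')"
          using lift_nonzeroE[of M u "\<phi> j i"] \<phi>_in[OF j] by blast
        then have "j = j'" "i = M j' i'"
          using \<phi>_inj[OF j \<open>i < N\<close> *(1) matching_less[OF M *(1,2)]] by auto
        moreover have "u i' \<noteq> 0"
          using lift_vertex[OF M *(1,2), of u] \<open>lift M u (\<phi> j i) \<noteq> 0\<close> *(3) by simp
        ultimately show "i \<in> M j ` ?L" using *(2) by blast
      qed
      then show "?L \<in> {L\<in>\<L>. \<forall>j<t. M j ` L = S j}"
        using u by (auto simp: \<L>_def wt_def)
    qed
    show "finite {L\<in>\<L>. \<forall>j<t. M j ` L = S j}" using fin by simp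
  qed
  then have "(\<Sum>M\<in>matchings. real (card {u\<in>vecs r {..<m}. wt {..<m} u = l \<and> lift M u = v}))
      \<le> (\<Sum>M\<in>matchings. real (card {L\<in>\<L>. \<forall>j<t. M j ` L = S j}))"
    by (intro sum_mono) simp
  also have "\<dots> = (\<Sum>M\<in>matchings. \<Sum>L\<in>\<L>. of_bool (\<forall>j<t. M j ` L = S j))"
    using fin by (intro sum.cong refl) (simp add: of_bool_def sum.If_cases Int_def)
  also have "\<dots> = (\<Sum>L\<in>\<L>. real (card {M\<in>matchings. \<forall>j<t. M j ` L = S j}))"
    by (subst sum.swap) (intro sum.cong refl, simp add: of_bool_def sum.If_cases Int_def)
  also have "\<dots> \<le> (\<Sum>L\<in>\<L>. real (card matchings) / real (N choose l) ^ t)"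
    by (intro sum_mono card_matchings_image_le) (auto simp: \<L>_def)
  also have "\<dots> = real (card matchings) * (real (m choose l) / real (N choose l) ^ t)"
    using n_subsets[of "{..<m}" l] by (simp add: \<L>_def)
  finally show ?thesis .
qed

text \<open>Double counting: nonzero label frequencies are grouped by weight l and by their lift v,
  which has weight t l, and the sum over matchings is then carried out for fixed v.\<close>

lemma sum_lift_fourier_le:
  fixes F :: "('a \<Rightarrow> nat) \<Rightarrow> real"
  assumes F: "\<And>v. 0 \<le> F v"
  shows "(\<Sum>M\<in>matchings. \<Sum>u\<in>vecs r {..<m} - {\<lambda>i\<in>{..<m}. 0}. F (lift M u))
    \<le> real (card matchings) * (\<Sum>l\<in>{1..m}. real (m choose l) / real (N choose l) ^ t *
        (\<Sum>v | v \<in> vecs r V \<and> wt V v = t * l. F v))"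
proof -
  let ?A = "\<lambda>l. {v. v \<in> vecs r V \<and> wt V v = t * l}"
  let ?U = "\<lambda>l. {u\<in>vecs r {..<m}. wt {..<m} u = l}"
  have finA: "finite (?A l)" for l using finV by simp
  have finU: "finite (?U l)" for l by simp
  have setc: "{u\<in>?U l. lift M u = v} = {u\<in>vecs r {..<m}. wt {..<m} u = l \<and> lift M u = v}" for M l v
    by blast
  have decomp: "vecs r {..<m} - {\<lambda>i\<in>{..<m}. 0} = (\<Union>l\<in>{1..m}. ?U l)"
  proof (intro equalityI subsetI)
    fix u assume u: "u \<in> vecs r {..<m} - {\<lambda>i\<in>{..<m}. 0}"
    have "\<exists>i<m. u i \<noteq> 0"
    proof (rule ccontr)
      assume "\<not> (\<exists>i<m. u i \<noteq> 0)"
      then have "u = (\<lambda>i\<in>{..<m}. 0)" using u by (auto simp: PiE_iff extensional_def fun_eq_iff)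
      then show False using u by blast
    qed
    then have "wt {..<m} u > 0" by (auto simp: wt_def card_gt_0_iff)
    moreover have "wt {..<m} u \<le> card {..<m}" unfolding wt_def by (intro card_mono) auto
    ultimately show "u \<in> (\<Union>l\<in>{1..m}. ?U l)" using u by auto
  next
    fix u assume "u \<in> (\<Union>l\<in>{1..m}. ?U l)"
    then obtain l where l: "l \<ge> 1" "u \<in> vecs r {..<m}" "wt {..<m} u = l" by auto
    have "wt {..<m} (\<lambda>i\<in>{..<m}. 0) = 0" by (simp add: wt_def)
    then have "u \<noteq> (\<lambda>i\<in>{..<m}. 0)" using l by (metis not_one_le_zero)
    then show "u \<in> vecs r {..<m} - {\<lambda>i\<in>{..<m}. 0}" using l(2) by blast
  qed
  have "(\<Sum>M\<in>matchings. \<Sum>u\<in>vecs r {..<m} - {\<lambda>i\<in>{..<m}. 0}. F (lift M u))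
      = (\<Sum>M\<in>matchings. \<Sum>l\<in>{1..m}. \<Sum>u\<in>?U l. F (lift M u))"
    unfolding decomp
    by (rule sum.cong[OF refl], rule sum.UNION_disjoint[OF _ ballI[OF finU]]) (simp, blast)
  also have "\<dots> = (\<Sum>M\<in>matchings. \<Sum>l\<in>{1..m}. \<Sum>v\<in>?A l. F v * real (card {u\<in>?U l. lift M u = v}))"
  proof (intro sum.cong refl)
    fix M l assume M: "M \<in> matchings"
    have "(\<Sum>u\<in>?U l. F (lift M u)) = (\<Sum>v\<in>?A l. \<Sum>u | u \<in> ?U l \<and> lift M u = v. F (lift M u))"
      using lift_in[OF M] wt_lift[OF M] finA finU by (intro sum.group[symmetric]) auto
    also have "\<dots> = (\<Sum>v\<in>?A l. F v * real (card {u\<in>?U l. lift M u = v}))"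
      by (intro sum.cong refl) simp
    finally show "(\<Sum>u\<in>?U l. F (lift M u)) = (\<Sum>v\<in>?A l. F v * real (card {u\<in>?U l. lift M u = v}))" .
  qed
  also have "\<dots> = (\<Sum>l\<in>{1..m}. \<Sum>v\<in>?A l. F v * (\<Sum>M\<in>matchings. real (card {u\<in>?U l. lift M u = v})))"
    unfolding sum_distrib_left by (subst sum.swap, intro sum.cong refl, subst sum.swap, rule refl)
  also have "\<dots> \<le> (\<Sum>l\<in>{1..m}. \<Sum>v\<in>?A l. F v * (real (card matchings) * (real (m choose l) / real (N choose l) ^ t)))"
    unfolding setc by (intro sum_mono mult_left_mono sum_card_lift_preimage_le F)
  also have "\<dots> = real (card matchings) * (\<Sum>l\<in>{1..m}. real (m choose l) / real (N choose l) ^ t * (\<Sum>v\<in>?A l. F v))"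
    unfolding sum_distrib_right[symmetric] unfolding sum_distrib_left[of "real (card matchings)"]
    by (simp only: mult_ac)
  finally show ?thesis .
qed

end

section \<open>One stage\<close>

text \<open>Replacing m by N in the numerator cancels one of the t binomials. The remaining exponent
  t - 1 is what finally becomes 1 - 1/t.\<close>

lemma inverse_binomial_power_le:
  assumes "1 \<le> l" "l \<le> m" "m \<le> N" "t \<ge> 1"
  shows "real (m choose l) / real (N choose l) ^ t \<le> ((real l / real N) ^ (t - 1)) ^ l"
proof -
  have pos: "real (N choose l) > 0" using assms by simp
  have "real (m choose l) \<le> real (N choose l)"
    using assms by (simp add: binomial_right_mono)
  then have "real (m choose l) / real (N choose l) ^ t \<le> real (N choose l) / real (N choose l) ^ t"
    by (intro divide_right_mono) auto
  also have "\<dots> = (1 / real (N choose l)) ^ (t - 1)"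
    using assms(4) pos by (cases t) (simp_all add: power_one_over field_simps)
  also have "\<dots> \<le> ((real l / real N) ^ l) ^ (t - 1)"
  proof (rule power_mono)
    have "(real N / real l) ^ l \<le> real (N choose l)"
      using binomial_ge_n_over_k_pow_k[of l N, where 'a=real] assms by simp
    then have "1 / real (N choose l) \<le> 1 / (real N / real l) ^ l"
      using assms by (intro divide_left_mono) auto
    also have "\<dots> = (real l / real N) ^ l" by (simp add: power_divide)
    finally show "1 / real (N choose l) \<le> (real l / real N) ^ l" .
  qed simp
  also have "\<dots> = ((real l / real N) ^ (t - 1)) ^ l"
    by (simp only: power_mult[symmetric] mult.commute)
  finally show ?thesis .
qed

lemma sum_half_powers_le: "(\<Sum>l\<in>{1..m}. (1/2 :: real) ^ l) \<le> 1"
proof -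
  have "(\<Sum>l\<in>{1..m}. (1/2 :: real) ^ l) = 1 - (1/2) ^ m"
    by (induction m) auto
  then show ?thesis by simp
qed

context block_matching
begin

text \<open>
  The two terms of the bound come from the two regimes of the level inequality: characters of
  weight at most \<open>S\<close>, where the moment order is about \<open>S / (t l)\<close>, and heavier characters,
  where it is \<open>1\<close> and the sparsity \<open>m / N\<close> of the matching does the work.
\<close>

lemma fourier_mass_le:
  fixes f :: "('a \<Rightarrow> nat) \<Rightarrow> real" and \<kappa> :: real
  assumes t: "t \<ge> 2" and sparse: "(64 * r)\<^sup>2 * m \<le> N"
    and \<kappa>: "0 \<le> \<kappa>" "\<kappa> \<le> 1/2"
    and S: "(64 * real r * real S) ^ t \<le> (\<kappa> * real t) ^ t * real N ^ (t - 1)"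
    and f: "\<And>x. x \<in> vecs r V \<Longrightarrow> 0 \<le> f x" "\<And>x. x \<in> vecs r V \<Longrightarrow> f x \<le> 1"
    and mu: "(1/2) ^ S \<le> avg r V f"
  shows "(\<Sum>M\<in>matchings. \<Sum>u\<in>vecs r {..<m} - {\<lambda>i\<in>{..<m}. 0}. (norm (fourier r V f (lift M u)))\<^sup>2)
    \<le> real (card matchings) * ((avg r V f)\<^sup>2 * (2 * \<kappa> ^ t + (1/2) ^ (S div 2)))"
proof -
  define \<mu> where "\<mu> = avg r V f"
  have term_le: "real (m choose l) / real (N choose l) ^ t *
        (\<Sum>v | v \<in> vecs r V \<and> wt V v = t * l. (norm (fourier r V f v))\<^sup>2)
      \<le> \<mu>\<^sup>2 * (2 * \<kappa> ^ t + (1/2) ^ (S div 2)) * (1/2) ^ l" if l: "l \<in> {1..m}" for l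
  proof -
    have l1: "l \<ge> 1" "l \<le> m" and lN: "real l > 0" "real N > 0" using l m_le by auto
    have level: "real (m choose l) / real (N choose l) ^ t *
        (\<Sum>v | v \<in> vecs r V \<and> wt V v = t * l. (norm (fourier r V f v))\<^sup>2)
      \<le> \<mu>\<^sup>2 * ((real l / real N) ^ (t - 1) * (32 * real r * real k) ^ t) ^ l"
      if k: "k > 0" "S \<le> k * (t * l)" for k
    proof -
      have "real (m choose l) / real (N choose l) ^ t *
        (\<Sum>v | v \<in> vecs r V \<and> wt V v = t * l. (norm (fourier r V f v))\<^sup>2)
        \<le> ((real l / real N) ^ (t - 1)) ^ l * (\<mu>\<^sup>2 * (32 * real r * real k) ^ (t * l))"
        unfolding \<mu>_def
        by (intro mult_mono inverse_binomial_power_le level_inequality[OF finV r_pos k(1) f mu k(2)] sum_nonneg)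
          (use l1 m_le t in auto)
      then show ?thesis
        unfolding power_mult power_mult_distrib[of "(real l / real N) ^ (t - 1)"] by (simp only: mult_ac)
    qed
    show ?thesis
    proof (cases "t * l \<le> S")
      case True
      \<comment> \<open>The least moment order with S < k t l. As t l <= S, also k t l <= 2 S, which
        turns the 32 of the level inequality into the 64 of the hypothesis on S.\<close>
      define k where "k = Suc (S div (t * l))"
      have tl: "t * l > 0" using t l1 by simp
      have k: "k > 0" "S \<le> k * (t * l)"
      proof -
        have "S \<le> t * l + S div (t * l) * (t * l)"
          using mod_less_divisor[OF tl, of S] div_mult_mod_eq[of S "t * l"] by linarith
        then show "k > 0" "S \<le> k * (t * l)" by (simp_all add: k_def)
      qed
      have "k * (t * l) \<le> 2 * S"
        using True div_times_less_eq_dividend[of S "t * l"] unfolding k_def mult_Suc by linarith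
      then have kS: "real k * (real t * real l) \<le> 2 * real S"
        by (metis of_nat_le_iff of_nat_mult of_nat_numeral)
      have "(32 * real r * real k) * (real t * real l) \<le> 64 * real r * real S"
        using mult_left_mono[OF kS, of "32 * real r"] by (simp add: mult_ac)
      then have "((32 * real r * real k) * (real t * real l)) ^ t \<le> (\<kappa> * real t) ^ t * real N ^ (t - 1)"
        using S by (intro order_trans[OF power_mono S]) auto
      then have "real t ^ t * ((32 * real r * real k) ^ t * real l ^ t) \<le> real t ^ t * (\<kappa> ^ t * real N ^ (t - 1))"
        by (simp only: power_mult_distrib mult_ac)
      then have "(32 * real r * real k) ^ t * real l ^ t \<le> \<kappa> ^ t * real N ^ (t - 1)"
        by (rule mult_left_le_imp_le) (use t in simp)
      moreover have "real l ^ t = real l * real l ^ (t - 1)" using t by (cases t) auto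
      ultimately have "real l * (real l ^ (t - 1) * (32 * real r * real k) ^ t) \<le> \<kappa> ^ t * real N ^ (t - 1)"
        by (simp only: mult_ac)
      moreover have "1 * (real l ^ (t - 1) * (32 * real r * real k) ^ t) \<le> real l * (real l ^ (t - 1) * (32 * real r * real k) ^ t)"
        using l1 by (intro mult_right_mono) auto
      ultimately have "real l ^ (t - 1) * (32 * real r * real k) ^ t \<le> \<kappa> ^ t * real N ^ (t - 1)"
        unfolding mult_1 by (rule order_trans[rotated])
      then have "(real l ^ (t - 1) * (32 * real r * real k) ^ t) / real N ^ (t - 1) \<le> \<kappa> ^ t"
        using lN by (subst pos_divide_le_eq) simp_all
      then have inner: "(real l / real N) ^ (t - 1) * (32 * real r * real k) ^ t \<le> \<kappa> ^ t"
        by (simp add: power_divide)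
      have "\<kappa> ^ t \<le> \<kappa> ^ 1" using \<kappa> t by (intro power_decreasing) auto
      then have half: "\<kappa> ^ t \<le> 1/2" using \<kappa> by simp
      \<comment> \<open>One factor \<open>\<kappa> ^ t\<close> is kept; the other l - 1 factors are
        at most 1/2 each and make the sum over l geometric.\<close>
      obtain l' where l': "l = Suc l'" using l1 by (cases l) auto
      have "((real l / real N) ^ (t - 1) * (32 * real r * real k) ^ t) ^ l \<le> (\<kappa> ^ t) ^ l"
        by (rule power_mono[OF inner]) auto
      also have "\<dots> \<le> \<kappa> ^ t * (1/2) ^ l'"
        unfolding l' power_Suc using half \<kappa> by (intro mult_left_mono power_mono) auto
      also have "\<dots> = 2 * \<kappa> ^ t * (1/2) ^ l" by (simp add: l')
      also have "\<dots> \<le> (2 * \<kappa> ^ t + (1/2) ^ (S div 2)) * (1/2) ^ l"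
        by (intro mult_right_mono) auto
      finally have "\<mu>\<^sup>2 * ((real l / real N) ^ (t - 1) * (32 * real r * real k) ^ t) ^ l
          \<le> \<mu>\<^sup>2 * ((2 * \<kappa> ^ t + (1/2) ^ (S div 2)) * (1/2) ^ l)"
        by (rule mult_left_mono) simp
      with level[OF k] show ?thesis unfolding mult.assoc[of "\<mu>\<^sup>2"] by (rule order_trans)
    next
      case False
      \<comment> \<open>Moment order 1 is enough here: sparsity gives l / N <= (64 r)^(-2), and 2 (t
        - 1) >= t, so the power t - 1 of this beats (32 r)^t and leaves 2^(-t).\<close>
      have "64 * real r * (64 * real r) * real l \<le> 64 * real r * (64 * real r) * real m"
        using l1 by (intro mult_left_mono) auto
      also have "\<dots> = real ((64 * r)\<^sup>2 * m)" by (simp add: power2_eq_square)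
      also have "\<dots> \<le> real N" using sparse by (simp only: of_nat_le_iff)
      finally have "real l / real N \<le> (1 / (64 * real r))\<^sup>2"
        using lN r_pos by (simp add: power2_eq_square field_simps)
      then have "(real l / real N) ^ (t - 1) \<le> ((1 / (64 * real r))\<^sup>2) ^ (t - 1)"
        by (intro power_mono) auto
      also have "\<dots> = (1 / (64 * real r)) ^ (2 * (t - 1))" by (simp only: power_mult)
      also have "\<dots> \<le> (1 / (64 * real r)) ^ t"
        using t r_pos by (intro power_decreasing) auto
      finally have "(real l / real N) ^ (t - 1) * (32 * real r * real (1::nat)) ^ t
          \<le> (1 / (64 * real r)) ^ t * (32 * real r * real (1::nat)) ^ t"
        by (rule mult_right_mono) simp
      also have "\<dots> = (1/2) ^ t"
        unfolding power_mult_distrib[symmetric] using r_pos by simp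
      finally have inner: "(real l / real N) ^ (t - 1) * (32 * real r * real (1::nat)) ^ t \<le> (1/2) ^ t" .
      have "2 * l \<le> t * l" using t by simp
      \<comment> \<open>Twice t l is at least 2 l + S, so 2^(-t l) pays both for the geometric
        factor in l and for the term 2^(-S/2).\<close>
      then have exps: "l + S div 2 \<le> t * l" using False by linarith
      have "((real l / real N) ^ (t - 1) * (32 * real r * real (1::nat)) ^ t) ^ l \<le> ((1/2) ^ t) ^ l"
        by (rule power_mono[OF inner]) auto
      also have "\<dots> = (1/2) ^ (t * l)" by (simp only: power_mult)
      also have "\<dots> \<le> (1/2) ^ (l + S div 2)" using exps by (intro power_decreasing) auto
      also have "\<dots> = (1/2) ^ (S div 2) * (1/2) ^ l" by (simp add: power_add)
      also have "\<dots> \<le> (2 * \<kappa> ^ t + (1/2) ^ (S div 2)) * (1/2) ^ l"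
        using \<kappa> by (intro mult_right_mono) auto
      finally have "\<mu>\<^sup>2 * ((real l / real N) ^ (t - 1) * (32 * real r * real (1::nat)) ^ t) ^ l
          \<le> \<mu>\<^sup>2 * ((2 * \<kappa> ^ t + (1/2) ^ (S div 2)) * (1/2) ^ l)"
        by (rule mult_left_mono) simp
      moreover have "S \<le> 1 * (t * l)" using False by simp
      note level[OF zero_less_one this]
      ultimately show ?thesis unfolding mult.assoc[of "\<mu>\<^sup>2"] by (rule order_trans[rotated])
    qed
  qed
  have "(\<Sum>l\<in>{1..m}. real (m choose l) / real (N choose l) ^ t *
        (\<Sum>v | v \<in> vecs r V \<and> wt V v = t * l. (norm (fourier r V f v))\<^sup>2))
      \<le> (\<Sum>l\<in>{1..m}. \<mu>\<^sup>2 * (2 * \<kappa> ^ t + (1/2) ^ (S div 2)) * (1/2) ^ l)"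
    by (rule sum_mono[OF term_le])
  also have "\<dots> \<le> \<mu>\<^sup>2 * (2 * \<kappa> ^ t + (1/2) ^ (S div 2)) * 1"
    unfolding sum_distrib_left[symmetric] using \<kappa>
    by (intro mult_left_mono sum_half_powers_le) auto
  finally have "(\<Sum>l\<in>{1..m}. real (m choose l) / real (N choose l) ^ t *
        (\<Sum>v | v \<in> vecs r V \<and> wt V v = t * l. (norm (fourier r V f v))\<^sup>2))
      \<le> (avg r V f)\<^sup>2 * (2 * \<kappa> ^ t + (1/2) ^ (S div 2))" by (simp add: \<mu>_def)
  then have "real (card matchings) * (\<Sum>l\<in>{1..m}. real (m choose l) / real (N choose l) ^ t *
        (\<Sum>v | v \<in> vecs r V \<and> wt V v = t * l. (norm (fourier r V f v))\<^sup>2))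
      \<le> real (card matchings) * ((avg r V f)\<^sup>2 * (2 * \<kappa> ^ t + (1/2) ^ (S div 2)))"
    by (rule mult_left_mono) simp
  then show ?thesis
    using sum_lift_fourier_le[of "\<lambda>v. (norm (fourier r V f v))\<^sup>2"] by simp
qed

definition matching_avg :: "((nat \<Rightarrow> nat \<Rightarrow> nat) \<Rightarrow> real) \<Rightarrow> real" where
  "matching_avg g = (\<Sum>M\<in>matchings. g M) / real (card matchings)"

text \<open>In the application \<open>f a x\<close> is the probability of memory content a given the
  hidden assignment x, and \<open>G a M w\<close> the probability of later acceptance. For contents
  of mean at least 2^(-S), Cauchy-Schwarz over the matchings converts \<open>fourier_mass_le\<close>
  into a loss of sqrt \<eta> times the mean; the means sum to at most 1, so these losses do not add
  up with the number of contents. Each remaining content costs at most its mean, which is below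
  2^(-S).\<close>

lemma stage_distinguishing_le:
  fixes f :: "'m \<Rightarrow> ('a \<Rightarrow> nat) \<Rightarrow> real" and G :: "'m \<Rightarrow> (nat \<Rightarrow> nat \<Rightarrow> nat) \<Rightarrow> (nat \<Rightarrow> nat) \<Rightarrow> real"
  assumes t: "t \<ge> 2" and sparse: "(64 * r)\<^sup>2 * m \<le> N"
    and \<kappa>: "0 \<le> \<kappa>" "\<kappa> \<le> 1/2"
    and S: "(64 * real r * real S) ^ t \<le> (\<kappa> * real t) ^ t * real N ^ (t - 1)"
    and A: "finite A"
    and f0: "\<And>a x. a \<in> A \<Longrightarrow> x \<in> vecs r V \<Longrightarrow> 0 \<le> f a x"
    and f1: "\<And>x. x \<in> vecs r V \<Longrightarrow> (\<Sum>a\<in>A. f a x) \<le> 1"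
    and G: "\<And>a M w. 0 \<le> G a M w" "\<And>a M w. G a M w \<le> 1"
  shows "\<bar>avg r V (\<lambda>x. \<Sum>a\<in>A. f a x * matching_avg (\<lambda>M. G a M (label M x)))
      - avg r V (\<lambda>x. \<Sum>a\<in>A. f a x * matching_avg (\<lambda>M. avg r {..<m} (G a M)))\<bar>
    \<le> sqrt (2 * \<kappa> ^ t + (1/2) ^ (S div 2)) + real (card A) * (1/2) ^ S"
proof -
  define \<eta> where "\<eta> = 2 * \<kappa> ^ t + (1/2) ^ (S div 2)"
  define D where "D a M = avg r V (\<lambda>x. f a x * (G a M (label M x) - avg r {..<m} (G a M)))" for a M
  have eta0: "\<eta> \<ge> 0" using \<kappa> by (simp add: \<eta>_def)
  have cM: "real (card matchings) > 0" by (simp add: card_matchings)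
  have cV: "real (r ^ card V) > 0" using r_pos by simp
  have avg01: "0 \<le> avg r {..<m} (G a M)" "avg r {..<m} (G a M) \<le> 1" for a M
  proof -
    show "0 \<le> avg r {..<m} (G a M)" using G by (simp add: avg_def sum_nonneg)
    have "(\<Sum>w\<in>vecs r {..<m}. G a M w) \<le> (\<Sum>w\<in>vecs r {..<m}. 1)" by (intro sum_mono G)
    then show "avg r {..<m} (G a M) \<le> 1" using r_pos by (simp add: avg_def card_vecs)
  qed
  have le1: "f a x \<le> 1" if "a \<in> A" "x \<in> vecs r V" for a x
    using member_le_sum[OF that(1), of "\<lambda>a. f a x"] f0[OF _ that(2)] A f1[OF that(2)] by force
  have mu0: "0 \<le> avg r V (f a)" if "a \<in> A" for a
    using f0[OF that] by (simp add: avg_def sum_nonneg)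
  have single: "\<bar>matching_avg (D a)\<bar> \<le> sqrt \<eta> * avg r V (f a) + (1/2) ^ S" if a: "a \<in> A" for a
  proof (cases "(1/2) ^ S \<le> avg r V (f a)")
    case True
    define Z where "Z M = (\<Sum>u\<in>vecs r {..<m} - {\<lambda>i\<in>{..<m}. 0}. (norm (fourier r V (f a) (lift M u)))\<^sup>2)" for M
    have Z0: "Z M \<ge> 0" for M by (simp add: Z_def sum_nonneg)
    have DZ: "\<bar>D a M\<bar> \<le> sqrt (Z M)" if M: "M \<in> matchings" for M
      unfolding D_def Z_def
      by (rule label_bias_le[OF finV _ r_pos label_in chr_label[OF M]]) (use G in \<open>auto simp: abs_le_iff intro: order_trans[of _ 0]\<close>)
    have "(\<Sum>M\<in>matchings. sqrt (Z M))\<^sup>2 \<le> (\<Sum>M\<in>matchings. (sqrt (Z M))\<^sup>2) * real (card matchings)"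
      by (rule sum_squared_le_sum_of_squares) 
    also have "(\<Sum>M\<in>matchings. (sqrt (Z M))\<^sup>2) = (\<Sum>M\<in>matchings. Z M)" by (simp add: Z0)
    also have "\<dots> \<le> real (card matchings) * ((avg r V (f a))\<^sup>2 * \<eta>)"
      unfolding Z_def \<eta>_def by (rule fourier_mass_le[OF t sparse \<kappa> S f0[OF a] le1[OF a] True])
    finally have "(\<Sum>M\<in>matchings. sqrt (Z M))\<^sup>2
        \<le> real (card matchings) * ((avg r V (f a))\<^sup>2 * \<eta>) * real (card matchings)"
      by (simp add: mult_right_mono)
    also have "\<dots> = (real (card matchings) * (avg r V (f a) * sqrt \<eta>))\<^sup>2"
      unfolding power_mult_distrib real_sqrt_pow2[OF eta0] by (simp only: power2_eq_square mult_ac)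
    finally have "(\<Sum>M\<in>matchings. sqrt (Z M))\<^sup>2 \<le> (real (card matchings) * (avg r V (f a) * sqrt \<eta>))\<^sup>2" .
    then have "(\<Sum>M\<in>matchings. sqrt (Z M)) \<le> real (card matchings) * (avg r V (f a) * sqrt \<eta>)"
      by (rule power2_le_imp_le) (use mu0[OF a] eta0 in simp)
    moreover have "\<bar>\<Sum>M\<in>matchings. D a M\<bar> \<le> (\<Sum>M\<in>matchings. sqrt (Z M))"
      by (rule order_trans[OF sum_abs sum_mono[OF DZ]])
    ultimately have "\<bar>\<Sum>M\<in>matchings. D a M\<bar> \<le> real (card matchings) * (avg r V (f a) * sqrt \<eta>)" by linarith
    then have "\<bar>matching_avg (D a)\<bar> \<le> avg r V (f a) * sqrt \<eta>"
      using cM by (simp add: matching_avg_def divide_le_eq mult.commute)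
    then show ?thesis by (simp add: mult.commute add_increasing2)
  next
    case False
    have "\<bar>D a M\<bar> \<le> (1/2) ^ S" for M
    proof -
      have "\<bar>D a M\<bar> \<le> (\<Sum>x\<in>vecs r V. \<bar>f a x * (G a M (label M x) - avg r {..<m} (G a M))\<bar>) / real (r ^ card V)"
        unfolding D_def avg_def using cV by (simp add: divide_right_mono sum_abs)
      also have "\<dots> \<le> (\<Sum>x\<in>vecs r V. f a x) / real (r ^ card V)"
      proof (intro divide_right_mono sum_mono)
        fix x assume x: "x \<in> vecs r V"
        have "\<bar>G a M (label M x) - avg r {..<m} (G a M)\<bar> \<le> 1"
          using G[of a M "label M x"] avg01[of a M] by linarith
        then show "\<bar>f a x * (G a M (label M x) - avg r {..<m} (G a M))\<bar> \<le> f a x"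
          using f0[OF a x] by (simp add: abs_mult mult_left_le)
      qed simp
      finally show ?thesis using False by (simp add: avg_def)
    qed
    then have "(\<Sum>M\<in>matchings. \<bar>D a M\<bar>) \<le> (\<Sum>M\<in>matchings. (1/2) ^ S)" by (rule sum_mono)
    then have "\<bar>\<Sum>M\<in>matchings. D a M\<bar> \<le> (\<Sum>M\<in>matchings. (1/2) ^ S)"
      by (rule order_trans[OF sum_abs])
    then have "\<bar>\<Sum>M\<in>matchings. D a M\<bar> \<le> real (card matchings) * (1/2) ^ S" by simp
    then have "\<bar>matching_avg (D a)\<bar> \<le> (1/2) ^ S"
      using cM by (simp add: matching_avg_def divide_le_eq mult.commute)
    then show ?thesis using mu0[OF a] eta0 by (simp add: add_increasing)
  qed
  have "avg r V (\<lambda>x. \<Sum>a\<in>A. f a x * matching_avg (\<lambda>M. G a M (label M x)))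
      - avg r V (\<lambda>x. \<Sum>a\<in>A. f a x * matching_avg (\<lambda>M. avg r {..<m} (G a M)))
      = avg r V (\<lambda>x. \<Sum>a\<in>A. f a x * matching_avg (\<lambda>M. G a M (label M x) - avg r {..<m} (G a M)))"
    by (simp add: avg_def matching_avg_def sum_subtractf right_diff_distrib diff_divide_distrib)
  also have "\<dots> = (\<Sum>a\<in>A. matching_avg (D a))"
  proof -
    have "avg r V (\<lambda>x. \<Sum>a\<in>A. f a x * matching_avg (\<lambda>M. G a M (label M x) - avg r {..<m} (G a M)))
      = (\<Sum>a\<in>A. avg r V (\<lambda>x. f a x * matching_avg (\<lambda>M. G a M (label M x) - avg r {..<m} (G a M))))"
      unfolding avg_def by (subst sum.swap) (simp add: sum_divide_distrib)
    also have "\<dots> = (\<Sum>a\<in>A. matching_avg (D a))"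
    proof (rule sum.cong[OF refl])
      fix a
      show "avg r V (\<lambda>x. f a x * matching_avg (\<lambda>M. G a M (label M x) - avg r {..<m} (G a M))) = matching_avg (D a)"
        unfolding D_def matching_avg_def avg_def[of r V]
        unfolding times_divide_eq_right sum_distrib_left sum_divide_distrib
        by (subst sum.swap) (simp add: mult.commute)
    qed
    finally show ?thesis .
  qed
  also have "\<bar>\<dots>\<bar> \<le> (\<Sum>a\<in>A. sqrt \<eta> * avg r V (f a) + (1/2) ^ S)"
    by (rule order_trans[OF sum_abs sum_mono[OF single]])
  also have "\<dots> = sqrt \<eta> * (\<Sum>a\<in>A. avg r V (f a)) + real (card A) * (1/2) ^ S"
    by (simp add: sum.distrib sum_distrib_left)
  also have "\<dots> \<le> sqrt \<eta> * 1 + real (card A) * (1/2) ^ S"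
  proof (intro add_right_mono mult_left_mono)
    have "(\<Sum>a\<in>A. avg r V (f a)) = (\<Sum>x\<in>vecs r V. \<Sum>a\<in>A. f a x) / real (r ^ card V)"
      unfolding avg_def by (subst sum.swap) (simp add: sum_divide_distrib)
    also have "\<dots> \<le> (\<Sum>x\<in>vecs r V. 1) / real (r ^ card V)"
      by (intro divide_right_mono sum_mono f1) auto
    also have "\<dots> = 1" using r_pos finV by (simp add: card_vecs)
    finally show "(\<Sum>a\<in>A. avg r V (f a)) \<le> 1" .
  qed (use eta0 in simp)
  finally show ?thesis by (simp add: \<eta>_def)
qed

end

section \<open>The hybrid argument\<close>

lemma pmf_bind_uniform:
  assumes "finite S" "S \<noteq> {}"
  shows "pmf (bind_pmf (pmf_of_set S) f) b = (\<Sum>s\<in>S. pmf (f s) b) / real (card S)"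
  using assms by (simp add: pmf_bind integral_pmf_of_set)

lemma pmf_bind_finite_support:
  assumes "finite S" "set_pmf M \<subseteq> S"
  shows "pmf (bind_pmf M f) b = (\<Sum>a\<in>S. pmf M a * pmf (f a) b)"
  using assms by (subst pmf_bind, subst integral_measure_pmf_real[of S]) (auto simp: mult.commute)

lemma pmf_bind_diff_le:
  assumes "\<And>x. x \<in> set_pmf M \<Longrightarrow> \<bar>pmf (f x) b - pmf (g x) b\<bar> \<le> \<delta>"
  shows "\<bar>pmf (bind_pmf M f) b - pmf (bind_pmf M g) b\<bar> \<le> \<delta>"
proof -
  have int: "integrable (measure_pmf M) (\<lambda>x. pmf (h x) b)" for h :: "'a \<Rightarrow> 'b pmf"
    by (rule measure_pmf.integrable_const_bound[where B=1]) (auto simp: pmf_le_1)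
  have "\<bar>pmf (bind_pmf M f) b - pmf (bind_pmf M g) b\<bar>
      = \<bar>\<integral>x. pmf (f x) b - pmf (g x) b \<partial>measure_pmf M\<bar>"
    by (simp add: pmf_bind int Bochner_Integration.integral_diff)
  also have "\<dots> \<le> (\<integral>x. \<bar>pmf (f x) b - pmf (g x) b\<bar> \<partial>measure_pmf M)"
    by (rule integral_abs_bound)
  also have "\<dots> \<le> (\<integral>x. \<delta> \<partial>measure_pmf M)"
    using assms by (intro integral_mono_AE) (auto simp: AE_measure_pmf_iff int)
  finally show ?thesis by simp
qed

lemma foldl_bind_pmf:
  "foldl (\<lambda>M i. bind_pmf M (st i)) M \<sigma> = bind_pmf M (\<lambda>a. foldl (\<lambda>M i. bind_pmf M (st i)) (return_pmf a) \<sigma>)"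
proof (induction \<sigma> arbitrary: M)
  case (Cons i \<sigma>)
  let ?F = "\<lambda>a. foldl (\<lambda>M i. bind_pmf M (st i)) (return_pmf a) \<sigma>"
  have "foldl (\<lambda>M i. bind_pmf M (st i)) M (i # \<sigma>) = bind_pmf M (\<lambda>a. bind_pmf (st i a) ?F)"
    unfolding foldl.simps bind_assoc_pmf[symmetric] by (rule Cons)
  then show ?case by (simp add: Cons[symmetric] bind_return_pmf)
qed (simp add: bind_return_pmf')

lemma card_bounded_bitstrings:
  "finite {xs :: bool list. length xs \<le> s}" "real (card {xs :: bool list. length xs \<le> s}) \<le> 2 ^ Suc s"
proof -
  have eq: "{xs :: bool list. length xs \<le> s} = {xs. set xs \<subseteq> UNIV \<and> length xs \<le> s}" by simp
  show "finite {xs :: bool list. length xs \<le> s}"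
    unfolding eq by (rule finite_lists_length_le) simp
  have "card {xs :: bool list. length xs \<le> s} = (\<Sum>i\<le>s. 2 ^ i)"
    unfolding eq by (subst card_lists_length_le) auto
  then have "real (card {xs :: bool list. length xs \<le> s}) = (\<Sum>i<Suc s. 2 ^ i)"
    by (simp add: lessThan_Suc_atMost)
  also have "\<dots> = 2 ^ Suc s - (1 :: real)"
    by (subst sum_gp_strict) simp
  finally show "real (card {xs :: bool list. length xs \<le> s}) \<le> 2 ^ Suc s" by simp
qed

text \<open>The comparison of yes and no streams uses only that the items of a stage are computed
  from its matching and its labels, so \<open>batch\<close> stays a parameter; the hypergraph enters
  in the later sublocale.\<close>

locale staged_matching =
  fixes V :: "'a set" and \<phi> :: "nat \<Rightarrow> nat \<Rightarrow> nat \<Rightarrow> 'a" and r t N m T :: nat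
    and batch :: "nat \<Rightarrow> (nat \<Rightarrow> nat \<Rightarrow> nat) \<Rightarrow> (nat \<Rightarrow> nat) \<Rightarrow> stream_item list"
  assumes stage: "\<And>\<tau>. \<tau> < T \<Longrightarrow> block_matching V (\<phi> \<tau>) r t N m"
    and T_pos: "T > 0"
begin

definition random_matching :: "(nat \<Rightarrow> nat \<Rightarrow> nat) pmf" where
  "random_matching = pmf_of_set (block_matching.matchings t N)"

definition random_labels :: "(nat \<Rightarrow> nat) pmf" where
  "random_labels = pmf_of_set (vecs r {..<m})"

definition hidden :: "('a \<Rightarrow> nat) pmf" where
  "hidden = pmf_of_set (vecs r V)"

definition labels :: "nat \<Rightarrow> (nat \<Rightarrow> nat \<Rightarrow> nat) \<Rightarrow> ('a \<Rightarrow> nat) \<Rightarrow> nat \<Rightarrow> nat" where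
  "labels \<tau> = block_matching.label (\<phi> \<tau>) r t m"

primrec yes_stream :: "nat \<Rightarrow> ('a \<Rightarrow> nat) \<Rightarrow> stream_item list pmf" where
  "yes_stream 0 x = return_pmf []"
| "yes_stream (Suc \<tau>) x = bind_pmf (yes_stream \<tau> x) (\<lambda>\<sigma>. bind_pmf random_matching (\<lambda>M.
      return_pmf (\<sigma> @ batch \<tau> M (labels \<tau> M x))))"

primrec no_stream :: "nat \<Rightarrow> stream_item list pmf" where
  "no_stream 0 = return_pmf []"
| "no_stream (Suc \<tau>) = bind_pmf (no_stream \<tau>) (\<lambda>\<sigma>. bind_pmf random_matching (\<lambda>M.
      bind_pmf random_labels (\<lambda>w. return_pmf (\<sigma> @ batch \<tau> M w))))"

lemma r_pos: "r > 0" and finV: "finite V"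
  using stage[OF T_pos] by (auto simp: block_matching_def)

lemma finite_matchings: "finite (block_matching.matchings t N)" "block_matching.matchings t N \<noteq> {}"
proof -
  interpret block_matching V "\<phi> 0" r t N m by (rule stage[OF T_pos])
  show "finite matchings" by simp
  have "real (card matchings) > 0" by (simp add: card_matchings)
  then show "matchings \<noteq> {}" by auto
qed

lemma vecs_nonempty: "vecs r W \<noteq> {}"
proof -
  have "(\<lambda>i\<in>W. 0) \<in> vecs r W" using r_pos by auto
  then show ?thesis by blast
qed

context
  fixes A :: streaming_alg and \<omega> :: nat and Acc :: "real set"
begin

definition process :: "stream_item list \<Rightarrow> bool list \<Rightarrow> bool list pmf" where
  "process \<sigma> a = foldl (\<lambda>M i. bind_pmf M (step A \<omega> i)) (return_pmf a) \<sigma>"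

definition yes_state :: "nat \<Rightarrow> ('a \<Rightarrow> nat) \<Rightarrow> bool list pmf" where
  "yes_state \<tau> x = bind_pmf (yes_stream \<tau> x) (memory_after A \<omega>)"

definition accepts :: "bool list \<Rightarrow> bool pmf" where
  "accepts a = map_pmf (\<lambda>y. y \<in> Acc) (answer A \<omega> a)"

text \<open>The run from content a through d uniform stages, the first being stage \<tau>. It does
  not mention the hidden assignment, which is what lets \<open>G\<close> in
  \<open>stage_distinguishing_le\<close> be independent of x.\<close>

primrec no_future :: "nat \<Rightarrow> nat \<Rightarrow> bool list \<Rightarrow> bool pmf" where
  "no_future 0 \<tau> a = accepts a"
| "no_future (Suc d) \<tau> a = bind_pmf random_matching (\<lambda>M. bind_pmf random_labels (\<lambda>w.
      bind_pmf (process (batch \<tau> M w) a) (no_future d (Suc \<tau>))))"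

lemma memory_after_append:
  "memory_after A \<omega> (\<sigma> @ \<sigma>') = bind_pmf (memory_after A \<omega> \<sigma>) (process \<sigma>')"
  unfolding memory_after_def process_def foldl_append by (rule foldl_bind_pmf)

lemma yes_state_Suc:
  "yes_state (Suc \<tau>) x = bind_pmf (yes_state \<tau> x) (\<lambda>a. bind_pmf random_matching (\<lambda>M.
      process (batch \<tau> M (labels \<tau> M x)) a))"
  unfolding yes_state_def yes_stream.simps bind_assoc_pmf bind_return_pmf memory_after_append
  by (subst bind_commute_pmf) (rule refl)

text \<open>The matching and labels of a stage are drawn independently of the earlier memory, so
  these draws commute and the uniform stages can be absorbed one by one.\<close>

lemma no_stream_future:
  "bind_pmf (bind_pmf (no_stream \<tau>) (memory_after A \<omega>)) (no_future d \<tau>)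
    = bind_pmf (bind_pmf (no_stream (\<tau> + d)) (memory_after A \<omega>)) accepts"
proof (induction d arbitrary: \<tau>)
  case 0
  then show ?case by (simp add: no_future.simps(1)[abs_def])
next
  case (Suc d)
  have "bind_pmf (bind_pmf (no_stream \<tau>) (memory_after A \<omega>)) (no_future (Suc d) \<tau>)
      = bind_pmf (no_stream \<tau>) (\<lambda>\<sigma>. bind_pmf random_matching (\<lambda>M. bind_pmf random_labels (\<lambda>w.
          bind_pmf (memory_after A \<omega> \<sigma>) (\<lambda>a. bind_pmf (process (batch \<tau> M w) a) (no_future d (Suc \<tau>))))))"
    unfolding no_future.simps bind_assoc_pmf
    by (subst bind_commute_pmf, subst bind_commute_pmf[of "memory_after _ _ _" random_labels]) (rule refl)
  also have "\<dots> = bind_pmf (bind_pmf (no_stream (Suc \<tau>)) (memory_after A \<omega>)) (no_future d (Suc \<tau>))"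
    by (simp add: bind_assoc_pmf bind_return_pmf memory_after_append)
  also have "\<dots> = bind_pmf (bind_pmf (no_stream (Suc \<tau> + d)) (memory_after A \<omega>)) accepts"
    by (rule Suc)
  finally show ?case by (simp only: add_Suc add_Suc_right)
qed

text \<open>Stages before \<tau> are consistent with the hidden assignment and the later ones
  uniform, so the index runs from the pure no run at 0 to the pure yes run at
  \<open>T\<close>.\<close>

definition hybrid :: "nat \<Rightarrow> bool pmf" where
  "hybrid \<tau> = bind_pmf hidden (\<lambda>x. bind_pmf (yes_state \<tau> x) (no_future (T - \<tau>) \<tau>))"

text \<open>The two hybrids differ only in the labels of stage \<tau>: those of the hidden
  assignment against uniform ones. Conditioning on the memory content before the stage brings both
  into the form of \<open>stage_distinguishing_le\<close>, with fewer than 2^(s+1) contents.\<close>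

lemma hybrid_step:
  assumes t: "t \<ge> 2" and sparse: "(64 * r)\<^sup>2 * m \<le> N"
    and \<kappa>: "0 \<le> \<kappa>" "\<kappa> \<le> 1/2"
    and S: "(64 * real r * real S) ^ t \<le> (\<kappa> * real t) ^ t * real N ^ (t - 1)"
    and space: "\<And>\<tau> x \<sigma> a. \<tau> < T \<Longrightarrow> x \<in> vecs r V \<Longrightarrow> \<sigma> \<in> set_pmf (yes_stream \<tau> x) \<Longrightarrow>
      a \<in> set_pmf (memory_after A \<omega> \<sigma>) \<Longrightarrow> length a \<le> s"
    and \<tau>: "\<tau> < T"
  shows "\<bar>pmf (hybrid (Suc \<tau>)) True - pmf (hybrid \<tau>) True\<bar>
    \<le> sqrt (2 * \<kappa> ^ t + (1/2) ^ (S div 2)) + 2 ^ Suc s * (1/2) ^ S"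
proof -
  interpret block_matching V "\<phi> \<tau>" r t N m by (rule stage[OF \<tau>])
  define B where "B = {a :: bool list. length a \<le> s}"
  define d where "d = T - Suc \<tau>"
  define G where "G a M w = pmf (bind_pmf (process (batch \<tau> M w) a) (no_future d (Suc \<tau>))) True" for a M w
  have d: "T - \<tau> = Suc d" using \<tau> by (simp add: d_def)
  have B: "finite B" "real (card B) \<le> 2 ^ Suc s"
    using card_bounded_bitstrings[of s] by (auto simp: B_def)
  have supp: "set_pmf (yes_state \<tau> x) \<subseteq> B" if "x \<in> vecs r V" for x
    using space[OF \<tau> that] by (auto simp: yes_state_def B_def)
  have avg_pmf: "pmf (bind_pmf hidden f) True = avg r V (\<lambda>x. pmf (f x) True)" for f :: "_ \<Rightarrow> bool pmf"
    unfolding hidden_def using vecs_nonempty finV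
    by (subst pmf_bind_uniform) (auto simp: avg_def card_vecs)
  have match_pmf: "pmf (bind_pmf random_matching f) True = matching_avg (\<lambda>M. pmf (f M) True)" for f :: "_ \<Rightarrow> bool pmf"
    unfolding random_matching_def matching_avg_def
    by (rule pmf_bind_uniform) (rule staged_matching.finite_matchings[OF staged_matching_axioms])+
  have label_pmf: "pmf (bind_pmf random_labels f) True = avg r {..<m} (\<lambda>w. pmf (f w) True)" for f :: "_ \<Rightarrow> bool pmf"
    unfolding random_labels_def using vecs_nonempty
    by (subst pmf_bind_uniform) (auto simp: avg_def card_vecs)
  have avg_cong: "avg r V f = avg r V g" if "\<And>x. x \<in> vecs r V \<Longrightarrow> f x = g x" for f g
    using that unfolding avg_def by (metis (no_types, lifting) sum.cong)
  have "pmf (hybrid (Suc \<tau>)) True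
      = avg r V (\<lambda>x. \<Sum>a\<in>B. pmf (yes_state \<tau> x) a * matching_avg (\<lambda>M. G a M (label M x)))"
    unfolding hybrid_def avg_pmf yes_state_Suc bind_assoc_pmf d_def[symmetric]
    by (intro avg_cong) (simp add: pmf_bind_finite_support[OF B(1) supp] match_pmf G_def labels_def)
  moreover have "pmf (hybrid \<tau>) True
      = avg r V (\<lambda>x. \<Sum>a\<in>B. pmf (yes_state \<tau> x) a * matching_avg (\<lambda>M. avg r {..<m} (G a M)))"
    unfolding hybrid_def avg_pmf d
    by (intro avg_cong) (simp add: pmf_bind_finite_support[OF B(1) supp] match_pmf label_pmf G_def[abs_def])
  moreover have "(\<Sum>a\<in>B. pmf (yes_state \<tau> x) a) \<le> 1" for x
    using B(1) by (simp add: measure_measure_pmf_finite[symmetric])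
  ultimately have "\<bar>pmf (hybrid (Suc \<tau>)) True - pmf (hybrid \<tau>) True\<bar>
      \<le> sqrt (2 * \<kappa> ^ t + (1/2) ^ (S div 2)) + real (card B) * (1/2) ^ S"
    using stage_distinguishing_le[OF t sparse \<kappa> S B(1), of "\<lambda>a x. pmf (yes_state \<tau> x) a" G]
    by (simp add: G_def pmf_le_1)
  also have "\<dots> \<le> sqrt (2 * \<kappa> ^ t + (1/2) ^ (S div 2)) + 2 ^ Suc s * (1/2) ^ S"
    using B(2) by (intro add_left_mono mult_right_mono) auto
  finally show ?thesis .
qed

lemma yes_no_state_distance:
  assumes t: "t \<ge> 2" and sparse: "(64 * r)\<^sup>2 * m \<le> N"
    and \<kappa>: "0 \<le> \<kappa>" "\<kappa> \<le> 1/2"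
    and S: "(64 * real r * real S) ^ t \<le> (\<kappa> * real t) ^ t * real N ^ (t - 1)"
    and space: "\<And>\<tau> x \<sigma> a. \<tau> < T \<Longrightarrow> x \<in> vecs r V \<Longrightarrow> \<sigma> \<in> set_pmf (yes_stream \<tau> x) \<Longrightarrow>
      a \<in> set_pmf (memory_after A \<omega> \<sigma>) \<Longrightarrow> length a \<le> s"
  shows "\<bar>pmf (bind_pmf hidden (\<lambda>x. bind_pmf (bind_pmf (yes_stream T x) (memory_after A \<omega>)) accepts)) True
      - pmf (bind_pmf (bind_pmf (no_stream T) (memory_after A \<omega>)) accepts) True\<bar>
    \<le> real T * (sqrt (2 * \<kappa> ^ t + (1/2) ^ (S div 2)) + 2 ^ Suc s * (1/2) ^ S)"
proof -
  define \<delta> where "\<delta> = sqrt (2 * \<kappa> ^ t + (1/2) ^ (S div 2)) + 2 ^ Suc s * (1/2) ^ S"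
  have "\<bar>pmf (hybrid \<tau>) True - pmf (hybrid 0) True\<bar> \<le> real \<tau> * \<delta>" if "\<tau> \<le> T" for \<tau>
    using that
  proof (induction \<tau>)
    case (Suc \<tau>)
    then have "\<bar>pmf (hybrid \<tau>) True - pmf (hybrid 0) True\<bar> \<le> real \<tau> * \<delta>" by simp
    moreover have "\<bar>pmf (hybrid (Suc \<tau>)) True - pmf (hybrid \<tau>) True\<bar> \<le> \<delta>"
      unfolding \<delta>_def using Suc.prems by (intro hybrid_step[OF t sparse \<kappa> S space]) simp_all
    ultimately show ?case by (simp add: algebra_simps abs_le_iff)
  qed simp
  from this[of T] have "\<bar>pmf (hybrid T) True - pmf (hybrid 0) True\<bar> \<le> real T * \<delta>" by simp
  moreover have "hybrid T = bind_pmf hidden (\<lambda>x. bind_pmf (bind_pmf (yes_stream T x) (memory_after A \<omega>)) accepts)"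
    by (simp add: hybrid_def yes_state_def no_future.simps(1)[abs_def])
  moreover have "hybrid 0 = bind_pmf (bind_pmf (no_stream T) (memory_after A \<omega>)) accepts"
    using no_stream_future[of 0 T] by (simp add: hybrid_def yes_state_def)
  ultimately show ?thesis by (simp add: \<delta>_def)
qed

end

text \<open>The stream is drawn independently of the random tape, so the tape can be drawn first;
  the bound holds for each fixed tape and survives averaging.\<close>

lemma yes_no_output_distance:
  assumes t: "t \<ge> 2" and sparse: "(64 * r)\<^sup>2 * m \<le> N"
    and \<kappa>: "0 \<le> \<kappa>" "\<kappa> \<le> 1/2"
    and S: "(64 * real r * real S) ^ t \<le> (\<kappa> * real t) ^ t * real N ^ (t - 1)"
    and space: "\<And>\<tau> x \<sigma> \<omega> a. \<tau> < T \<Longrightarrow> x \<in> vecs r V \<Longrightarrow> \<sigma> \<in> set_pmf (yes_stream \<tau> x) \<Longrightarrow>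
      \<omega> \<in> set_pmf (tape A) \<Longrightarrow> a \<in> set_pmf (memory_after A \<omega> \<sigma>) \<Longrightarrow> length a \<le> s"
  shows "\<bar>pmf (bind_pmf hidden (\<lambda>x. bind_pmf (yes_stream T x) (\<lambda>\<sigma>. map_pmf (\<lambda>y. y \<in> Acc) (output_dist A \<sigma>)))) True
      - pmf (bind_pmf (no_stream T) (\<lambda>\<sigma>. map_pmf (\<lambda>y. y \<in> Acc) (output_dist A \<sigma>))) True\<bar>
    \<le> real T * (sqrt (2 * \<kappa> ^ t + (1/2) ^ (S div 2)) + 2 ^ Suc s * (1/2) ^ S)"
proof -
  have yes: "bind_pmf hidden (\<lambda>x. bind_pmf (yes_stream T x) (\<lambda>\<sigma>. map_pmf (\<lambda>y. y \<in> Acc) (output_dist A \<sigma>)))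
      = bind_pmf (tape A) (\<lambda>\<omega>. bind_pmf hidden (\<lambda>x. bind_pmf (bind_pmf (yes_stream T x) (memory_after A \<omega>)) (accepts A \<omega> Acc)))"
    unfolding output_dist_def map_bind_pmf accepts_def[abs_def] bind_assoc_pmf
    by (subst bind_commute_pmf[of _ "tape A"], subst bind_commute_pmf[of _ "tape A"]) (rule refl)
  have no: "bind_pmf (no_stream T) (\<lambda>\<sigma>. map_pmf (\<lambda>y. y \<in> Acc) (output_dist A \<sigma>))
      = bind_pmf (tape A) (\<lambda>\<omega>. bind_pmf (bind_pmf (no_stream T) (memory_after A \<omega>)) (accepts A \<omega> Acc))"
    unfolding output_dist_def map_bind_pmf accepts_def[abs_def] bind_assoc_pmf
    by (subst bind_commute_pmf[of _ "tape A"]) (rule refl)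
  show ?thesis
    unfolding yes no
    by (intro pmf_bind_diff_le yes_no_state_distance[OF t sparse \<kappa> S]) (rule space)
qed

end

section \<open>Unique Games streams\<close>

text \<open>Such a stream determines its own instance, \<open>edges_of\<close> with
  \<open>constr_of\<close>. Distinctness is required because an instance has one constraint per
  hyperedge and presents it once.\<close>

definition stream_instance :: "nat \<Rightarrow> nat \<Rightarrow> nat \<Rightarrow> stream_item list \<Rightarrow> bool" where
  "stream_instance r t n \<sigma> \<longleftrightarrow> distinct (map fst \<sigma>) \<and>
     (\<forall>(e, c)\<in>set \<sigma>. e \<subseteq> {..<n} \<and> card e \<le> t \<and> linear_constr r e c)"

definition edges_of :: "stream_item list \<Rightarrow> nat set set" where
  "edges_of \<sigma> = set (map fst \<sigma>)"

definition constr_of :: "stream_item list \<Rightarrow> nat set \<Rightarrow> constr" where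
  "constr_of \<sigma> e = the (map_of \<sigma> e)"

definition satisfied :: "stream_item list \<Rightarrow> (nat \<Rightarrow> int) \<Rightarrow> nat" where
  "satisfied \<sigma> y = (\<Sum>(e, c)\<leftarrow>\<sigma>. of_bool (c y))"

lemma constr_of_item:
  assumes "distinct (map fst \<sigma>)" "(e, c) \<in> set \<sigma>"
  shows "constr_of \<sigma> e = c"
  using assms by (simp add: constr_of_def)

lemma unique_games_stream:
  assumes "stream_instance r t n \<sigma>"
  shows "unique_games r t n (edges_of \<sigma>) (constr_of \<sigma>)"
  unfolding unique_games_def edges_of_def
proof
  fix e assume "e \<in> set (map fst \<sigma>)"
  then obtain c where "(e, c) \<in> set \<sigma>" by auto
  then show "e \<subseteq> {..<n} \<and> card e \<le> t \<and> linear_constr r e (constr_of \<sigma> e)"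
    using assms constr_of_item[of \<sigma> e c] by (auto simp: stream_instance_def)
qed

lemma stream_in_ug_streams:
  assumes "stream_instance r t n \<sigma>"
  shows "\<sigma> \<in> ug_streams (edges_of \<sigma>) (constr_of \<sigma>)"
proof -
  have "map (\<lambda>e. (e, constr_of \<sigma> e)) (map fst \<sigma>) = \<sigma>"
    using assms constr_of_item by (auto simp: stream_instance_def intro!: map_idI)
  then show ?thesis
    using assms unfolding ug_streams_def edges_of_def stream_instance_def
    by (intro CollectI exI[of _ "map fst \<sigma>"]) auto
qed

lemma ug_value_stream:
  assumes "stream_instance r t n \<sigma>"
  shows "ug_value (edges_of \<sigma>) (constr_of \<sigma>) y = satisfied \<sigma> y"
proof -
  have "ug_value (edges_of \<sigma>) (constr_of \<sigma>) y = (\<Sum>e\<leftarrow>map fst \<sigma>. of_bool (constr_of \<sigma> e y))"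
    using assms unfolding ug_value_def edges_of_def stream_instance_def
    by (intro sum.distinct_set_conv_list) simp
  also have "\<dots> = satisfied \<sigma> y"
    using assms constr_of_item unfolding satisfied_def stream_instance_def
    by (auto simp: comp_def intro!: arg_cong[where f=sum_list] map_cong)
  finally show ?thesis .
qed

definition assignments :: "nat \<Rightarrow> nat \<Rightarrow> (nat \<Rightarrow> int) set" where
  "assignments r n = {..<n} \<rightarrow>\<^sub>E {0..<int r}"

lemma finite_assignments: "finite (assignments r n)"
  by (simp add: assignments_def finite_PiE)

lemma satisfied_le_length: "satisfied \<sigma> y \<le> length \<sigma>"
  unfolding satisfied_def by (induction \<sigma>) auto

lemma ug_opt_stream_le:
  assumes \<sigma>: "stream_instance r t n \<sigma>" and "r > 0"
    and "\<And>y. y \<in> assignments r n \<Longrightarrow> real (satisfied \<sigma> y) \<le> b"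
  shows "real (ug_opt r n (edges_of \<sigma>) (constr_of \<sigma>)) \<le> b"
proof -
  have "(\<lambda>i\<in>{..<n}. 0) \<in> assignments r n" using assms(2) by (auto simp: assignments_def)
  then have "ug_opt r n (edges_of \<sigma>) (constr_of \<sigma>) \<in> satisfied \<sigma> ` assignments r n"
    unfolding ug_opt_def ug_value_stream[OF \<sigma>, abs_def] assignments_def[symmetric]
    using finite_assignments by (intro Max_in) auto
  then show ?thesis using assms(3) by auto
qed

lemma ug_opt_stream_satisfiable:
  assumes \<sigma>: "stream_instance r t n \<sigma>" and y: "y \<in> assignments r n"
    and sat: "\<And>e c. (e, c) \<in> set \<sigma> \<Longrightarrow> c y"
  shows "ug_opt r n (edges_of \<sigma>) (constr_of \<sigma>) = length \<sigma>"
proof -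
  have "satisfied \<rho> y = length \<rho>" if "\<forall>(e, c)\<in>set \<rho>. c y" for \<rho>
    using that unfolding satisfied_def by (induction \<rho>) auto
  then have "satisfied \<sigma> y = length \<sigma>" using sat by blast
  moreover have "ug_opt r n (edges_of \<sigma>) (constr_of \<sigma>) = Max (satisfied \<sigma> ` assignments r n)"
    unfolding ug_opt_def ug_value_stream[OF \<sigma>, abs_def] assignments_def[symmetric] ..
  moreover have "Max (satisfied \<sigma> ` assignments r n) = satisfied \<sigma> y"
  proof (rule Max_eqI)
    show "k \<le> satisfied \<sigma> y" if "k \<in> satisfied \<sigma> ` assignments r n" for k
      using that satisfied_le_length[of \<sigma>] calculation(1) by auto
    show "satisfied \<sigma> y \<in> satisfied \<sigma> ` assignments r n" using y by (rule imageI)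
  qed (simp add: finite_assignments)
  ultimately show ?thesis by simp
qed

text \<open>The distinguisher accepts when the output is at least \<theta>. A correct output passes
  if OPT / \<gamma> >= \<theta>, and fails if OPT < \<theta>, which is the next lemma.\<close>

lemma ug_approx_accepts:
  assumes A: "ug_approx r t n \<gamma> p A" and \<sigma>: "stream_instance r t n \<sigma>"
    and opt: "\<theta> \<le> real (ug_opt r n (edges_of \<sigma>) (constr_of \<sigma>)) / \<gamma>"
  shows "p \<le> pmf (map_pmf (\<lambda>y. y \<in> {\<theta>..}) (output_dist A \<sigma>)) True"
proof -
  let ?opt = "real (ug_opt r n (edges_of \<sigma>) (constr_of \<sigma>))"
  have "p \<le> measure_pmf.prob (output_dist A \<sigma>) {?opt / \<gamma> .. ?opt}"
    using A unique_games_stream[OF \<sigma>] stream_in_ug_streams[OF \<sigma>] unfolding ug_approx_def by blast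
  also have "\<dots> \<le> measure_pmf.prob (output_dist A \<sigma>) {\<theta>..}"
    using opt by (intro measure_pmf.finite_measure_mono) auto
  finally show ?thesis by (simp add: pmf_map vimage_def atLeast_def)
qed

lemma ug_approx_rejects:
  assumes A: "ug_approx r t n \<gamma> p A" and \<sigma>: "stream_instance r t n \<sigma>"
    and opt: "real (ug_opt r n (edges_of \<sigma>) (constr_of \<sigma>)) < \<theta>"
  shows "pmf (map_pmf (\<lambda>y. y \<in> {\<theta>..}) (output_dist A \<sigma>)) True \<le> 1 - p"
proof -
  let ?opt = "real (ug_opt r n (edges_of \<sigma>) (constr_of \<sigma>))"
  have "p \<le> measure_pmf.prob (output_dist A \<sigma>) {?opt / \<gamma> .. ?opt}"
    using A unique_games_stream[OF \<sigma>] stream_in_ug_streams[OF \<sigma>] unfolding ug_approx_def by blast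
  also have "\<dots> \<le> measure_pmf.prob (output_dist A \<sigma>) (UNIV - {\<theta>..})"
    using opt by (intro measure_pmf.finite_measure_mono) auto
  also have "\<dots> = 1 - measure_pmf.prob (output_dist A \<sigma>) {\<theta>..}"
    by (subst measure_pmf.finite_measure_Diff) auto
  finally show ?thesis by (simp add: pmf_map vimage_def atLeast_def)
qed

section \<open>The hard instances\<close>

locale ug_construction =
  fixes r t n B N m :: nat
  assumes r2: "r \<ge> 2" and t2: "t \<ge> 2" and B_pos: "B > 0" and m_le: "m \<le> N"
    and room: "(2 * B + t - 2) * N \<le> n"
begin

text \<open>
  The first two parts have \<open>B\<close> blocks each, and stage \<open>\<tau> < B\<^sup>2\<close> uses the block pair
  \<open>(\<tau> div B, \<tau> mod B)\<close>, so that hyperedges of different stages are automatically distinct;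
  the remaining parts have one block each, shared by all stages.
\<close>

definition block :: "nat \<Rightarrow> nat \<Rightarrow> nat" where
  "block \<tau> j = (if j = 0 then \<tau> div B else if j = 1 then B + \<tau> mod B else 2 * B + j - 2)"

definition vertex :: "nat \<Rightarrow> nat \<Rightarrow> nat \<Rightarrow> nat" where
  "vertex \<tau> j i = block \<tau> j * N + i"

definition edge :: "nat \<Rightarrow> (nat \<Rightarrow> nat \<Rightarrow> nat) \<Rightarrow> nat \<Rightarrow> nat set" where
  "edge \<tau> M i = (\<lambda>j. vertex \<tau> j (M j i)) ` {..<t}"

definition sum_constr :: "nat set \<Rightarrow> nat \<Rightarrow> constr" where
  "sum_constr e q = (\<lambda>x. [(\<Sum>i\<in>e. 1 * x i) = int q] (mod int r))"

definition batch :: "nat \<Rightarrow> (nat \<Rightarrow> nat \<Rightarrow> nat) \<Rightarrow> (nat \<Rightarrow> nat) \<Rightarrow> stream_item list" where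
  "batch \<tau> M w = map (\<lambda>i. (edge \<tau> M i, sum_constr (edge \<tau> M i) (w i))) [0..<m]"

lemma block_less:
  assumes "\<tau> < B * B" "j < t"
  shows "block \<tau> j < 2 * B + t - 2"
proof -
  have "(if j = 0 then a else if j = 1 then B + b else 2 * B + j - 2) < 2 * B + t - 2"
    if "a < B" "b < B" for a b
    using that assms(2) t2 by auto
  from this[OF less_mult_imp_div_less[OF assms(1)] mod_less_divisor[OF B_pos]]
  show ?thesis unfolding block_def .
qed

lemma block_inj:
  assumes "\<tau> < B * B" "block \<tau> j = block \<tau> j'"
  shows "j = j'"
proof -
  have "j = j'" if "a < B" "b < B"
    "(if j = 0 then a else if j = 1 then B + b else 2 * B + j - 2)
      = (if j' = 0 then a else if j' = 1 then B + b else 2 * B + j' - 2)" for a b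
    using that by (auto split: if_splits)
  from this[OF less_mult_imp_div_less[OF assms(1)] mod_less_divisor[OF B_pos] assms(2)[unfolded block_def]]
  show ?thesis .
qed

text \<open>Block numbers below B come only from part 0 and those from B to 2 B - 1 only from part
  1, so the set of blocks reveals both base-B digits of \<tau>.\<close>

lemma block_image_inj:
  assumes "\<tau> < B * B" "\<tau>' < B * B" "block \<tau> ` {..<t} = block \<tau>' ` {..<t}"
  shows "\<tau> = \<tau>'"
proof -

  have "block \<tau> 0 \<in> block \<tau>' ` {..<t}" "block \<tau> 1 \<in> block \<tau>' ` {..<t}"
    using assms(3) t2 by auto
  then obtain j0 j1 where j: "block \<tau> 0 = block \<tau>' j0" "block \<tau> 1 = block \<tau>' j1" by auto
  have small: "\<tau> div B < B" "\<tau>' div B < B" "\<tau> mod B < B" "\<tau>' mod B < B"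
    by (rule less_mult_imp_div_less[OF assms(1)] less_mult_imp_div_less[OF assms(2)] mod_less_divisor[OF B_pos])+
  have 1: "a = a'" if "a < B" "a = (if j = 0 then a' else if j = 1 then B + b' else 2 * B + j - 2)" for a a' b' j
    using that by (auto split: if_splits)
  have 2: "b = b'" if "a' < B" "b < B" "B + b = (if j = 0 then a' else if j = 1 then B + b' else 2 * B + j - 2)" for a' b b' j
    using that by (auto split: if_splits)
  have "\<tau> div B = \<tau>' div B"
    by (rule 1[OF small(1)]) (use j(1) in \<open>simp only: block_def refl if_True\<close>)
  moreover have "\<tau> mod B = \<tau>' mod B"
    by (rule 2[OF small(2,3)]) (use j(2) in \<open>simp only: block_def one_neq_zero refl if_True if_False\<close>)
  ultimately show ?thesis by (metis div_mult_mod_eq)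
qed

lemma vertex_div: "i < N \<Longrightarrow> vertex \<tau> j i div N = block \<tau> j"
  by (simp add: vertex_def)

lemma stage_matching:
  assumes "\<tau> < B * B"
  shows "block_matching {..<n} (vertex \<tau>) r t N m"
proof
  fix j i assume ji: "j < t" "i < N"
  have "vertex \<tau> j i < Suc (block \<tau> j) * N" using ji by (simp add: vertex_def)
  also have "\<dots> \<le> (2 * B + t - 2) * N"
    using block_less[OF assms ji(1)] by (intro mult_le_mono1) simp
  finally show "vertex \<tau> j i \<in> {..<n}" using room by simp
next
  fix j i j' i' assume *: "i < N" "i' < N" "vertex \<tau> j i = vertex \<tau> j' i'"
  then have "block \<tau> j = block \<tau> j'" using vertex_div by metis
  then show "j = j' \<and> i = i'" using block_inj[OF assms] * by (simp add: vertex_def)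
qed (use m_le r2 t2 in auto)

sublocale staged_matching "{..<n}" vertex r t N m "B * B" batch
  by (rule staged_matching.intro) (use stage_matching B_pos in auto)

abbreviation "all_matchings \<equiv> block_matching.matchings t N"

text \<open>A hyperedge meets exactly the blocks of its stage, whatever the matching; with
  \<open>block_image_inj\<close> this tells hyperedges of different stages apart.\<close>

lemma edge_blocks:
  assumes "\<tau> < B * B" "M \<in> all_matchings" "i < m"
  shows "(\<lambda>v. v div N) ` edge \<tau> M i = block \<tau> ` {..<t}"
proof -
  interpret block_matching "{..<n}" "vertex \<tau>" r t N m by (rule stage_matching[OF assms(1)])
  show ?thesis
    using matching_less[OF assms(2) _ assms(3)] by (force simp: edge_def image_image vertex_div)
qed

lemma edge_inj:
  assumes \<tau>: "\<tau> < B * B" and M: "M \<in> all_matchings" and ii': "i < m" "i' < m" and eq: "edge \<tau> M i = edge \<tau> M i'"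
  shows "i = i'"
proof -
  interpret block_matching "{..<n}" "vertex \<tau>" r t N m by (rule stage_matching[OF \<tau>])
  have "vertex \<tau> 0 (M 0 i) \<in> edge \<tau> M i'"
  proof -
    have "vertex \<tau> 0 (M 0 i) \<in> edge \<tau> M i" using t_pos by (auto simp: edge_def)
    then show ?thesis by (simp only: eq)
  qed
  then obtain j where j: "j < t" "vertex \<tau> 0 (M 0 i) = vertex \<tau> j (M j i')" by (auto simp: edge_def)
  then have "0 = j \<and> M 0 i = M j i'"
    using matching_less[OF M] ii' t_pos by (intro \<phi>_inj) auto
  then show ?thesis using matching_inj[OF M t_pos] by simp
qed

lemma edge_sum:
  assumes "\<tau> < B * B" "M \<in> all_matchings" "i < m"
  shows "(\<Sum>v\<in>edge \<tau> M i. g v) = (\<Sum>j<t. g (vertex \<tau> j (M j i)))"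
    and "edge \<tau> M i \<subseteq> {..<n}" and "card (edge \<tau> M i) \<le> t"
proof -
  interpret block_matching "{..<n}" "vertex \<tau>" r t N m by (rule stage_matching[OF assms(1)])
  have "inj_on (\<lambda>j. vertex \<tau> j (M j i)) {..<t}"
    using \<phi>_inj matching_less[OF assms(2) _ assms(3)] by (intro inj_onI) blast
  then show "(\<Sum>v\<in>edge \<tau> M i. g v) = (\<Sum>j<t. g (vertex \<tau> j (M j i)))"
    by (simp add: edge_def sum.reindex)
  show "edge \<tau> M i \<subseteq> {..<n}"
    using \<phi>_in matching_less[OF assms(2) _ assms(3)] by (force simp: edge_def)
  show "card (edge \<tau> M i) \<le> t"
    unfolding edge_def by (metis card_image_le card_lessThan finite_lessThan)
qed

definition stream :: "nat \<Rightarrow> (nat \<Rightarrow> nat \<Rightarrow> nat \<Rightarrow> nat) \<Rightarrow> (nat \<Rightarrow> nat \<Rightarrow> nat) \<Rightarrow> stream_item list" where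
  "stream \<tau> Ms ws = concat (map (\<lambda>k. batch k (Ms k) (ws k)) [0..<\<tau>])"

lemma length_stream: "length (stream \<tau> Ms ws) = \<tau> * m"
  by (simp add: stream_def batch_def length_concat comp_def sum_list_triv)

lemma stream_cong:
  assumes "\<And>k. k < \<tau> \<Longrightarrow> Ms k = Ms' k \<and> ws k = ws' k"
  shows "stream \<tau> Ms ws = stream \<tau> Ms' ws'"
  using assms by (auto simp: stream_def intro!: arg_cong[where f=concat] map_cong)

lemma no_stream_support:
  assumes "\<sigma> \<in> set_pmf (no_stream \<tau>)"
  shows "\<exists>Ms ws. (\<forall>k<\<tau>. Ms k \<in> all_matchings) \<and> \<sigma> = stream \<tau> Ms ws"
  using assms
proof (induction \<tau> arbitrary: \<sigma>)
  case 0
  then show ?case by (simp add: stream_def)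
next
  case (Suc \<tau>)
  then obtain \<sigma>' M w where 1: "\<sigma>' \<in> set_pmf (no_stream \<tau>)" "M \<in> all_matchings" "\<sigma> = \<sigma>' @ batch \<tau> M w"
    using finite_matchings by (auto simp: random_matching_def)
  from Suc.IH[OF this(1)] obtain Ms ws where 2: "\<forall>k<\<tau>. Ms k \<in> all_matchings" "\<sigma>' = stream \<tau> Ms ws" by blast
  have "stream \<tau> (Ms(\<tau> := M)) (ws(\<tau> := w)) = stream \<tau> Ms ws"
    by (rule stream_cong) simp
  then have "\<sigma> = stream (Suc \<tau>) (Ms(\<tau> := M)) (ws(\<tau> := w))"
    using 1 2 by (simp add: stream_def)
  moreover have "\<forall>k<Suc \<tau>. (Ms(\<tau> := M)) k \<in> all_matchings" using 1 2 by (auto simp: less_Suc_eq)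
  ultimately show ?case by blast
qed

lemma yes_stream_support:
  assumes "\<sigma> \<in> set_pmf (yes_stream \<tau> x)"
  shows "\<exists>Ms. (\<forall>k<\<tau>. Ms k \<in> all_matchings) \<and> \<sigma> = stream \<tau> Ms (\<lambda>k. labels k (Ms k) x)"
  using assms
proof (induction \<tau> arbitrary: \<sigma>)
  case 0
  then show ?case by (simp add: stream_def)
next
  case (Suc \<tau>)
  then obtain \<sigma>' M where 1: "\<sigma>' \<in> set_pmf (yes_stream \<tau> x)" "M \<in> all_matchings" "\<sigma> = \<sigma>' @ batch \<tau> M (labels \<tau> M x)"
    using finite_matchings by (auto simp: random_matching_def)
  from Suc.IH[OF this(1)] obtain Ms where 2: "\<forall>k<\<tau>. Ms k \<in> all_matchings" "\<sigma>' = stream \<tau> Ms (\<lambda>k. labels k (Ms k) x)" by blast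
  have "stream \<tau> (Ms(\<tau> := M)) (\<lambda>k. labels k ((Ms(\<tau> := M)) k) x) = stream \<tau> Ms (\<lambda>k. labels k (Ms k) x)"
    by (rule stream_cong) simp
  then have "\<sigma> = stream (Suc \<tau>) (Ms(\<tau> := M)) (\<lambda>k. labels k ((Ms(\<tau> := M)) k) x)"
    using 1 2 by (simp add: stream_def)
  moreover have "\<forall>k<Suc \<tau>. (Ms(\<tau> := M)) k \<in> all_matchings" using 1 2 by (auto simp: less_Suc_eq)
  ultimately show ?case by blast
qed

lemma stream_instance_stream:
  assumes "\<tau> \<le> B * B" "\<And>k. k < \<tau> \<Longrightarrow> Ms k \<in> all_matchings"
  shows "stream_instance r t n (stream \<tau> Ms ws)"
  unfolding stream_instance_def
proof
  show "distinct (map fst (stream \<tau> Ms ws))"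
    using assms
  proof (induction \<tau>)
    case 0
    then show ?case by (simp add: stream_def)
  next
    case (Suc \<tau>)
    have items: "map fst (batch k M w) = map (edge k M) [0..<m]" for k M w
      by (simp add: batch_def comp_def)
    have split: "map fst (stream (Suc \<tau>) Ms ws) = map fst (stream \<tau> Ms ws) @ map (edge \<tau> (Ms \<tau>)) [0..<m]"
      by (simp add: stream_def items)
    have "distinct (map (edge \<tau> (Ms \<tau>)) [0..<m])"
      unfolding distinct_map
    proof (intro conjI distinct_upt inj_onI)
      fix i i' assume "i \<in> set [0..<m]" "i' \<in> set [0..<m]" "edge \<tau> (Ms \<tau>) i = edge \<tau> (Ms \<tau>) i'"
      then show "i = i'" using Suc.prems by (intro edge_inj[of \<tau> "Ms \<tau>"]) auto
    qed
    moreover have "edge \<tau> (Ms \<tau>) i \<notin> set (map fst (stream \<tau> Ms ws))" if i: "i < m" for i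
    proof
      assume "edge \<tau> (Ms \<tau>) i \<in> set (map fst (stream \<tau> Ms ws))"
      then obtain k i' where k: "k < \<tau>" "i' < m" "edge \<tau> (Ms \<tau>) i = edge k (Ms k) i'"
        by (auto simp: stream_def batch_def)
      then have "block \<tau> ` {..<t} = block k ` {..<t}"
        using edge_blocks[of \<tau> "Ms \<tau>" i] edge_blocks[of k "Ms k" i'] Suc.prems i by auto
      then show False using block_image_inj[of \<tau> k] Suc.prems k by auto
    qed
    then have "set (map fst (stream \<tau> Ms ws)) \<inter> set (map (edge \<tau> (Ms \<tau>)) [0..<m]) = {}"
      unfolding set_map[of "edge _ _"] set_upt atLeast0LessThan lessThan_def by blast
    moreover have "distinct (map fst (stream \<tau> Ms ws))" using Suc.prems by (intro Suc.IH) auto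
    ultimately show ?case unfolding split distinct_append by blast
  qed
  show "\<forall>(e, c)\<in>set (stream \<tau> Ms ws). e \<subseteq> {..<n} \<and> card e \<le> t \<and> linear_constr r e c"
  proof clarify
    fix e c assume "(e, c) \<in> set (stream \<tau> Ms ws)"
    then obtain k i where k: "k < \<tau>" "i < m" "e = edge k (Ms k) i" "c = sum_constr e (ws k i)"
      by (auto simp: stream_def batch_def)
    then have "e \<subseteq> {..<n} \<and> card e \<le> t"
      using edge_sum[of k "Ms k" i] assms by auto
    moreover have "linear_constr r e c"
      unfolding linear_constr_def k(4) sum_constr_def
      by (intro exI[of _ "\<lambda>_. 1"] exI[of _ "int (ws k i)"]) simp
    ultimately show "e \<subseteq> {..<n} \<and> card e \<le> t \<and> linear_constr r e c" by blast
  qed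
qed

lemma yes_stream_instance:
  assumes "\<sigma> \<in> set_pmf (yes_stream \<tau> x)" "\<tau> \<le> B * B"
  shows "stream_instance r t n \<sigma>"
  using yes_stream_support[OF assms(1)] stream_instance_stream[OF assms(2)] by blast

lemma no_stream_instance:
  assumes "\<sigma> \<in> set_pmf (no_stream \<tau>)" "\<tau> \<le> B * B"
  shows "stream_instance r t n \<sigma>"
  using no_stream_support[OF assms(1)] stream_instance_stream[OF assms(2)] by blast

text \<open>The hidden assignment satisfies every constraint, and no assignment can do better than
  the length of the stream.\<close>

lemma ug_opt_yes_stream:
  assumes \<sigma>: "\<sigma> \<in> set_pmf (yes_stream (B * B) x)" and x: "x \<in> vecs r {..<n}"
  shows "ug_opt r n (edges_of \<sigma>) (constr_of \<sigma>) = B * B * m"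
proof -
  obtain Ms where Ms: "\<forall>k<B * B. Ms k \<in> all_matchings" and eq: "\<sigma> = stream (B * B) Ms (\<lambda>k. labels k (Ms k) x)"
    using yes_stream_support[OF \<sigma>] by blast
  define y where "y = (\<lambda>i\<in>{..<n}. int (x i))"
  have sat: "c y" if "(e, c) \<in> set \<sigma>" for e c
  proof -
    from that obtain k i where k: "k < B * B" "i < m" "e = edge k (Ms k) i" "c = sum_constr e (labels k (Ms k) x i)"
      unfolding eq by (auto simp: stream_def batch_def)
    interpret block_matching "{..<n}" "vertex k" r t N m by (rule stage_matching[OF k(1)])
    have M: "Ms k \<in> all_matchings" using Ms k by blast
    have "(\<Sum>v\<in>e. 1 * y v) = (\<Sum>v\<in>e. int (x v))"
    proof (rule sum.cong[OF refl])
      fix v assume "v \<in> e"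
      then have "v \<in> {..<n}" using edge_sum(2)[OF k(1) M k(2)] k(3) by blast
      then show "1 * y v = int (x v)" by (simp add: y_def)
    qed
    also have "\<dots> = int (\<Sum>j<t. x (vertex k j (Ms k j i)))"
      unfolding k(3) edge_sum(1)[OF k(1) M k(2)] by simp
    finally have "(\<Sum>v\<in>e. 1 * y v) mod int r = int (labels k (Ms k) x i) mod int r"
      using k(2) by (simp add: labels_def label_def zmod_int)
    then show "c y" by (simp add: k(4) sum_constr_def cong_def)
  qed
  have "int (x i) \<in> {0..<int r}" if "i \<in> {..<n}" for i
    using PiE_mem[OF x that] by simp
  then have "y \<in> assignments r n"
    unfolding assignments_def y_def by (simp add: restrict_PiE_iff)
  then have "ug_opt r n (edges_of \<sigma>) (constr_of \<sigma>) = length \<sigma>"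
    using sat by (rule ug_opt_stream_satisfiable[OF yes_stream_instance[OF \<sigma> order_refl]])
  then show ?thesis by (simp add: eq length_stream)
qed

end

section \<open>No streams have small value\<close>

lemma pmf_bind_ge:
  assumes "\<And>x. x \<in> set_pmf M \<Longrightarrow> p \<le> pmf (f x) b"
  shows "p \<le> pmf (bind_pmf M f) b"
  unfolding pmf_bind using assms
  by (intro measure_pmf.integral_ge_const measure_pmf.integrable_const_bound[where B=1])
    (auto simp: AE_measure_pmf_iff pmf_le_1)

lemma pmf_bind_le_add_prob:
  assumes "\<And>x. x \<in> set_pmf M \<Longrightarrow> x \<notin> X \<Longrightarrow> pmf (f x) b \<le> p" and "p \<ge> 0"
  shows "pmf (bind_pmf M f) b \<le> p + measure_pmf.prob M X"
proof -
  have "pmf (bind_pmf M f) b \<le> (\<integral>x. p + indicator X x \<partial>measure_pmf M)"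
    unfolding pmf_bind
  proof (rule integral_mono_AE)
    show "integrable (measure_pmf M) (\<lambda>x. pmf (f x) b)"
      by (rule measure_pmf.integrable_const_bound[where B=1]) (auto simp: pmf_le_1)
    show "AE x in measure_pmf M. pmf (f x) b \<le> p + indicator X x"
      unfolding AE_measure_pmf_iff
    proof
      fix x assume "x \<in> set_pmf M"
      then show "pmf (f x) b \<le> p + indicator X x"
        using assms pmf_le_1[of "f x" b] by (cases "x \<in> X") auto
    qed
    show "integrable (measure_pmf M) (\<lambda>x. p + indicat_real X x)"
      by (rule measure_pmf.integrable_const_bound[where B="\<bar>p\<bar> + 1"]) (auto simp: indicator_def)
  qed
  also have "\<dots> = p + measure_pmf.prob M X"
  proof -
    have "integrable (measure_pmf M) (indicat_real X)"
      by (rule measure_pmf.integrable_const_bound[where B=1]) auto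
    then show ?thesis by simp
  qed
  finally show ?thesis .
qed

lemma card_assignments: "card (assignments r n) = r ^ n"
  by (simp add: assignments_def card_PiE)

lemma satisfied_append: "satisfied (\<sigma> @ \<sigma>') y = satisfied \<sigma> y + satisfied \<sigma>' y"
  by (simp add: satisfied_def)

context ug_construction
begin

text \<open>Exactly one right-hand side q < r agrees with y on the hyperedge.\<close>

lemma sum_constr_mgf:
  "(\<Sum>q<r. exp (l * of_bool (sum_constr e q y))) = real (r - 1) + exp l"
proof -
  define q0 where "q0 = nat ((\<Sum>i\<in>e. 1 * y i) mod int r)"
  have r: "int r > 0" using r2 by simp
  have q0: "q0 < r" "int q0 = (\<Sum>i\<in>e. 1 * y i) mod int r"
    using pos_mod_bound[OF r] pos_mod_sign[OF r] by (auto simp: q0_def nat_less_iff)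
  have iff: "sum_constr e q y \<longleftrightarrow> q = q0" if "q < r" for q
    using that q0(2) by (auto simp: sum_constr_def cong_def)
  have "(\<Sum>q<r. exp (l * of_bool (sum_constr e q y))) = (\<Sum>q<r. exp (l * of_bool (q = q0)))"
    by (intro sum.cong refl) (simp add: iff)
  also have "\<dots> = exp l + (\<Sum>q\<in>{..<r} - {q0}. exp (l * of_bool (q = q0)))"
    using q0 by (subst sum.remove[of _ q0]) auto
  also have "(\<Sum>q\<in>{..<r} - {q0}. exp (l * of_bool (q = q0))) = (\<Sum>q\<in>{..<r} - {q0}. 1)"
    by (intro sum.cong) auto
  also have "\<dots> = real (r - 1)" using q0 by (simp add: card_Diff_singleton)
  finally show ?thesis by simp
qed

lemma batch_mgf:
  "(\<Sum>w\<in>vecs r {..<m}. exp (l * real (satisfied (batch \<tau> M w) y))) = (real (r - 1) + exp l) ^ m"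
proof -
  have "exp (l * real (satisfied (batch \<tau> M w) y))
      = (\<Prod>i<m. exp (l * of_bool (sum_constr (edge \<tau> M i) (w i) y)))" for w
  proof -
    have "satisfied (batch \<tau> M w) y = (\<Sum>i<m. of_bool (sum_constr (edge \<tau> M i) (w i) y))"
      unfolding satisfied_def batch_def
      by (simp add: comp_def interv_sum_list_conv_sum_set_nat atLeast0LessThan)
    then have "l * real (satisfied (batch \<tau> M w) y) = (\<Sum>i<m. l * of_bool (sum_constr (edge \<tau> M i) (w i) y))"
      by (simp only: of_nat_sum of_nat_of_bool sum_distrib_left)
    then show ?thesis by (simp only: exp_sum finite_lessThan)
  qed
  then have "(\<Sum>w\<in>vecs r {..<m}. exp (l * real (satisfied (batch \<tau> M w) y)))
      = (\<Prod>i<m. \<Sum>q<r. exp (l * of_bool (sum_constr (edge \<tau> M i) q y)))"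
    by (simp add: prod_sum_PiE)
  then show ?thesis by (simp add: sum_constr_mgf)
qed

text \<open>For fixed y the number of satisfied constraints is binomial with success probability
  1/r, whatever the matchings are, because the labels are uniform and independent. Nonnegative
  integrals avoid integrability conditions.\<close>

lemma no_stream_mgf:
  "(\<integral>\<^sup>+\<sigma>. ennreal (exp (l * real (satisfied \<sigma> y))) \<partial>measure_pmf (no_stream \<tau>))
    = ennreal (((real (r - 1) + exp l) / real r) ^ (\<tau> * m))"
proof (induction \<tau>)
  case 0
  then show ?case by (simp add: satisfied_def)
next
  case (Suc \<tau>)
  define C where "C = ((real (r - 1) + exp l) / real r) ^ m"
  have C0: "C \<ge> 0" by (simp add: C_def add_nonneg_nonneg)
  have labels: "(\<integral>\<^sup>+w. ennreal (exp (l * real (satisfied (batch \<tau> M w) y))) \<partial>measure_pmf random_labels) = ennreal C" for M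
  proof -
    have "(\<integral>\<^sup>+w. ennreal (exp (l * real (satisfied (batch \<tau> M w) y))) \<partial>measure_pmf random_labels)
        = ennreal (\<Sum>w\<in>vecs r {..<m}. exp (l * real (satisfied (batch \<tau> M w) y))) / ennreal (real (card (vecs r {..<m})))"
      unfolding random_labels_def using vecs_nonempty[of "{..<m}"]
      by (subst nn_integral_pmf_of_set) (auto simp: sum_ennreal ennreal_of_nat_eq_real_of_nat)
    also have "\<dots> = ennreal C"
      using r2 unfolding batch_mgf
      by (subst divide_ennreal) (auto simp: C_def card_vecs power_divide intro!: add_nonneg_nonneg)
    finally show ?thesis .
  qed
  have "(\<integral>\<^sup>+\<sigma>. ennreal (exp (l * real (satisfied \<sigma> y))) \<partial>measure_pmf (no_stream (Suc \<tau>)))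
      = (\<integral>\<^sup>+\<sigma>. \<integral>\<^sup>+M. \<integral>\<^sup>+w. ennreal (exp (l * real (satisfied \<sigma> y))) * ennreal (exp (l * real (satisfied (batch \<tau> M w) y)))
          \<partial>measure_pmf random_labels \<partial>measure_pmf random_matching \<partial>measure_pmf (no_stream \<tau>))"
    by (simp add: satisfied_append exp_add distrib_left ennreal_mult)
  also have "\<dots> = (\<integral>\<^sup>+\<sigma>. ennreal (exp (l * real (satisfied \<sigma> y))) \<partial>measure_pmf (no_stream \<tau>)) * ennreal C"
    by (simp add: nn_integral_cmult nn_integral_multc labels measure_pmf.emeasure_space_1)
  also have "\<dots> = ennreal (((real (r - 1) + exp l) / real r) ^ (\<tau> * m) * C)"
    unfolding Suc using C0 by (simp add: ennreal_mult'')
  also have "((real (r - 1) + exp l) / real r) ^ (\<tau> * m) * C = ((real (r - 1) + exp l) / real r) ^ (Suc \<tau> * m)"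
    by (simp add: C_def power_add mult.commute)
  finally show ?case .
qed

lemma no_stream_tail:
  assumes l: "l \<ge> 0"
  shows "measure_pmf.prob (no_stream \<tau>) {\<sigma>. b \<le> real (satisfied \<sigma> y)}
    \<le> exp (- (l * b)) * ((real (r - 1) + exp l) / real r) ^ (\<tau> * m)"
proof -
  let ?C = "((real (r - 1) + exp l) / real r) ^ (\<tau> * m)"
  have "emeasure (no_stream \<tau>) {\<sigma>. b \<le> real (satisfied \<sigma> y)}
      = (\<integral>\<^sup>+\<sigma>. indicator {\<sigma>. b \<le> real (satisfied \<sigma> y)} \<sigma> \<partial>measure_pmf (no_stream \<tau>))"
    by simp
  also have "\<dots> \<le> (\<integral>\<^sup>+\<sigma>. ennreal (exp (- (l * b))) * ennreal (exp (l * real (satisfied \<sigma> y))) \<partial>measure_pmf (no_stream \<tau>))"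
  proof (rule nn_integral_mono)
    fix \<sigma>
    show "indicator {\<sigma>. b \<le> real (satisfied \<sigma> y)} \<sigma> \<le> ennreal (exp (- (l * b))) * ennreal (exp (l * real (satisfied \<sigma> y)))"
    proof (cases "b \<le> real (satisfied \<sigma> y)")
      case True
      then have "l * b \<le> l * real (satisfied \<sigma> y)" using l by (rule mult_left_mono)
      then have "1 \<le> exp (- (l * b) + l * real (satisfied \<sigma> y))" by simp
      then show ?thesis
        using True unfolding exp_add by (simp add: ennreal_mult[symmetric])
    qed simp
  qed
  also have "\<dots> = ennreal (exp (- (l * b)) * ?C)"
    by (simp add: nn_integral_cmult no_stream_mgf ennreal_mult' )
  finally show ?thesis
    by (simp add: measure_pmf.emeasure_eq_measure add_nonneg_nonneg)
qed

lemma no_stream_high_value: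
  assumes \<delta>: "0 < \<delta>" "\<delta> \<le> 1 / real r"
    and dense: "real n * ln (real r) + 3 \<le> real (B * B * m) * (\<delta>\<^sup>2 * real r / 4)"
  shows "measure_pmf.prob (no_stream (B * B))
    {\<sigma>. \<exists>y\<in>assignments r n. (1 / real r + \<delta>) * real (B * B * m) \<le> real (satisfied \<sigma> y)} \<le> 1 / 8"
proof -
  define E where "E = B * B * m"
  \<comment> \<open>The exponent per constraint is at most -l \<delta> + l^2 / r, minimised here
    with value -\<delta>^2 r / 4. The cap \<delta> <= 1/r keeps l in the range of
    \<open>exp_bound\<close>.\<close>
  define l where "l = \<delta> * real r / 2"
  define b where "b = (1 / real r + \<delta>) * real E"
  have r: "real r > 0" using r2 by simp
  have l: "0 \<le> l" "l \<le> 1" using \<delta> r by (auto simp: l_def field_simps)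
  have single: "measure_pmf.prob (no_stream (B * B)) {\<sigma>. b \<le> real (satisfied \<sigma> y)}
      \<le> exp (- (real E * (\<delta>\<^sup>2 * real r / 4)))" for y
  proof -
    have "(real (r - 1) + exp l) / real r = 1 + (exp l - 1) / real r"
      using r r2 by (simp add: field_simps of_nat_diff)
    also have "\<dots> \<le> exp ((exp l - 1) / real r)" by (rule exp_ge_add_one_self)
    also have "\<dots> \<le> exp ((l + l\<^sup>2) / real r)"
      using exp_bound[OF l] r by (simp add: divide_right_mono)
    finally have "((real (r - 1) + exp l) / real r) ^ E \<le> exp ((l + l\<^sup>2) / real r) ^ E"
      by (rule power_mono) (simp add: add_nonneg_nonneg)
    also have "\<dots> = exp (real E * ((l + l\<^sup>2) / real r))" by (rule exp_of_nat_mult[symmetric])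
    finally have "exp (- (l * b)) * ((real (r - 1) + exp l) / real r) ^ E
        \<le> exp (- (l * b)) * exp (real E * ((l + l\<^sup>2) / real r))"
      by (rule mult_left_mono) simp
    also have "\<dots> = exp (- (l * b) + real E * ((l + l\<^sup>2) / real r))" by (rule exp_add[symmetric])
    also have "- (l * b) + real E * ((l + l\<^sup>2) / real r) = - (real E * (\<delta>\<^sup>2 * real r / 4))"
      using r unfolding b_def l_def by (simp add: field_simps power2_eq_square)
    finally show ?thesis
      using no_stream_tail[OF l(1), of "B * B" b y] by (simp add: E_def)
  qed
  have "measure_pmf.prob (no_stream (B * B)) {\<sigma>. \<exists>y\<in>assignments r n. b \<le> real (satisfied \<sigma> y)}
      = measure_pmf.prob (no_stream (B * B)) (\<Union>y\<in>assignments r n. {\<sigma>. b \<le> real (satisfied \<sigma> y)})"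
    by (rule arg_cong[where f="measure_pmf.prob _"]) auto
  also have "\<dots> \<le> (\<Sum>y\<in>assignments r n. measure_pmf.prob (no_stream (B * B)) {\<sigma>. b \<le> real (satisfied \<sigma> y)})"
    by (rule measure_pmf.finite_measure_subadditive_finite) (auto simp: finite_assignments)
  also have "\<dots> \<le> (\<Sum>y\<in>assignments r n. exp (- (real E * (\<delta>\<^sup>2 * real r / 4))))"
    by (rule sum_mono[OF single])
  also have "\<dots> = real r ^ n * exp (- (real E * (\<delta>\<^sup>2 * real r / 4)))"
    by (simp add: card_assignments)
  also have "real r ^ n = exp (real n * ln (real r))"
    using r by (simp add: exp_of_nat_mult)
  also have "exp (real n * ln (real r)) * exp (- (real E * (\<delta>\<^sup>2 * real r / 4)))
      = exp (real n * ln (real r) + - (real E * (\<delta>\<^sup>2 * real r / 4)))"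
    by (rule exp_add[symmetric])
  \<comment> \<open>The slack 3 in \<open>dense\<close> is chosen so that e^(-3) <= 1/8.\<close>
  also have "\<dots> \<le> exp (- 3)" using dense by (simp add: E_def)
  also have "\<dots> = 1 / exp 1 ^ 3" by (simp add: exp_minus field_simps flip: exp_of_nat_mult)
  also have "\<dots> \<le> 1 / 2 ^ 3"
  proof -
    have "(2 :: real) ^ 3 \<le> exp 1 ^ 3"
      using exp_ge_add_one_self[of 1] by (intro power_mono) auto
    then show ?thesis by (intro divide_left_mono) auto
  qed
  finally show ?thesis by (simp add: b_def E_def)
qed

text \<open>The output is tested against \<theta>, the value of a yes stream divided by \<gamma>.
  Yes streams pass with probability at least 2/3; no streams pass with probability at most 1/3, plus
  1/8 for those of exceptionally high value. The difference is 5/24, and the hybrid argument bounds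
  it from above.\<close>

lemma space_forces_advantage:
  assumes A: "ug_approx r t n \<gamma> (2/3) A" and space: "ug_space_at_most r t n A s"
    and m: "m > 0" and \<delta>: "0 < \<delta>" "\<delta> \<le> 1 / real r" "1 / real r + \<delta> < 1 / \<gamma>"
    and dense: "real n * ln (real r) + 3 \<le> real (B * B * m) * (\<delta>\<^sup>2 * real r / 4)"
    and sparse: "(64 * r)\<^sup>2 * m \<le> N"
    and \<kappa>: "0 \<le> \<kappa>" "\<kappa> \<le> 1/2"
    and S: "(64 * real r * real S) ^ t \<le> (\<kappa> * real t) ^ t * real N ^ (t - 1)"
  shows "5 / 24 \<le> real (B * B) * (sqrt (2 * \<kappa> ^ t + (1/2) ^ (S div 2)) + 2 ^ Suc s * (1/2) ^ S)"
proof -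
  define \<theta> where "\<theta> = real (B * B * m) / \<gamma>"
  define out where "out \<sigma> = map_pmf (\<lambda>y. y \<in> {\<theta>..}) (output_dist A \<sigma>)" for \<sigma>
  define X where "X = {\<sigma>. \<exists>y\<in>assignments r n. (1 / real r + \<delta>) * real (B * B * m) \<le> real (satisfied \<sigma> y)}"
  have Bm: "real (B * B * m) > 0" using m B_pos by simp
  have yes: "2/3 \<le> pmf (bind_pmf hidden (\<lambda>x. bind_pmf (yes_stream (B * B) x) out)) True"
  proof (intro pmf_bind_ge)
    fix x \<sigma> assume "x \<in> set_pmf hidden" and \<sigma>: "\<sigma> \<in> set_pmf (yes_stream (B * B) x)"
    then have x: "x \<in> vecs r {..<n}"
      using vecs_nonempty[of "{..<n}"] by (simp add: hidden_def)
    show "2/3 \<le> pmf (out \<sigma>) True"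
      unfolding out_def using ug_opt_yes_stream[OF \<sigma> x]
      by (intro ug_approx_accepts[OF A yes_stream_instance[OF \<sigma> order_refl]]) (simp add: \<theta>_def)
  qed
  have no: "pmf (bind_pmf (no_stream (B * B)) out) True \<le> 1/3 + measure_pmf.prob (no_stream (B * B)) X"
  proof (intro pmf_bind_le_add_prob)
    fix \<sigma> assume \<sigma>: "\<sigma> \<in> set_pmf (no_stream (B * B))" and X: "\<sigma> \<notin> X"
    note inst = no_stream_instance[OF \<sigma> order_refl]
    have "real (ug_opt r n (edges_of \<sigma>) (constr_of \<sigma>)) \<le> (1 / real r + \<delta>) * real (B * B * m)"
      using X r2 by (intro ug_opt_stream_le[OF inst]) (auto simp: X_def)
    also have "\<dots> < 1 / \<gamma> * real (B * B * m)"
      using \<delta>(3) Bm by (rule mult_strict_right_mono)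
    finally have "real (ug_opt r n (edges_of \<sigma>) (constr_of \<sigma>)) < \<theta>" by (simp add: \<theta>_def)
    from ug_approx_rejects[OF A inst this] show "pmf (out \<sigma>) True \<le> 1/3" by (simp add: out_def)
  qed simp
  have bad: "measure_pmf.prob (no_stream (B * B)) X \<le> 1 / 8"
    unfolding X_def by (rule no_stream_high_value[OF \<delta>(1,2) dense])
  have "\<bar>pmf (bind_pmf hidden (\<lambda>x. bind_pmf (yes_stream (B * B) x) out)) True
      - pmf (bind_pmf (no_stream (B * B)) out) True\<bar>
    \<le> real (B * B) * (sqrt (2 * \<kappa> ^ t + (1/2) ^ (S div 2)) + 2 ^ Suc s * (1/2) ^ S)"
    unfolding out_def
  proof (rule yes_no_output_distance[OF t2 sparse \<kappa> S])
    fix \<tau> x \<sigma> \<omega> a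
    assume "\<tau> < B * B" "\<sigma> \<in> set_pmf (yes_stream \<tau> x)" "\<omega> \<in> set_pmf (tape A)" "a \<in> set_pmf (memory_after A \<omega> \<sigma>)"
    \<comment> \<open>A yes stream cut off after fewer stages is itself a stream of an instance, so
      the space bound applies to the memory between stages.\<close>
    moreover from this have "stream_instance r t n \<sigma>" by (intro yes_stream_instance) auto
    ultimately show "length a \<le> s"
      using space unique_games_stream stream_in_ug_streams unfolding ug_space_at_most_def by blast
  qed
  then show ?thesis using yes no bad by linarith
qed

end

text \<open>With no memory the output law is the same for the empty stream and for a single
  satisfiable constraint, although the correct answers are 0 and a number of size at least
  1/\<gamma>. This settles small n, where one bit is all that is claimed.\<close>

lemma space_positive:
  assumes A: "ug_approx r t n \<gamma> (2/3) A" and space: "ug_space_at_most r t n A s"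
    and n: "n > 0" and t: "t > 0" and r: "r > 0"
  shows "s > 0"
proof (rule ccontr)
  assume "\<not> s > 0"
  then have s: "s = 0" by simp
  define c :: constr where "c = (\<lambda>x. [(\<Sum>i\<in>{0}. 1 * x i) = 0] (mod int r))"
  define \<sigma> where "\<sigma> = [({0 :: nat}, c)]"
  have \<gamma>: "\<gamma> > 0" using A by (simp add: ug_approx_def)
  have "linear_constr r {0} c"
    unfolding linear_constr_def c_def by (intro exI[of _ "\<lambda>_. 1"] exI[of _ 0]) simp
  then have inst: "stream_instance r t n \<sigma>" "stream_instance r t n []"
    using n t by (auto simp: stream_instance_def \<sigma>_def)
  have mem: "memory_after A \<omega> \<rho> = return_pmf []" if "\<omega> \<in> set_pmf (tape A)" "stream_instance r t n \<rho>" for \<omega> \<rho>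
  proof -
    have "set_pmf (memory_after A \<omega> \<rho>) \<subseteq> {[]}"
      using space unique_games_stream[OF that(2)] stream_in_ug_streams[OF that(2)] that(1)
      unfolding ug_space_at_most_def s by fastforce
    then show ?thesis by (simp add: set_pmf_subset_singleton)
  qed
  have out: "output_dist A \<sigma> = output_dist A []"
    unfolding output_dist_def using inst by (intro bind_pmf_cong refl) (simp add: mem)
  have "ug_opt r n (edges_of \<sigma>) (constr_of \<sigma>) = length \<sigma>"
    using r by (intro ug_opt_stream_satisfiable[OF inst(1), of "\<lambda>i\<in>{..<n}. 0"])
      (auto simp: assignments_def \<sigma>_def c_def n)
  then have "2/3 \<le> pmf (map_pmf (\<lambda>y. y \<in> {1 / \<gamma>..}) (output_dist A \<sigma>)) True"
    by (intro ug_approx_accepts[OF A inst(1)]) (simp add: \<sigma>_def)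
  moreover have "real (ug_opt r n (edges_of []) (constr_of [])) \<le> 0"
    using r by (intro ug_opt_stream_le[OF inst(2)]) (auto simp: satisfied_def)
  then have "pmf (map_pmf (\<lambda>y. y \<in> {1 / \<gamma>..}) (output_dist A [])) True \<le> 1 - 2/3"
    using \<gamma> by (intro ug_approx_rejects[OF A inst(2)]) (auto intro: le_less_trans)
  ultimately show False by (simp add: out)
qed

section \<open>Choice of the parameters\<close>

lemma square_le_four_power: "(real t)\<^sup>2 \<le> 4 ^ t"
proof -
  have "real t \<le> 2 ^ t" using of_nat_less_two_power[of t, where 'a=real] by simp
  then have "(real t)\<^sup>2 \<le> (2 ^ t)\<^sup>2" by (rule power_mono) simp
  also have "\<dots> = (4 :: real) ^ t"
    by (simp add: power_even_eq[symmetric] power_mult[symmetric] mult.commute[of t] flip: power_mult) (simp add: power_mult)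
  finally show ?thesis .
qed

text \<open>There are B0^2 t^2 stages and each loses at most 3 P with P = 2^(-p t). In p the summand
  18 B0^2 pays for 3 * 6 * B0^2 and the summand 2 for t^2 <= 4^t. The target 1/6 is below
  5/24.\<close>

lemma advantage_bound:
  fixes B0 p t S s :: nat
  assumes p: "p = 18 * B0\<^sup>2 + 2" and t: "t \<ge> 2" and S: "4 * p * t \<le> S" "2 * s + 2 \<le> S"
  shows "real ((B0 * t) * (B0 * t)) * (sqrt (2 * ((1/4) ^ p) ^ t + (1/2) ^ (S div 2)) + 2 ^ Suc s * (1/2) ^ S) \<le> 1/6"
proof -
  define P where "P = (1/2 :: real) ^ (p * t)"
  define h where "h = S div 2"
  have P0: "P > 0" and P1: "P \<le> 1" by (simp_all add: P_def power_le_one)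
  have h: "2 * (p * t) \<le> h" "Suc s \<le> h" "h + Suc s \<le> S" using S by (auto simp: h_def)
  have kap: "((1/4 :: real) ^ p) ^ t = P\<^sup>2"
  proof -
    have "(1/4 :: real) = (1/2)\<^sup>2" by (simp add: power2_eq_square)
    then have "((1/4 :: real) ^ p) ^ t = ((1/2)\<^sup>2) ^ (p * t)" by (simp only: power_mult)
    also have "\<dots> = P\<^sup>2" unfolding P_def by (simp only: power_mult[symmetric] mult.commute)
    finally show ?thesis .
  qed
  have half: "(1/2 :: real) ^ h \<le> P\<^sup>2"
  proof -
    have "(1/2 :: real) ^ h \<le> (1/2) ^ (2 * (p * t))" using h(1) by (intro power_decreasing) auto
    also have "\<dots> = P\<^sup>2" unfolding P_def by (simp only: power_mult[symmetric] mult.commute)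
    finally show ?thesis .
  qed
  have "2 * P\<^sup>2 + (1/2) ^ h \<le> 4 * P\<^sup>2" using half zero_le_power2[of P] by linarith
  then have "sqrt (2 * ((1/4) ^ p) ^ t + (1/2) ^ (S div 2)) \<le> sqrt ((2 * P)\<^sup>2)"
    unfolding kap h_def[symmetric] by (intro real_sqrt_le_mono) (simp add: power_mult_distrib)
  also have "\<dots> = 2 * P" by (rule real_sqrt_unique) (use P0 in simp_all)
  finally have 1: "sqrt (2 * ((1/4) ^ p) ^ t + (1/2) ^ (S div 2)) \<le> 2 * P" .
  have "2 ^ Suc s * (1/2 :: real) ^ S \<le> 2 ^ Suc s * (1/2) ^ (h + Suc s)"
    using h(3) by (intro mult_left_mono power_decreasing) auto
  also have "\<dots> = (1/2) ^ h * (2 * (1/2)) ^ Suc s"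
    unfolding power_mult_distrib power_add by (simp only: mult_ac)
  also have "\<dots> = (1/2) ^ h" by simp
  also have "\<dots> \<le> P" using half P0 P1 mult_left_le[of P P] unfolding power2_eq_square by linarith
  finally have 2: "2 ^ Suc s * (1/2 :: real) ^ S \<le> P" .
  have "real ((B0 * t) * (B0 * t)) * (sqrt (2 * ((1/4) ^ p) ^ t + (1/2) ^ (S div 2)) + 2 ^ Suc s * (1/2) ^ S)
      \<le> real ((B0 * t) * (B0 * t)) * (3 * P)"
    using 1 2 by (intro mult_left_mono) auto
  also have "\<dots> = 3 * (real B0)\<^sup>2 * (real t)\<^sup>2 * P" by (simp add: power2_eq_square)
  also have "\<dots> \<le> 1/6"
  proof -
    have "18 * (real B0)\<^sup>2 = real (18 * B0\<^sup>2)" by simp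
    also have "\<dots> \<le> 2 ^ (18 * B0\<^sup>2)" by (rule of_nat_less_two_power[THEN less_imp_le])
    also have "\<dots> \<le> 2 ^ (18 * B0\<^sup>2 * t)" using t by (intro power_increasing) auto
    finally have "18 * (real B0)\<^sup>2 * (real t)\<^sup>2 \<le> 2 ^ (18 * B0\<^sup>2 * t) * 4 ^ t"
      using square_le_four_power by (intro mult_mono) auto
    also have "\<dots> = 2 ^ (18 * B0\<^sup>2 * t) * (2\<^sup>2) ^ t" by simp
    also have "\<dots> = 2 ^ (18 * B0\<^sup>2 * t + 2 * t)" by (simp only: power_mult power_add)
    also have "18 * B0\<^sup>2 * t + 2 * t = p * t" by (simp add: p algebra_simps)
    finally have "18 * (real B0)\<^sup>2 * (real t)\<^sup>2 * P \<le> 2 ^ (p * t) * P"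
      using P0 by (intro mult_right_mono) auto
    also have "\<dots> = 1" by (simp add: P_def power_one_over)
    finally show ?thesis by simp
  qed
  finally show ?thesis .
qed

text \<open>If s were smaller, all stages together would lose at most 1/6, against the 5/24 of
  \<open>space_forces_advantage\<close>. Here q is the sparsity N / m, and the construction uses B =
  B0 t. The 2 B + t - 2 blocks of q m vertices occupy at most 3 B0 q t m <= n vertices, which
  explains the choice of m.\<close>

lemma memory_lower_bound:
  fixes r B0 p m t n s :: nat and \<gamma> \<delta> a :: real and A :: streaming_alg
  defines "q \<equiv> (64 * r)\<^sup>2"
  assumes r: "r \<ge> 2" and t: "t \<ge> 2"
    and \<delta>: "0 < \<delta>" "\<delta> \<le> 1 / real r" "1 / real r + \<delta> < 1 / \<gamma>"
    and B0: "B0 > 0" "6 * real q * real r + 3 \<le> real B0 * (\<delta>\<^sup>2 * real r / 4)"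
    and p: "p = 18 * B0\<^sup>2 + 2" and a: "a = (1/4) ^ p / (64 * real r)"
    and m: "m = n div (3 * B0 * q * t)" "m > 0" "4 * real p + 2 \<le> a * sqrt (real m)"
    and A: "ug_approx r t n \<gamma> (2/3) A" and space: "ug_space_at_most r t n A s"
  shows "a / (8 * real (3 * B0 * q)) * (real n / real t) powr (1 - 1 / real t) \<le> real s"
proof (rule ccontr)
  define K where "K = 3 * B0 * q"
  define B where "B = B0 * t"
  define N where "N = q * m"
  define y where "y = real N powr (1 - 1 / real t)"
  \<comment> \<open>The largest S allowed by the hypothesis of \<open>fourier_mass_le\<close> with
    \<kappa> = 4^(-p), since a = \<kappa> / (64 r).\<close>
  define S where "S = nat \<lfloor>a * real t * y\<rfloor>"
  assume "\<not> ?thesis"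
  then have s: "real s < a / (8 * real K) * (real n / real t) powr (1 - 1 / real t)"
    by (simp add: K_def)
  have q: "q \<ge> 1" using r by (simp add: q_def)
  have K: "K \<ge> 1" using B0 q by (simp add: K_def)
  have a0: "a > 0" using r by (simp add: a)
  have mN: "m \<le> N" using q by (simp add: N_def)
  have N1: "real N \<ge> 1" using mN m(2) by simp
  have Kt: "K * t > 0" using K t by simp
  have n_low: "K * t * m \<le> n"
    unfolding m(1) K_def by (metis div_times_less_eq_dividend mult.commute)
  have n_up: "n < (m + 1) * (K * t)"
    using dividend_less_div_times[OF Kt, of n] by (simp add: m(1) K_def mult.commute)
  also have "\<dots> \<le> (2 * m) * (K * t)" using m(2) by (intro mult_le_mono1) simp
  finally have n_up2: "real n \<le> 2 * real m * (real K * real t)"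
    by (metis (no_types, lifting) less_imp_le of_nat_le_iff of_nat_mult of_nat_numeral)
  \<comment> \<open>The exponent is at least 1/2 for every t >= 2, so y >= sqrt m; this makes the
    lower bound required of m independent of t.\<close>
  have exponent: "1/2 \<le> 1 - 1 / real t" "1 - 1 / real t \<le> 1" using t by (auto simp: field_simps)
  have "sqrt (real m) \<le> sqrt (real N)" using mN by simp
  also have "\<dots> = real N powr (1/2)" using N1 by (simp add: powr_half_sqrt)
  also have "\<dots> \<le> y" unfolding y_def using exponent N1 by (intro powr_mono) auto
  finally have "a * sqrt (real m) \<le> a * y" using a0 by (intro mult_left_mono) auto
  then have ay: "4 * real p + 2 \<le> a * y" using m(3) by linarith
  have y0: "y > 0" using N1 by (simp add: y_def)
  have aty: "2 * (a * y) \<le> a * real t * y"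
    using t a0 y0 by (simp add: mult_right_mono mult_left_mono)
  have S_le: "real S \<le> a * real t * y"
    using a0 y0 by (simp add: S_def)
  have S_ge: "a * real t * y - 1 < real S"
    unfolding S_def using a0 y0 by linarith
  \<comment> \<open>As n / t <= 2 K N, the assumption gives s < a y / 4, whereas S > a t y - 1 >= 2
    a y - 1 with a y >= 4 p + 2.\<close>
  have "s * 2 + 2 \<le> S"
  proof -
    have "real n / real t \<le> 2 * real K * real m"
      using n_up2 t by (simp add: divide_le_eq mult_ac)
    also have "\<dots> \<le> 2 * real K * real N" using mN by (intro mult_left_mono) auto
    finally have "(real n / real t) powr (1 - 1 / real t) \<le> (2 * real K * real N) powr (1 - 1 / real t)"
      using exponent by (intro powr_mono2) auto
    also have "\<dots> = (2 * real K) powr (1 - 1 / real t) * y"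
      using K N1 unfolding y_def by (intro powr_mult)
    also have "\<dots> \<le> (2 * real K) powr 1 * y"
      using K exponent y0 by (intro mult_right_mono powr_mono) auto
    also have "\<dots> = 2 * real K * y" using K by simp
    finally have "a / (8 * real K) * (real n / real t) powr (1 - 1 / real t) \<le> a / (8 * real K) * (2 * real K * y)"
      using a0 by (intro mult_left_mono) auto
    also have "\<dots> = a * y / 4" using K by (simp add: field_simps)
    finally have "2 * real s + 2 < real S + 1" using s S_ge aty ay by linarith
    then show ?thesis by linarith
  qed
  moreover have "4 * p * t \<le> S"
  proof -
    have "real t * (4 * real p + 2) \<le> real t * (a * y)" using ay by (intro mult_left_mono) auto
    then have "4 * real p * real t + 1 \<le> a * real t * y" using t by (simp add: algebra_simps)
    then have "real (4 * p * t) < real S" using S_ge by simp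
    then show ?thesis by (simp only: of_nat_less_iff less_imp_le)
  qed
  ultimately have small: "real (B * B) * (sqrt (2 * ((1/4) ^ p) ^ t + (1/2) ^ (S div 2)) + 2 ^ Suc s * (1/2) ^ S) \<le> 1/6"
    unfolding B_def by (intro advantage_bound[OF p t]) auto
  have "(2 * B + t - 2) * N \<le> (3 * B0 * t) * N"
  proof (rule mult_le_mono1)
    have "t \<le> B0 * t" using B0 by simp
    then show "2 * B + t - 2 \<le> 3 * B0 * t" unfolding B_def by linarith
  qed
  also have "\<dots> = K * t * m" by (simp add: K_def N_def)
  finally interpret ug_construction r t n B N m
    using r t B0 mN n_low by unfold_locales (auto simp: B_def)
  have "5 / 24 \<le> real (B * B) * (sqrt (2 * ((1/4) ^ p) ^ t + (1/2) ^ (S div 2)) + 2 ^ Suc s * (1/2) ^ S)"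
  proof (rule space_forces_advantage[OF A space m(2) \<delta>])
    show "(64 * r)\<^sup>2 * m \<le> N" by (simp add: N_def q_def)
    show "0 \<le> ((1/4) ^ p :: real)" by simp
    have "(1/4 :: real) ^ p \<le> (1/4) ^ 1" using p by (intro power_decreasing) auto
    then show "(1/4 :: real) ^ p \<le> 1/2" by simp
    have yt: "y ^ t = real N ^ (t - 1)"
    proof -
      have "y ^ t = y powr real t" using y0 by (simp add: powr_realpow)
      also have "\<dots> = real N powr ((1 - 1 / real t) * real t)" unfolding y_def by (rule powr_powr)
      also have "(1 - 1 / real t) * real t = real (t - 1)" using t by (simp add: field_simps of_nat_diff)
      also have "real N powr real (t - 1) = real N ^ (t - 1)" using N1 by (intro powr_realpow) simp
      finally show ?thesis .
    qed
    have "64 * real r * real S \<le> 64 * real r * (a * real t * y)" using S_le by (intro mult_left_mono) auto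
    also have "\<dots> = (1/4) ^ p * real t * y" using r by (simp add: a)
    finally have "(64 * real r * real S) ^ t \<le> ((1/4) ^ p * real t * y) ^ t" by (rule power_mono) simp
    also have "\<dots> = ((1/4) ^ p * real t) ^ t * real N ^ (t - 1)" by (simp only: power_mult_distrib yt)
    finally show "(64 * real r * real S) ^ t \<le> ((1/4) ^ p * real t) ^ t * real N ^ (t - 1)" .
    \<comment> \<open>There are B0^2 t^2 m constraints, while n log r is at most 6 B0 q r t m. The
      surplus factor B0 absorbs the constants in r and \<delta>, and the surplus t is
      dropped.\<close>
    have "ln (real r) \<le> real r" using r ln_le_minus_one[of "real r"] by simp
    then have "real n * ln (real r) \<le> (2 * real m * (real K * real t)) * real r"
      using n_up2 r by (intro mult_mono) auto
    also have "\<dots> = real B0 * real t * real m * (6 * real q * real r)" by (simp add: K_def)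
    finally have log: "real n * ln (real r) \<le> real B0 * real t * real m * (6 * real q * real r)" .
    have "real n * ln (real r) + 3 \<le> real B0 * real t * real m * (6 * real q * real r) + real B0 * real t * real m * 3"
    proof -
      have "1 \<le> B0 * t * m" using B0 t m(2) by simp
      then have "1 \<le> real B0 * real t * real m" by (metis of_nat_1 of_nat_le_iff of_nat_mult)
      then show ?thesis using log by linarith
    qed
    also have "\<dots> = real B0 * real t * real m * (6 * real q * real r + 3)" by (simp add: algebra_simps)
    also have "\<dots> \<le> real B0 * real t * real m * (real B0 * (\<delta>\<^sup>2 * real r / 4))"
      using B0(2) by (intro mult_left_mono) auto
    also have "\<dots> \<le> real t * (real B0 * real t * real m * (real B0 * (\<delta>\<^sup>2 * real r / 4)))"
      using t mult_right_mono[of 1 "real t" "real B0 * real t * real m * (real B0 * (\<delta>\<^sup>2 * real r / 4))"] by simp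
    also have "\<dots> = real (B * B * m) * (\<delta>\<^sup>2 * real r / 4)" by (simp add: B_def)
    finally show "real n * ln (real r) + 3 \<le> real (B * B * m) * (\<delta>\<^sup>2 * real r / 4)" .
  qed
  then show False using small by simp
qed

theorem theorem4p16:
  fixes r :: nat and \<epsilon> :: real
  assumes "r \<ge> 2" and "\<epsilon> > 0"
  shows "\<exists>c>0. \<forall>t\<ge>2. \<forall>n. \<forall>A s.
           ug_approx r t n (real r - \<epsilon>) (2/3) A \<and> ug_space_at_most r t n A s \<longrightarrow>
             real s \<ge> c * (real n / real t) powr (1 - 1 / real t)"
proof (cases "real r - \<epsilon> > 0")
  case False
  \<comment> \<open>For \<epsilon> >= r no algorithm qualifies, because \<open>ug_approx\<close>
    demands a positive factor.\<close>
  then show ?thesis by (intro exI[of _ 1]) (auto simp: ug_approx_def)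
next
  case True
  define \<gamma> where "\<gamma> = real r - \<epsilon>"
  \<comment> \<open>Half of the gap between 1/r and 1/\<gamma>, capped at 1/r as the Chernoff bound
    requires.\<close>
  define \<delta> where "\<delta> = min (1 / real r) ((1 / \<gamma> - 1 / real r) / 2)"
  define q where "q = (64 * r)\<^sup>2"
  have \<gamma>: "0 < \<gamma>" "\<gamma> < real r" using True assms by (auto simp: \<gamma>_def)
  then have gap: "1 / real r < 1 / \<gamma>" by (intro divide_strict_left_mono) auto
  then have \<delta>: "0 < \<delta>" "\<delta> \<le> 1 / real r" "1 / real r + \<delta> < 1 / \<gamma>"
  proof -
    show "\<delta> \<le> 1 / real r" unfolding \<delta>_def by (rule min.cobounded1)
    show "0 < \<delta>" using gap assms by (simp add: \<delta>_def)
    have "\<delta> \<le> (1 / \<gamma> - 1 / real r) / 2" unfolding \<delta>_def by (rule min.cobounded2)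
    moreover have "u + d < v" if "d \<le> (v - u) / 2" "u < v" for u v d :: real
    proof -
      have "2 * d \<le> v - u" using that(1) by simp
      then show ?thesis using that(2) by linarith
    qed
    ultimately show "1 / real r + \<delta> < 1 / \<gamma>" using gap by blast
  qed
  have D: "\<delta>\<^sup>2 * real r / 4 > 0" using \<delta>(1) assms by simp
  \<comment> \<open>From here to c every parameter is chosen from r and \<epsilon> alone, which
    makes c uniform in t and n.\<close>
  obtain B0 :: nat where B0: "(6 * real q * real r + 3) / (\<delta>\<^sup>2 * real r / 4) \<le> real B0"
    using real_arch_simple by blast
  have B0': "6 * real q * real r + 3 \<le> real B0 * (\<delta>\<^sup>2 * real r / 4)"
    using B0 D by (simp only: pos_divide_le_eq)
  have "0 < (6 * real q * real r + 3) / (\<delta>\<^sup>2 * real r / 4)"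
    using D by (intro divide_pos_pos) (auto intro: add_nonneg_pos)
  then have B0_pos: "B0 > 0" using B0 by simp
  define p where "p = 18 * B0\<^sup>2 + 2"
  define a where "a = (1/4 :: real) ^ p / (64 * real r)"
  define K where "K = 3 * B0 * q"
  have a: "a > 0" using assms by (simp add: a_def)
  have K: "K > 0" using B0_pos assms by (simp add: K_def q_def)
  obtain m0 :: nat where m0: "((4 * real p + 2) / a)\<^sup>2 \<le> real m0"
    using real_arch_simple by blast
  \<comment> \<open>The first value serves for n / (K t) large. Otherwise n / t <= K (m0 + 1), and
    the second value makes the claimed bound at most 1, which \<open>space_positive\<close>
    provides.\<close>
  define c where "c = min (a / (8 * real K)) (1 / (real (K * (m0 + 1)) + 1))"
  have c: "c > 0" using a K by (simp add: c_def add_nonneg_pos)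
  have "real s \<ge> c * (real n / real t) powr (1 - 1 / real t)"
    if t: "t \<ge> 2" and A: "ug_approx r t n \<gamma> (2/3) A" and space: "ug_space_at_most r t n A s" for t n A s
  proof (cases "n div (K * t) > m0")
    case True
    define m where "m = n div (K * t)"
    have "(4 * real p + 2) / a \<le> sqrt (real m)"
      using m0 True by (intro real_le_rsqrt) (simp add: m_def)
    then have large: "4 * real p + 2 \<le> a * sqrt (real m)"
      using a by (simp add: divide_le_eq mult.commute)
    have m: "m = n div (3 * B0 * q * t)" "m > 0" using True by (auto simp: m_def K_def)
    have "a / (8 * real K) * (real n / real t) powr (1 - 1 / real t) \<le> real s"
      using memory_lower_bound[OF assms(1) t \<delta> B0_pos B0'[unfolded q_def] p_def a_def m[unfolded q_def] large A space]
      by (simp add: K_def q_def)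
    moreover have "c * (real n / real t) powr (1 - 1 / real t) \<le> a / (8 * real K) * (real n / real t) powr (1 - 1 / real t)"
      by (intro mult_right_mono) (auto simp: c_def)
    ultimately show ?thesis by linarith
  next
    case False
    show ?thesis
    \<comment> \<open>For n = 0 the claimed bound is 0, since \<open>powr\<close> with base 0 is
      0.\<close>
    proof (cases "n = 0")
      case False
      then have s: "s > 0" using space_positive[OF A space] t assms(1) by simp
      define z where "z = real n / real t"
      have Kt: "K * t > 0" using K t by simp
      have "n < (n div (K * t) + 1) * (K * t)"
        using dividend_less_div_times[OF Kt, of n] by (simp add: mult.commute)
      also have "\<dots> \<le> (m0 + 1) * (K * t)" using \<open>\<not> n div (K * t) > m0\<close> by (intro mult_le_mono1) simp
      also have "\<dots> = K * (m0 + 1) * t" by (simp only: mult_ac)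
      finally have "n \<le> K * (m0 + 1) * t" by (rule less_imp_le)
      then have "real n \<le> real (K * (m0 + 1)) * real t" by (metis of_nat_le_iff of_nat_mult)
      then have z: "0 \<le> z" "z \<le> real (K * (m0 + 1))" using t by (auto simp: z_def divide_le_eq)
      have e: "0 \<le> 1 - 1 / real t" "1 - 1 / real t \<le> 1" using t by (auto simp: field_simps)
      have "z powr (1 - 1 / real t) \<le> real (K * (m0 + 1)) + 1"
      proof (cases "z \<le> 1")
        case True
        then have "z powr (1 - 1 / real t) \<le> 1" using z e by (intro powr_le1) auto
        then show ?thesis by (rule order_trans) simp
      next
        case False
        then have "z powr (1 - 1 / real t) \<le> z powr 1" using e by (intro powr_mono) auto
        then show ?thesis using False z by simp
      qed
      then have "c * z powr (1 - 1 / real t) \<le> 1 / (real (K * (m0 + 1)) + 1) * (real (K * (m0 + 1)) + 1)"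
        using c by (intro mult_mono) (auto simp: c_def)
      also have "\<dots> = 1"
      proof -
        have "1 / X * X = 1" if "X > 0" for X :: real using that by simp
        then show ?thesis by (rule meta_mp) (rule add_nonneg_pos, simp_all only: of_nat_0_le_iff zero_less_one)
      qed
      also have "\<dots> \<le> real s" using s by simp
      finally show ?thesis by (simp add: z_def)
    qed simp
  qed
  then show ?thesis using c unfolding \<gamma>_def by blast
qed

end
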